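(* Let $K$ be a strongly proper and atomistic commutative iteration semiring. Then for each finite alphabet $\Sigma$, $K^{\mathrm{rat}}\langle\!\langle\Sigma^*\rangle\!\rangle$ is a free iteration $K$-semialgebra on $\Sigma$; that is, for every iteration $K$-semialgebra $A$ and every function $h:\Sigma\to A$ there is a unique morphism of iteration $K$-semialgebras $K^{\mathrm{rat}}\langle\!\langle\Sigma^*\rangle\!\rangle\to A$ extending $h$.
   Context: All semirings are nontrivial ($0\neq1$), with $x0=0=0x$. A Conway semiring is a semiring $S$ with a total operation ${}^*:S\to S$ satisfying $(a+b)^*=(a^*b)^*a^*$ and $(ab)^*=1+a(ba)^*b$ for all $a,b\in S$. Matrix star: for $M\in S^{n\times n}$, $M^*$ is defined inductively: $(a)^*=(a^* )$ for $n=1$, and for $n>1$, with $X$ of size $(n-1)\times(n-1)$ and $V$ of size $1\times1$, $$\begin{pmatrix}X&Y\\ U&V\end{pmatrix}^*=\begin{pmatrix}\alpha&\alpha YV^*\\ \delta UX^*&\delta\end{pmatrix},\quad \alpha=(X+YV^*U)^*,\ \delta=(V+UX^*Y)^*.$$ Group identities: for a finite group $G$ with elements $\{1,\dots,n\}$ let $M_G$ be the $n\times n$ matrix whose $(i,j)$ entry is the variable $x_{i^{-1}\cdot j}$ (inverse and product in $G$). The group identity of $G$ is $r_1+\dots+r_n=(x_1+\dots+x_n)^*$, where $r_1,\dots,r_n$ is the first row of $M_G^*$. An iteration semiring is a Conway semiring satisfying the group identities of all finite groups. Let $K$ be a commutative semiring with a star operation. A $K$-semialgebra is a semiring $A$ (with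 unit $e$) that is also a $K$-semimodule (action with $(k+k')a=ka+k'a$, $k(a+b)=ka+kb$, $(kk')a=k(k'a)$, $1a=a$, $0a=0$, $k0=0$) satisfying $k(ab)=(ka)b=a(kb)$. An iteration $K$-semialgebra is a $K$-semialgebra $A$ that is also an iteration semiring and satisfies $(ke)^*=k^*e$ for all $k\in K$. Morphisms preserve the semiring operations and constants, the $K$-action and the star. Series: $K\langle\!\langle\Sigma^*\rangle\!\rangle$ is the $K$-semialgebra of functions $s:\Sigma^*\to K$ with pointwise sum and action and Cauchy product; letters and elements of $K$ are identified with the corresponding series. $s$ is proper if its coefficient at the empty word is $0$; for proper $s$, $s^*$ is the unique solution of $x=sx+1$ and $s^+:=ss^*$. $K^{\mathrm{rat}}\langle\!\langle\Sigma^*\rangle\!\rangle$ is the set of series $k+b$ with $k\in K$ and $b$ generated from $\Sigma\cup\{0\}$ by sum, product, $K$-action and $^+$ (applied to proper series). When $K$ is a commutative iteration semiring, the star is extended to arbitrary series by $s^*=(k_0^*r)^*k_0^*$ where $s=k_0+r$ with $k_0\in K$, $r$ proper; this makes $K\langle\!\langle\Sigma^*\rangle\!\rangle$ and $K^{\mathrm{rat}}\langle\!\langle\Sigma^*\rangle\!\rangle$ iteration $K$-semialgebras. A $K$-automaton in $K\langle\!\langle\Sigma^*\rangle\!\rangle$ of dimension $n\ge1$ is a triple $(\alpha,M,\beta)$ with $\alpha\in K^{1\times n}$, $\beta\in K^{n\times1}$, $M\in(K\Sigma)^{n\times n}$, $K\Sigma$ being the set of $K$-linear combinations of letters. Its behavior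 is $\alpha M^*\beta$; automata are equivalent if they have the same behavior. A simulation $(\alpha,M,\beta)\to(\gamma,N,\delta)$ (dimensions $m,n$) is $X\in K^{m\times n}$ with $\alpha X=\gamma$, $MX=XN$, $\beta=X\delta$. It is functional if each row of $X$ has exactly one entry $1$ and all other entries $0$; dual functional if the same holds for columns; invertible diagonal if $X$ is diagonal with all diagonal entries units of $K$. $K$ is strongly proper if for every finite alphabet $\Sigma$, any two equivalent $K$-automata in $K\langle\!\langle\Sigma^*\rangle\!\rangle$ can be connected by a finite chain of functional, dual functional and invertible diagonal simulations (each link in either direction). A semiring $S$ is atomistic if whenever $x_1+\dots+x_m=y_1+\dots+y_n$ in $S$ ($m,n\ge1$), there are $z_1,\dots,z_k\in S$ and partitions $I_1,\dots,I_m$ and $J_1,\dots,J_n$ of $\{1,\dots,k\}$ into pairwise disjoint, possibly empty sets with $x_i=\sum_{\ell\in I_i}z_\ell$ and $y_j=\sum_{\ell\in J_j}z_\ell$ for all $i,j$. *)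

theory Defs
  imports
    "Jordan_Normal_Form.Matrix"
    "HOL-Library.FuncSet"
    "HOL-Library.Disjoint_Sets"
begin

class star =
  fixes star :: "'a \<Rightarrow> 'a"

section \<open>Matrix star\<close>

text \<open>
  The clause for dimension \<open>0\<close> only serves totality.  In the recursive clause the blocks are
  \<open>X\<close> of size \<open>(n-1) \<times> (n-1)\<close>, \<open>Y\<close>, \<open>U\<close> and the \<open>1 \<times> 1\<close> block \<open>V\<close>.
\<close>

fun mat_star_dim :: "nat \<Rightarrow> 'a::{semiring_1,star} mat \<Rightarrow> 'a mat" where
  "mat_star_dim 0 M = M"
| "mat_star_dim (Suc 0) M = mat 1 1 (\<lambda>_. star (M $$ (0,0)))"
| "mat_star_dim (Suc (Suc n)) M =
    (let (X, Y, U, V) = split_block M (Suc n) (Suc n);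
         \<alpha> = mat_star_dim (Suc n) (X + Y * mat_star_dim (Suc 0) V * U);
         \<delta> = mat_star_dim (Suc 0) (V + U * mat_star_dim (Suc n) X * Y)
     in four_block_mat
          \<alpha> (\<alpha> * Y * mat_star_dim (Suc 0) V)
          (\<delta> * U * mat_star_dim (Suc n) X) \<delta>)"

definition mat_star :: "'a::{semiring_1,star} mat \<Rightarrow> 'a mat" where
  "mat_star M = mat_star_dim (dim_row M) M"

section \<open>Iteration semirings and semialgebras\<close>

text \<open>
  All structures are given by a carrier \<open>A\<close>, a subset of a type with operations.  A structure
  that is a whole type is described by the carrier \<open>UNIV\<close>; proper carriers are needed for the
  rational series.  The semiring laws, including \<open>0 \<noteq> 1\<close>, are those of the class
  \<^class>\<open>semiring_1\<close> of the ambient type.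
\<close>

locale semiring_carrier =
  fixes A :: "'a::semiring_1 set"
  assumes zero_closed: "0 \<in> A"
    and one_closed: "1 \<in> A"
    and add_closed: "a \<in> A \<Longrightarrow> b \<in> A \<Longrightarrow> a + b \<in> A"
    and mult_closed: "a \<in> A \<Longrightarrow> b \<in> A \<Longrightarrow> a * b \<in> A"

locale conway_semiring = semiring_carrier A
  for A :: "'a::{semiring_1,star} set" +
  assumes star_closed: "a \<in> A \<Longrightarrow> star a \<in> A"
    and star_add: "a \<in> A \<Longrightarrow> b \<in> A \<Longrightarrow> star (a + b) = star (star a * b) * star a"
    and star_mult: "a \<in> A \<Longrightarrow> b \<in> A \<Longrightarrow> star (a * b) = 1 + a * star (b * a) * b"

definition group_mat :: "nat monoid \<Rightarrow> nat \<Rightarrow> (nat \<Rightarrow> 'a) \<Rightarrow> 'a mat" where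
  "group_mat G n x = mat n n (\<lambda>(i, j). x (inv\<^bsub>G\<^esub> i \<otimes>\<^bsub>G\<^esub> j))"

text \<open>
  Group elements are numbered from \<open>0\<close>, in accordance with matrix indices.  Every group structure
  on \<open>{0..<n}\<close> is considered; in particular, \<open>0\<close> need not be the neutral element.
\<close>

locale iteration_semiring = conway_semiring A
  for A :: "'a::{semiring_1,star} set" +
  assumes group_identity:
    "group G \<Longrightarrow> carrier G = {0..<n} \<Longrightarrow> (\<And>i. i < n \<Longrightarrow> x i \<in> A) \<Longrightarrow>
      (\<Sum>j<n. mat_star (group_mat G n x) $$ (0, j)) = star (\<Sum>i<n. x i)"

locale semialgebra = semiring_carrier A
  for A :: "'a::semiring_1 set" +
  fixes scale :: "'k::comm_semiring_1 \<Rightarrow> 'a \<Rightarrow> 'a"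
  assumes scale_closed: "a \<in> A \<Longrightarrow> scale k a \<in> A"
    and scale_add_left: "a \<in> A \<Longrightarrow> scale (k + k') a = scale k a + scale k' a"
    and scale_add_right: "a \<in> A \<Longrightarrow> b \<in> A \<Longrightarrow> scale k (a + b) = scale k a + scale k b"
    and scale_scale: "a \<in> A \<Longrightarrow> scale (k * k') a = scale k (scale k' a)"
    and scale_one: "a \<in> A \<Longrightarrow> scale 1 a = a"
    and scale_zero_left: "a \<in> A \<Longrightarrow> scale 0 a = 0"
    and scale_zero_right: "scale k 0 = 0"
    and scale_mult_left: "a \<in> A \<Longrightarrow> b \<in> A \<Longrightarrow> scale k (a * b) = scale k a * b"
    and scale_mult_right: "a \<in> A \<Longrightarrow> b \<in> A \<Longrightarrow> scale k (a * b) = a * scale k b"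

locale iteration_semialgebra = semialgebra A scale + iteration_semiring A
  for A :: "'a::{semiring_1,star} set"
    and scale :: "'k::{comm_semiring_1,star} \<Rightarrow> 'a \<Rightarrow> 'a" +
  assumes star_scale_one: "star (scale k 1) = scale (star k) 1"

locale iteration_semialgebra_hom =
  dom: iteration_semialgebra A scale + cod: iteration_semialgebra B scale'
  for A :: "'a::{semiring_1,star} set"
    and scale :: "'k::{comm_semiring_1,star} \<Rightarrow> 'a \<Rightarrow> 'a"
    and B :: "'b::{semiring_1,star} set"
    and scale' :: "'k \<Rightarrow> 'b \<Rightarrow> 'b"
    and f :: "'a \<Rightarrow> 'b" +
  assumes hom_closed: "f \<in> A \<rightarrow> B"
    and hom_zero: "f 0 = 0"
    and hom_one: "f 1 = 1"
    and hom_add: "a \<in> A \<Longrightarrow> b \<in> A \<Longrightarrow> f (a + b) = f a + f b"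
    and hom_mult: "a \<in> A \<Longrightarrow> b \<in> A \<Longrightarrow> f (a * b) = f a * f b"
    and hom_scale: "a \<in> A \<Longrightarrow> f (scale k a) = scale' k (f a)"
    and hom_star: "a \<in> A \<Longrightarrow> f (star a) = star (f a)"

section \<open>Formal power series in noncommuting variables\<close>

typedef ('s, 'k) series = "UNIV :: ('s list \<Rightarrow> 'k) set"
  morphisms coeff Series ..

setup_lifting type_definition_series

lemma series_eqI: "(\<And>w. coeff s w = coeff t w) \<Longrightarrow> s = t"
  by transfer (rule ext)

instantiation series :: (type, semiring_1) semiring_1
begin

lift_definition zero_series :: "('a, 'b) series" is "\<lambda>_. 0" .

lift_definition one_series :: "('a, 'b) series" is "\<lambda>w. if w = [] then 1 else 0" .

lift_definition plus_series :: "('a, 'b) series \<Rightarrow> ('a, 'b) series \<Rightarrow> ('a, 'b) series"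
  is "\<lambda>s t w. s w + t w" .

lift_definition times_series :: "('a, 'b) series \<Rightarrow> ('a, 'b) series \<Rightarrow> ('a, 'b) series"
  is "\<lambda>s t w. \<Sum>i\<le>length w. s (take i w) * t (drop i w)" .

instance
proof
  fix r s t :: "('a, 'b) series"
  show "r + s + t = r + (s + t)"
    by transfer (simp add: add.assoc)
  show "r + s = s + r"
    by transfer (simp add: add.commute)
  show "0 + r = r"
    by transfer simp
  show "0 * r = 0"
    by transfer simp
  show "r * 0 = 0"
    by transfer simp
  show "(r + s) * t = r * t + s * t"
    by transfer (simp add: distrib_right sum.distrib)
  show "r * (s + t) = r * s + r * t"
    by transfer (simp add: distrib_left sum.distrib)
  show "(0 :: ('a, 'b) series) \<noteq> 1"
    by transfer (metis zero_neq_one)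
  show "1 * r = r"
  proof (rule series_eqI)
    fix w
    have "coeff (1 * r) w =
        (\<Sum>i\<le>length w. (if take i w = [] then 1 else 0) * coeff r (drop i w))"
      by transfer simp
    also have "\<dots> = (\<Sum>i\<le>length w. if i = 0 then coeff r w else 0)"
      by (rule sum.cong) auto
    also have "\<dots> = coeff r w"
      by simp
    finally show "coeff (1 * r) w = coeff r w" .
  qed
  show "r * 1 = r"
  proof (rule series_eqI)
    fix w
    have "coeff (r * 1) w =
        (\<Sum>i\<le>length w. coeff r (take i w) * (if drop i w = [] then 1 else 0))"
      by transfer simp
    also have "\<dots> = (\<Sum>i\<le>length w. if i = length w then coeff r w else 0)"
      by (rule sum.cong) auto
    also have "\<dots> = coeff r w"
      by simp
    finally show "coeff (r * 1) w = coeff r w" .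
  qed
  have reindex: "(\<Sum>j\<le>n. \<Sum>i\<le>j. f i (j - i) (n - j)) = (\<Sum>j\<le>n. \<Sum>i\<le>n - j. f j i (n - j - i))"
    for n and f :: "nat \<Rightarrow> nat \<Rightarrow> nat \<Rightarrow> 'b"
    unfolding sum.Sigma[OF finite_atMost ballI[OF finite_atMost]]
    by (rule sum.reindex_bij_witness[where
          i = "\<lambda>(j, i). (j + i, j)" and j = "\<lambda>(j, i). (i, j - i)"]) auto
  show "r * s * t = r * (s * t)"
  proof (rule series_eqI)
    fix w
    define f where "f i j (k :: nat) =
      coeff r (take i w) * coeff s (take j (drop i w)) * coeff t (drop (i + j) w)" for i j k
    have "coeff (r * s * t) w = (\<Sum>j\<le>length w. (\<Sum>i\<le>length (take j w).
        coeff r (take i (take j w)) * coeff s (drop i (take j w))) * coeff t (drop j w))"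
      by transfer simp
    also have "\<dots> = (\<Sum>j\<le>length w. \<Sum>i\<le>j. f i (j - i) (length w - j))"
      by (intro sum.cong refl)
        (auto simp: f_def sum_distrib_right min_def drop_take intro!: sum.cong)
    also have "\<dots> = (\<Sum>j\<le>length w. \<Sum>i\<le>length w - j. f j i (length w - j - i))"
      by (rule reindex)
    also have "\<dots> = (\<Sum>j\<le>length w. coeff r (take j w) * (\<Sum>i\<le>length (drop j w).
        coeff s (take i (drop j w)) * coeff t (drop i (drop j w))))"
      by (simp add: f_def sum_distrib_left mult.assoc add.commute)
    also have "\<dots> = coeff (r * (s * t)) w"
      by transfer simp
    finally show "coeff (r * s * t) w = coeff (r * (s * t)) w" .
  qed
qed

end

lift_definition const :: "'k::semiring_1 \<Rightarrow> ('s, 'k) series"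
  is "\<lambda>k w. if w = [] then k else 0" .

lift_definition letter :: "'s \<Rightarrow> ('s, 'k::semiring_1) series"
  is "\<lambda>a w. if w = [a] then 1 else 0" .

lift_definition series_scale :: "'k::semiring_1 \<Rightarrow> ('s, 'k) series \<Rightarrow> ('s, 'k) series"
  is "\<lambda>k s w. k * s w" .

lift_definition proper_part :: "('s, 'k::semiring_1) series \<Rightarrow> ('s, 'k) series"
  is "\<lambda>s w. if w = [] then 0 else s w" .

definition proper :: "('s, 'k::semiring_1) series \<Rightarrow> bool" where
  "proper s \<longleftrightarrow> coeff s [] = 0"

definition proper_star :: "('s, 'k::semiring_1) series \<Rightarrow> ('s, 'k) series" where
  "proper_star s = (THE x. x = s * x + 1)"

definition proper_plus :: "('s, 'k::semiring_1) series \<Rightarrow> ('s, 'k) series" where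
  "proper_plus s = s * proper_star s"

instantiation series :: (type, "{semiring_1,star}") star
begin

text \<open>
  The extension of the star to all series via the decomposition of \<open>s\<close> as constant term \<open>k\<^sub>0\<close> plus
  proper part.  If \<open>star 0 = 1\<close> in the coefficient semiring, as in every Conway semiring, it agrees
  with \<^const>\<open>proper_star\<close> on proper series.
\<close>

definition star_series :: "('a, 'b) series \<Rightarrow> ('a, 'b) series" where
  "star_series s =
    (let k = star (coeff s []) in proper_star (series_scale k (proper_part s)) * const k)"

instance ..

end

text \<open>
  An alphabet is a set \<open>\<Sigma>\<close> of elements of a type of letters, so that it may be empty.
\<close>

inductive_set rat_proper :: "'s set \<Rightarrow> ('s, 'k::comm_semiring_1) series set"
  for \<Sigma> :: "'s set" where
  zero: "0 \<in> rat_proper \<Sigma>"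
| letter: "a \<in> \<Sigma> \<Longrightarrow> letter a \<in> rat_proper \<Sigma>"
| add: "s \<in> rat_proper \<Sigma> \<Longrightarrow> t \<in> rat_proper \<Sigma> \<Longrightarrow> s + t \<in> rat_proper \<Sigma>"
| mult: "s \<in> rat_proper \<Sigma> \<Longrightarrow> t \<in> rat_proper \<Sigma> \<Longrightarrow> s * t \<in> rat_proper \<Sigma>"
| scale: "s \<in> rat_proper \<Sigma> \<Longrightarrow> series_scale k s \<in> rat_proper \<Sigma>"
| plus: "s \<in> rat_proper \<Sigma> \<Longrightarrow> proper s \<Longrightarrow> proper_plus s \<in> rat_proper \<Sigma>"

definition rat :: "'s set \<Rightarrow> ('s, 'k::comm_semiring_1) series set" where
  "rat \<Sigma> = {const k + b | k b. b \<in> rat_proper \<Sigma>}"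

section \<open>Automata and simulations\<close>

type_synonym ('s, 'k) automaton = "'k mat \<times> ('s, 'k) series mat \<times> 'k mat"

definition linear_combs :: "'s set \<Rightarrow> ('s, 'k::comm_semiring_1) series set" where
  "linear_combs \<Sigma> = {\<Sum>a\<in>\<Sigma>. series_scale (c a) (letter a) | c. True}"

definition is_automaton :: "'s set \<Rightarrow> nat \<Rightarrow> ('s, 'k::comm_semiring_1) automaton \<Rightarrow> bool" where
  "is_automaton \<Sigma> n = (\<lambda>(\<alpha>, M, \<beta>).
     n \<ge> 1 \<and> \<alpha> \<in> carrier_mat 1 n \<and> M \<in> carrier_mat n n \<and> \<beta> \<in> carrier_mat n 1 \<and>
     (\<forall>i<n. \<forall>j<n. M $$ (i, j) \<in> linear_combs \<Sigma>))"

definition behavior :: "('s, 'k::{comm_semiring_1,star}) automaton \<Rightarrow> ('s, 'k) series" where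
  "behavior = (\<lambda>(\<alpha>, M, \<beta>). (map_mat const \<alpha> * mat_star M * map_mat const \<beta>) $$ (0, 0))"

definition simulation ::
  "'k mat \<Rightarrow> ('s, 'k::comm_semiring_1) automaton \<Rightarrow> ('s, 'k) automaton \<Rightarrow> bool" where
  "simulation X = (\<lambda>(\<alpha>, M, \<beta>) (\<gamma>, N, \<delta>).
     X \<in> carrier_mat (dim_row M) (dim_row N) \<and>
     \<alpha> * X = \<gamma> \<and> M * map_mat const X = map_mat const X * N \<and> \<beta> = X * \<delta>)"

definition functional_mat :: "'k::comm_semiring_1 mat \<Rightarrow> bool" where
  "functional_mat X \<longleftrightarrow>
     (\<forall>i<dim_row X. \<exists>j<dim_col X.
        X $$ (i, j) = 1 \<and> (\<forall>j'<dim_col X. j' \<noteq> j \<longrightarrow> X $$ (i, j') = 0))"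

definition dual_functional_mat :: "'k::comm_semiring_1 mat \<Rightarrow> bool" where
  "dual_functional_mat X \<longleftrightarrow> functional_mat (transpose_mat X)"

definition invertible_diagonal_mat :: "'k::comm_semiring_1 mat \<Rightarrow> bool" where
  "invertible_diagonal_mat X \<longleftrightarrow>
     square_mat X \<and> diagonal_mat X \<and> (\<forall>i<dim_row X. X $$ (i, i) dvd 1)"

definition simulation_step ::
  "'s set \<Rightarrow> ('s, 'k::comm_semiring_1) automaton \<Rightarrow> ('s, 'k) automaton \<Rightarrow> bool" where
  "simulation_step \<Sigma> P Q \<longleftrightarrow>
     (\<exists>m. is_automaton \<Sigma> m P) \<and> (\<exists>n. is_automaton \<Sigma> n Q) \<and>
     (\<exists>X. simulation X P Q \<and>
        (functional_mat X \<or> dual_functional_mat X \<or> invertible_diagonal_mat X))"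

text \<open>
  Quantifying over the finite sets of natural numbers covers all finite alphabets up to renaming
  of letters.
\<close>

definition strongly_proper :: "'k::{comm_semiring_1,star} itself \<Rightarrow> bool" where
  "strongly_proper _ \<longleftrightarrow>
     (\<forall>\<Sigma> :: nat set. finite \<Sigma> \<longrightarrow>
       (\<forall>m n. \<forall>(P :: (nat, 'k) automaton) (Q :: (nat, 'k) automaton).
          is_automaton \<Sigma> m P \<longrightarrow> is_automaton \<Sigma> n Q \<longrightarrow> behavior P = behavior Q \<longrightarrow>
          equivclp (simulation_step \<Sigma>) P Q))"

section \<open>Atomistic semirings\<close>

definition atomistic :: "'k::semiring_1 itself \<Rightarrow> bool" where
  "atomistic _ \<longleftrightarrow>
     (\<forall>m\<ge>1. \<forall>n\<ge>1. \<forall>(x :: nat \<Rightarrow> 'k) (y :: nat \<Rightarrow> 'k).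
         (\<Sum>i\<in>{1..m}. x i) = (\<Sum>j\<in>{1..n}. y j) \<longrightarrow>
       (\<exists>k. \<exists>z :: nat \<Rightarrow> 'k. \<exists>(I :: nat \<Rightarrow> nat set) (J :: nat \<Rightarrow> nat set).
          (\<Union>i\<in>{1..m}. I i) = {1..k} \<and> disjoint_family_on I {1..m} \<and>
          (\<Union>j\<in>{1..n}. J j) = {1..k} \<and> disjoint_family_on J {1..n} \<and>
          (\<forall>i\<in>{1..m}. x i = (\<Sum>l\<in>I i. z l)) \<and>
          (\<forall>j\<in>{1..n}. y j = (\<Sum>l\<in>J j. z l))))"

end

theory Submission
  imports Defs "HOL-Combinatorics.Permutations"
begin

text \<open>
  Every rational series is the value of a rational expression, and a morphism to an iteration
  semialgebra \<open>A\<close> that extends \<open>h\<close> must send it to the value of the expression in \<open>A\<close>.  This gives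
  uniqueness, and existence reduces to one statement: two expressions with the same value as
  series have the same value in \<open>A\<close> (\<open>rexp_identity_transfer\<close>).  An expression is translated into
  an automaton whose behavior is its value, simultaneously for series and for \<open>A\<close>
  (\<open>eval_rexp_automaton\<close>).  Equal series give equivalent automata, which strong properness connects
  by a chain of functional, dual functional and invertible diagonal simulations.  It remains to see
  that the value of an automaton in \<open>A\<close> does not change along a link of the chain
  (\<open>aut_value_simulation_step\<close>).

  The diagonal case is a conjugation.  For a functional simulation from \<open>M\<close> to \<open>N\<close>, compared
  letter by letter, the rows of each block of \<open>M\<close> have a common sum, an entry of \<open>N\<close>.  Since the coefficient semiring is
  atomistic, the rows can be refined simultaneously (\<open>transf_sum_atomistic\<close>), so that the block is a
  sum of weighted transformations \<open>a\<^sub>1 R\<^bsub>f\<^sub>1\<^esub> + \<dots> + a\<^sub>k R\<^bsub>f\<^sub>k\<^esub>\<close>, with \<open>R\<^bsub>f\<^esub>\<close> the \<open>0\<close>-\<open>1\<close> matrix of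
  the function \<open>f\<close>, and the entry of \<open>N\<close> is the total weight \<open>a\<^sub>1 + \<dots> + a\<^sub>k\<close>.  The heart of the proof is
  that this form is preserved by the star: the star of a sum of weighted transformations of a
  finite set is again such a sum, and its total weight is the star of the total weight
  (\<open>transf_sum_paths\<close>, stated for \<open>M M\<^sup>*\<close>).  If all transformations are permutations, this follows from
  the group identity of the symmetric group.  Otherwise one splits off a noninjective
  transformation \<open>c\<close>; the paths between consecutive uses of \<open>c\<close> form a sum of weighted transformations
  of the smaller set that is the image of \<open>c\<close>, and an induction on the number of states and on the number
  of transformations applies.  The dual functional case is the functional one in the opposite
  semiring.

  All matrix stars are computed by state elimination: \<open>paths I M i j\<close> is the total weight of the
  nonempty paths from \<open>i\<close> to \<open>j\<close> with intermediate states in \<open>I\<close>.  By the Conway identities, the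
  result does not depend on the order of elimination (\<open>bypass_commute\<close>), so matrix identities are
  obtained by eliminating the states of a suitable graph in two different orders.

  That the rational series themselves form an iteration semialgebra is deduced from the uniqueness
  of solutions of proper linear systems (\<open>iteration_type_series\<close>).
\<close>

section \<open>Path sums in Conway semirings\<close>

text \<open>
  Elimination of the state \<open>k\<close>: paths through \<open>k\<close>, looping there any number of times, are added to the
  direct transitions.  The new matrix is still defined on all states, including \<open>k\<close>.
\<close>

definition bypass :: "'i \<Rightarrow> ('i \<Rightarrow> 'i \<Rightarrow> 'a::{semiring_1,star}) \<Rightarrow> 'i \<Rightarrow> 'i \<Rightarrow> 'a" where
  "bypass k M i j = M i j + M i k * star (M k k) * M k j"

text \<open>
  The total weight of the nonempty paths from \<open>i\<close> to \<open>j\<close> whose intermediate states lie in \<open>I\<close>.  Matrices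
  are functions on an arbitrary index type, and the endpoints need not belong to \<open>I\<close>.  The fold is
  meaningful for finite \<open>I\<close> over a Conway semiring, where the eliminations commute.
\<close>

definition paths :: "'i set \<Rightarrow> ('i \<Rightarrow> 'i \<Rightarrow> 'a::{semiring_1,star}) \<Rightarrow> 'i \<Rightarrow> 'i \<Rightarrow> 'a" where
  "paths I M = Finite_Set.fold bypass M I"

definition unit_mat :: "'i \<Rightarrow> 'i \<Rightarrow> 'a::semiring_1" where
  "unit_mat i j = (if i = j then 1 else 0)"

text \<open>
  The star of the matrix with index set \<open>I\<close>; for \<open>I = {..<n}\<close> it agrees with \<^const>\<open>mat_star\<close>
  (see \<open>mat_star_index\<close> below).
\<close>

definition star_on :: "'i set \<Rightarrow> ('i \<Rightarrow> 'i \<Rightarrow> 'a::{semiring_1,star}) \<Rightarrow> 'i \<Rightarrow> 'i \<Rightarrow> 'a" where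
  "star_on I M i j = unit_mat i j + paths I M i j"

lemma paths_empty [simp]: "paths {} M = M"
  by (simp add: paths_def)

lemma sum_unit_mat_left [simp]:
  "finite I \<Longrightarrow> i \<in> I \<Longrightarrow> (\<Sum>k\<in>I. unit_mat i k * f k) = (f i :: 'a::semiring_1)"
  by (subst sum.cong[OF refl, of _ _ "\<lambda>k. if i = k then f k else 0"]) (auto simp: unit_mat_def)

lemma sum_unit_mat_right [simp]:
  "finite I \<Longrightarrow> j \<in> I \<Longrightarrow> (\<Sum>k\<in>I. f k * unit_mat k j) = (f j :: 'a::semiring_1)"
  by (subst sum.cong[OF refl, of _ _ "\<lambda>k. if j = k then f k else 0"]) (auto simp: unit_mat_def)

lemma unit_mat_inj: "inj_on \<sigma> S \<Longrightarrow> i \<in> S \<Longrightarrow> j \<in> S \<Longrightarrow> unit_mat (\<sigma> i) (\<sigma> j) = unit_mat i j"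
  by (auto simp: unit_mat_def inj_on_def)

text \<open>
  A type all of whose elements form a Conway semiring.  The locale parameter only carries the type.
\<close>

locale conway_type =
  fixes T :: "'a::{semiring_1,star} itself"
  assumes conway: "conway_semiring (UNIV :: 'a set)"
begin

lemma star_sum: "star (a + b) = star (star a * b) * star (a :: 'a)"
  by (rule conway_semiring.star_add[OF conway]) simp_all

lemma star_prod: "star (a * b) = 1 + a * star (b * a) * (b :: 'a)"
  by (rule conway_semiring.star_mult[OF conway]) simp_all

lemma star_unfold_left: "star a = 1 + a * star (a :: 'a)"
  using star_prod[of a 1] by (simp only: mult_1_left mult_1_right)

lemma star_unfold_right: "star a = 1 + star a * (a :: 'a)"
  using star_prod[of 1 a] by (simp only: mult_1_left mult_1_right)

lemma star_zero [simp]: "star 0 = (1 :: 'a)"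
  using star_prod[of 0 0] by simp

lemma star_shift: "x * star (y * x) = star (x * y) * (x :: 'a)"
proof -
  have "x * star (y * x) = x + x * y * star (x * y) * x"
    by (subst star_prod) (simp add: distrib_left mult.assoc)
  also have "\<dots> = (1 + x * y * star (x * y)) * x"
    by (simp add: distrib_right mult.assoc)
  finally show ?thesis by (simp flip: star_unfold_left)
qed

lemma bypass_commute: "bypass k (bypass l M) = bypass l (bypass k (M :: 'i \<Rightarrow> 'i \<Rightarrow> 'a))"
proof (cases "k = l")
  case False
  define a b c d where defs: "a = M k k" "b = M k l" "c = M l k" "d = M l l"
  define x y where xy: "x = star a * b" "y = star d * c"
  define al de where ad: "al = star (a + b * star d * c)" "de = star (d + c * star a * b)"
  have al: "al = star (x * y) * star a"
    unfolding ad xy by (subst star_sum) (simp add: mult.assoc)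
  have de: "de = star (y * x) * star d"
    unfolding ad xy by (subst star_sum) (simp add: mult.assoc)
  have r1: "al * b * star d = star a * b * de"
  proof -
    have "al * b * star d = star (x * y) * x * star d"
      by (simp add: al xy mult.assoc)
    also have "\<dots> = x * star (y * x) * star d"
      by (simp add: star_shift)
    finally show ?thesis by (simp add: de xy mult.assoc)
  qed
  have r2: "star d * c * al = de * c * star a"
  proof -
    have "star d * c * al = y * star (x * y) * star a"
      by (simp add: al xy mult.assoc)
    also have "\<dots> = star (y * x) * y * star a"
      by (simp add: star_shift)
    finally show ?thesis by (simp add: de xy mult.assoc)
  qed
  have r3: "al = star a + star a * b * de * c * star a"
    unfolding al by (subst star_prod) (simp add: de xy distrib_right mult.assoc)
  have r4: "de = star d + star d * c * al * b * star d"
    unfolding de by (subst star_prod) (simp add: al xy distrib_right mult.assoc)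
  show ?thesis
  proof (intro ext)
    fix i j
    have "bypass k (bypass l M) i j =
        M i j + M i l * star d * M l j
        + (M i k + M i l * star d * c) * al * (M k j + b * star d * M l j)"
      by (simp add: bypass_def defs ad)
    also have "\<dots> = M i j + M i k * al * M k j + M i k * (al * b * star d) * M l j
        + M i l * (star d * c * al) * M k j + M i l * (star d + star d * c * al * b * star d) * M l j"
      by (simp add: algebra_simps)
    also have "\<dots> = M i j + M i k * al * M k j + M i k * (star a * b * de) * M l j
        + M i l * (de * c * star a) * M k j + M i l * de * M l j"
      by (subst r4[symmetric]) (simp only: r1 r2)
    also have "\<dots> = M i j + M i k * (star a + star a * b * de * c * star a) * M k j
        + M i k * (star a * b * de) * M l j
        + M i l * (de * c * star a) * M k j + M i l * de * M l j"
      by (simp only: flip: r3)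
    also have "\<dots> = M i j + M i k * star a * M k j
        + (M i l + M i k * star a * b) * de * (M l j + c * star a * M k j)"
      by (simp add: algebra_simps)
    also have "\<dots> = bypass l (bypass k M) i j"
      by (simp add: bypass_def defs ad)
    finally show "bypass k (bypass l M) i j = bypass l (bypass k M) i j" .
  qed
qed simp

sublocale bypass: comp_fun_commute "bypass :: 'i \<Rightarrow> ('i \<Rightarrow> 'i \<Rightarrow> 'a) \<Rightarrow> _"
  by standard (simp add: fun_eq_iff bypass_commute)

lemma paths_insert:
  "finite I \<Longrightarrow> k \<notin> I \<Longrightarrow> paths (insert k I) M = bypass k (paths I (M :: 'i \<Rightarrow> 'i \<Rightarrow> 'a))"
  unfolding paths_def by (rule bypass.fold_insert)

lemma paths_insert':
  "finite I \<Longrightarrow> k \<notin> I \<Longrightarrow> paths (insert k I) M = paths I (bypass k (M :: 'i \<Rightarrow> 'i \<Rightarrow> 'a))"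
  unfolding paths_def by (rule bypass.fold_insert2)

lemma paths_Un:
  assumes "finite I" "finite J" "I \<inter> J = {}"
  shows "paths (I \<union> J) M = paths I (paths J (M :: 'i \<Rightarrow> 'i \<Rightarrow> 'a))"
  using assms
proof (induction I rule: finite_induct)
  case (insert k I)
  then have "paths (insert k I \<union> J) M = bypass k (paths (I \<union> J) M)"
    by (simp add: paths_insert)
  with insert show ?case by (simp add: paths_insert)
qed simp

lemma paths_singleton: "paths {k} M = bypass k (M :: 'i \<Rightarrow> 'i \<Rightarrow> 'a)"
  by (simp add: paths_insert)

lemma bypass_self: "bypass k M k k = M k k * star (M k k :: 'a)"
proof -
  have "bypass k M k k = M k k * (1 + star (M k k) * M k k)"
    by (simp add: bypass_def distrib_left mult.assoc)
  then show ?thesis by (simp flip: star_unfold_right)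
qed

lemma paths_unfold_left:
  assumes "finite I"
  shows "paths I M i j = M i j + (\<Sum>k\<in>I. M i k * paths I (M :: 'i \<Rightarrow> 'i \<Rightarrow> 'a) k j)"
  using assms
proof (induction I arbitrary: i j rule: finite_induct)
  case (insert k I)
  define N where "N = paths I M"
  define s where "s = star (N k k)"
  have P: "paths (insert k I) M i j = N i j + N i k * s * N k j" for i j
    using insert.hyps by (simp add: paths_insert bypass_def N_def s_def)
  have IH: "N i j = M i j + (\<Sum>l\<in>I. M i l * N l j)" for i j
    unfolding N_def by (rule insert.IH)
  have s: "s = 1 + N k k * s"
    unfolding s_def by (rule star_unfold_left)
  have "M i j + (\<Sum>l\<in>insert k I. M i l * paths (insert k I) M l j) =
      (M i j + (\<Sum>l\<in>I. M i l * N l j)) + (\<Sum>l\<in>I. M i l * N l k) * s * N k j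
       + M i k * ((1 + N k k * s) * N k j)"
    using insert.hyps
    by (simp add: P distrib_left distrib_right sum.distrib sum_distrib_right mult.assoc add_ac)
  also have "\<dots> = N i j + (M i k + (\<Sum>l\<in>I. M i l * N l k)) * s * N k j"
    unfolding s[symmetric] IH[of i j, symmetric] by (simp add: distrib_right mult.assoc add_ac)
  also have "\<dots> = paths (insert k I) M i j"
    unfolding P IH[of i k, symmetric] ..
  finally show ?case by simp
qed simp

lemma paths_unfold_right:
  assumes "finite I"
  shows "paths I M i j = M i j + (\<Sum>k\<in>I. paths I (M :: 'i \<Rightarrow> 'i \<Rightarrow> 'a) i k * M k j)"
  using assms
proof (induction I arbitrary: i j rule: finite_induct)
  case (insert k I)
  define N where "N = paths I M"
  define s where "s = star (N k k)"
  have P: "paths (insert k I) M i j = N i j + N i k * s * N k j" for i j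
    using insert.hyps by (simp add: paths_insert bypass_def N_def s_def)
  have IH: "N i j = M i j + (\<Sum>l\<in>I. N i l * M l j)" for i j
    unfolding N_def by (rule insert.IH)
  have s: "s = 1 + s * N k k"
    unfolding s_def by (rule star_unfold_right)
  have "M i j + (\<Sum>l\<in>insert k I. paths (insert k I) M i l * M l j) =
      (M i j + (\<Sum>l\<in>I. N i l * M l j)) + N i k * s * (\<Sum>l\<in>I. N k l * M l j)
       + N i k * (1 + s * N k k) * M k j"
    using insert.hyps
    by (simp add: P distrib_left distrib_right sum.distrib sum_distrib_left mult.assoc add_ac)
  also have "\<dots> = N i j + N i k * s * (M k j + (\<Sum>l\<in>I. N k l * M l j))"
    unfolding s[symmetric] IH[of i j, symmetric] by (simp add: distrib_left mult.assoc add_ac)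
  also have "\<dots> = paths (insert k I) M i j"
    unfolding P IH[of k j, symmetric] ..
  finally show ?case by simp
qed simp

lemma paths_eq_star_on_mult:
  assumes "finite I" "i \<in> I"
  shows "paths I M i j = (\<Sum>k\<in>I. star_on I (M :: 'i \<Rightarrow> 'i \<Rightarrow> 'a) i k * M k j)"
  using assms
  by (subst paths_unfold_right) (simp_all add: star_on_def distrib_right sum.distrib)

lemma paths_eq_mult_star_on:
  assumes "finite I" "j \<in> I"
  shows "paths I M i j = (\<Sum>k\<in>I. M i k * star_on I (M :: 'i \<Rightarrow> 'i \<Rightarrow> 'a) k j)"
  using assms
  by (subst paths_unfold_left) (simp_all add: star_on_def distrib_left sum.distrib)

lemma paths_sandwich:
  assumes "finite I"
  shows "paths I M i j =
    M i j + (\<Sum>k\<in>I. \<Sum>l\<in>I. M i k * star_on I (M :: 'i \<Rightarrow> 'i \<Rightarrow> 'a) k l * M l j)"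
  using assms
  by (subst paths_unfold_left)
    (simp_all add: paths_eq_star_on_mult sum_distrib_left mult.assoc)

lemma paths_cong:
  assumes "finite I" "I \<subseteq> R" "I \<subseteq> C" "\<And>i j. i \<in> R \<Longrightarrow> j \<in> C \<Longrightarrow> M i j = M' i j"
    and "i \<in> R" "j \<in> C"
  shows "paths I M i j = paths I (M' :: 'i \<Rightarrow> 'i \<Rightarrow> 'a) i j"
  using assms(1-3,5,6)
proof (induction I arbitrary: i j rule: finite_induct)
  case empty
  then show ?case using assms(4) by simp
next
  case (insert k I)
  then show ?case by (simp add: paths_insert bypass_def)
qed

lemma star_on_cong:
  assumes "finite I" "\<And>i j. i \<in> I \<Longrightarrow> j \<in> I \<Longrightarrow> M i j = M' i j" "i \<in> I" "j \<in> I"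
  shows "star_on I M i j = star_on I (M' :: 'i \<Rightarrow> 'i \<Rightarrow> 'a) i j"
  unfolding star_on_def using paths_cong[OF assms(1) order_refl order_refl assms(2-4)] by simp

lemma paths_reindex:
  assumes "finite I" "inj_on \<sigma> I"
  shows "paths (\<sigma> ` I) M (\<sigma> i) (\<sigma> j) = paths I (\<lambda>i j. (M (\<sigma> i) (\<sigma> j) :: 'a)) i j"
  using assms
proof (induction I arbitrary: i j rule: finite_induct)
  case (insert k I)
  from insert.prems insert.hyps have "\<sigma> k \<notin> \<sigma> ` I" by auto
  then show ?case
    using insert by (simp add: paths_insert bypass_def)
qed simp

lemma star_on_reindex:
  assumes "finite I" "inj_on \<sigma> I" "i \<in> I" "j \<in> I"
  shows "star_on (\<sigma> ` I) M (\<sigma> i) (\<sigma> j) = star_on I (\<lambda>i j. (M (\<sigma> i) (\<sigma> j) :: 'a)) i j"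
  using assms by (simp add: star_on_def paths_reindex unit_mat_inj[OF assms(2)])

text \<open>
  States that are not reachable from a set \<open>R\<close> closed under transitions do not matter for paths
  that start in \<open>R\<close>.
\<close>

lemma paths_closed_rows:
  assumes "finite I" "R \<subseteq> I" "\<And>i j. i \<in> R \<Longrightarrow> j \<notin> R \<Longrightarrow> M i j = (0 :: 'a)" "i \<in> R"
  shows "paths I M i j = paths R M i j" and "j \<notin> R \<Longrightarrow> paths I M i j = 0"
proof -
  have same: "paths J M i j = M i j"
    if "finite J" "J \<inter> R = {}" "i \<in> R" for J i j
    using that(1,2,3)
  proof (induction J arbitrary: i j rule: finite_induct)
    case (insert k J)
    then have "M i k = 0" using assms(3) by auto
    with insert show ?case by (simp add: paths_insert bypass_def)
  qed simp
  have fin: "finite R" "finite (I - R)" using assms(1,2) finite_subset by auto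
  have "paths I M i j = paths R (paths (I - R) M) i j"
    using paths_Un[of R "I - R" M] fin assms(2) by (simp add: Un_absorb1)
  also have "\<dots> = paths R M i j"
    by (rule paths_cong[OF fin(1) order_refl subset_UNIV]) (use fin assms(4) in \<open>auto intro: same\<close>)
  finally show eq: "paths I M i j = paths R M i j" .
  assume "j \<notin> R"
  then have "(\<Sum>k\<in>R. paths R M i k * M k j) = 0" "M i j = 0"
    using assms(3,4) by (auto intro!: sum.neutral)
  then show "paths I M i j = 0"
    unfolding eq by (subst paths_unfold_right[OF fin(1)]) simp
qed

end

lemma paths_hom:
  fixes \<phi> :: "'a::{semiring_1,star} \<Rightarrow> 'b::{semiring_1,star}"
  assumes "conway_type TYPE('a)" "conway_type TYPE('b)" "finite I"
    and "\<And>x y. \<phi> (x + y) = \<phi> x + \<phi> y" "\<And>x y. \<phi> (x * y) = \<phi> x * \<phi> y" "\<And>x. \<phi> (star x) = star (\<phi> x)"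
  shows "\<phi> (paths I M i j) = paths I (\<lambda>i j. \<phi> (M i j)) i j"
  using assms(3)
proof (induction I arbitrary: i j rule: finite_induct)
  case (insert k I)
  then show ?case
    by (simp add: conway_type.paths_insert[OF assms(1)] conway_type.paths_insert[OF assms(2)]
        bypass_def assms(4-6))
qed simp

lemma star_on_hom:
  fixes \<phi> :: "'a::{semiring_1,star} \<Rightarrow> 'b::{semiring_1,star}"
  assumes "conway_type TYPE('a)" "conway_type TYPE('b)" "finite I" "\<phi> 0 = 0" "\<phi> 1 = 1"
    and "\<And>x y. \<phi> (x + y) = \<phi> x + \<phi> y" "\<And>x y. \<phi> (x * y) = \<phi> x * \<phi> y" "\<And>x. \<phi> (star x) = star (\<phi> x)"
  shows "\<phi> (star_on I M i j) = star_on I (\<lambda>i j. \<phi> (M i j)) i j"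
  by (simp add: star_on_def assms(4-8) unit_mat_def paths_hom[OF assms(1-3), of \<phi>, OF assms(6-8)])

context conway_type
begin

subsection \<open>Star of a sum of matrices\<close>

text \<open>
  The identity \<open>(A + B)\<^sup>* = (A\<^sup>* B)\<^sup>* A\<^sup>*\<close> for matrices.
\<close>

lemma star_on_add:
  fixes A B :: "'i \<Rightarrow> 'i \<Rightarrow> 'a"
  assumes I: "finite I" and ij: "i \<in> I" "j \<in> I"
  defines "C \<equiv> \<lambda>i j. \<Sum>k\<in>I. star_on I A i k * B k j"
  shows "star_on I (\<lambda>i j. A i j + B i j) i j = (\<Sum>k\<in>I. star_on I C i k * star_on I A k j)"
proof -
  \<comment> \<open>Two copies of the states: \<open>A\<close> acts inside the first copy, \<open>B\<close> leads to the second, and unit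
transitions lead back.  Eliminating the second copy first yields \<open>A + B\<close>, eliminating the first
copy first yields \<open>A\<^sup>* B\<close> on the second.\<close>
  define G :: "'i + 'i \<Rightarrow> 'i + 'i \<Rightarrow> 'a" where
    "G = (\<lambda>p q. case p of
        Inl i \<Rightarrow> (case q of Inl j \<Rightarrow> A i j | Inr j \<Rightarrow> B i j)
      | Inr i \<Rightarrow> (case q of Inl j \<Rightarrow> unit_mat i j | Inr j \<Rightarrow> 0))"
  have G [simp]: "G (Inl i) (Inl j) = A i j" "G (Inl i) (Inr j) = B i j"
    "G (Inr i) (Inl j) = unit_mat i j" "G (Inr i) (Inr j) = 0" for i j
    by (simp_all add: G_def)
  have fin: "finite (Inl ` I)" "finite (Inr ` I)" and disj: "Inl ` I \<inter> Inr ` I = {}"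
    using I by auto
  have inj: "inj_on Inl I" "inj_on Inr I" by auto
  have "paths (Inl ` I \<union> Inr ` I) G (Inl i) (Inl j) = paths (Inl ` I) (paths (Inr ` I) G) (Inl i) (Inl j)"
    by (simp add: paths_Un fin disj)
  also have "\<dots> = paths I (\<lambda>i j. paths (Inr ` I) G (Inl i) (Inl j)) i j"
    by (rule paths_reindex) (use I inj in auto)
  also have "\<dots> = paths I (\<lambda>i j. A i j + B i j) i j"
  proof (rule paths_cong[OF I order_refl order_refl _ ij])
    fix i j assume *: "i \<in> I" "j \<in> I"
    have "paths (Inr ` I) G (Inr k) (Inl j) = unit_mat k j" for k
      by (subst paths_unfold_left[OF fin(2)]) (simp add: sum.reindex)
    then show "paths (Inr ` I) G (Inl i) (Inl j) = A i j + B i j"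
      using * I by (subst paths_unfold_left[OF fin(2)]) (simp add: sum.reindex)
  qed
  finally have 1: "paths (Inl ` I \<union> Inr ` I) G (Inl i) (Inl j) = paths I (\<lambda>i j. A i j + B i j) i j" .
  define H where "H = paths (Inl ` I) G"
  have H1: "H (Inl i) (Inl j) = paths I A i j" for i j
    unfolding H_def using paths_reindex[OF I inj(1), of G i j] by simp
  have H2: "H (Inl i) (Inr j) = C i j" if "i \<in> I" for i j
    unfolding H_def C_def
    using that I H1[unfolded H_def]
    by (subst paths_unfold_right[OF fin(1)])
      (simp add: sum.reindex star_on_def distrib_right sum.distrib)
  have H3: "H (Inr i) (Inl j) = star_on I A i j" if "i \<in> I" for i j
    unfolding H_def using that I H1[unfolded H_def]
    by (subst paths_unfold_left[OF fin(1)])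
      (simp add: sum.reindex star_on_def)
  have H4: "H (Inr i) (Inr j) = C i j" if "i \<in> I" for i j
    unfolding H_def using that I H2[unfolded H_def]
    by (subst paths_unfold_left[OF fin(1)]) (simp add: sum.reindex)
  have S: "star_on (Inr ` I) H (Inr k) (Inr l) = star_on I C k l" if "k \<in> I" "l \<in> I" for k l
    unfolding star_on_reindex[OF I inj(2) that]
    by (rule star_on_cong[OF I _ that]) (simp add: H4)
  have "paths (Inl ` I \<union> Inr ` I) G (Inl i) (Inl j) = paths (Inr ` I) H (Inl i) (Inl j)"
    unfolding H_def using paths_Un[OF fin(2,1), of G] disj by (simp add: Un_commute Int_commute)
  also have "\<dots> = paths I A i j + (\<Sum>k\<in>I. \<Sum>l\<in>I. C i k * star_on I C k l * star_on I A l j)"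
    unfolding paths_sandwich[OF fin(2)]
    using ij by (simp add: sum.reindex H1 H2 H3 S)
  also have "(\<Sum>k\<in>I. \<Sum>l\<in>I. C i k * star_on I C k l * star_on I A l j)
      = (\<Sum>l\<in>I. paths I C i l * star_on I A l j)"
    by (subst sum.swap) (simp add: paths_eq_mult_star_on[OF I] sum_distrib_right)
  finally have 2: "paths I (\<lambda>i j. A i j + B i j) i j
      = paths I A i j + (\<Sum>l\<in>I. paths I C i l * star_on I A l j)"
    unfolding 1 .
  show ?thesis
    unfolding star_on_def[of I "\<lambda>i j. A i j + B i j"] 2
    using I ij by (simp add: star_on_def[of I C] distrib_right sum.distrib star_on_def[of I A] add.assoc)
qed

subsection \<open>The matrix star\<close>

text \<open>
  The block recursion of the matrix star eliminates the last state, either first (upper blocks) or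
  last (lower blocks).
\<close>

lemma mat_star_dim_index:
  assumes "M \<in> carrier_mat (Suc n) (Suc n)"
  shows "mat_star_dim (Suc n) (M :: 'a mat) \<in> carrier_mat (Suc n) (Suc n) \<and>
    (\<forall>i<Suc n. \<forall>j<Suc n. mat_star_dim (Suc n) M $$ (i, j) = star_on {..<Suc n} (\<lambda>i j. M $$ (i, j)) i j)"
  using assms
proof (induction n arbitrary: M)
  case 0
  have "star (M $$ (0, 0)) = 1 + bypass 0 (\<lambda>i j. M $$ (i, j)) 0 0"
    by (simp add: bypass_self flip: star_unfold_left)
  then show ?case
    by (simp add: star_on_def unit_mat_def lessThan_Suc paths_singleton)
next
  case (Suc n)
  define m where "m = Suc n"
  define f where "f = (\<lambda>i j. M $$ (i, j))"
  have dim [simp]: "dim_row M = Suc m" "dim_col M = Suc m"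
    using Suc.prems by (auto simp: m_def)
  define X Y U V where "X = mat m m (\<lambda>(i, j). f i j)" and "Y = mat m 1 (\<lambda>(i, j). f i m)"
    and "U = mat 1 m (\<lambda>(i, j). f m j)" and "V = mat 1 1 (\<lambda>(i, j). f m m)"
  have split: "split_block M m m = (X, Y, U, V)"
    by (auto simp: split_block_def X_def Y_def U_def V_def f_def)
  define Vs where "Vs = mat_star_dim (Suc 0) V"
  have Vs: "Vs = mat 1 1 (\<lambda>_. star (f m m))"
    by (simp add: Vs_def V_def)
  define Z al Xs de where "Z = X + Y * Vs * U" and "al = mat_star_dim m Z"
    and "Xs = mat_star_dim m X" and "de = mat_star_dim (Suc 0) (V + U * Xs * Y)"
  have Z: "Z \<in> carrier_mat m m" and X: "X \<in> carrier_mat m m"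
    by (auto simp: Z_def X_def Y_def Vs U_def)
  have Zij: "Z $$ (i, j) = bypass m f i j" if "i < m" "j < m" for i j
    using that by (simp add: Z_def X_def Y_def U_def Vs bypass_def scalar_prod_def)
  have al: "al \<in> carrier_mat m m"
    and al_ij: "\<And>i j. i < m \<Longrightarrow> j < m \<Longrightarrow> al $$ (i, j) = star_on {..<m} (bypass m f) i j"
  proof -
    show "al \<in> carrier_mat m m"
      using Suc.IH[of Z] Z by (simp add: al_def m_def)
    fix i j assume ij: "i < m" "j < m"
    have "al $$ (i, j) = star_on {..<m} (\<lambda>i j. Z $$ (i, j)) i j"
      using Suc.IH[of Z] Z ij by (simp add: al_def m_def)
    also have "\<dots> = star_on {..<m} (bypass m f) i j"
      by (rule star_on_cong) (use ij Zij in auto)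
    finally show "al $$ (i, j) = star_on {..<m} (bypass m f) i j" .
  qed
  have Xs: "Xs \<in> carrier_mat m m"
    and Xs_ij: "\<And>i j. i < m \<Longrightarrow> j < m \<Longrightarrow> Xs $$ (i, j) = star_on {..<m} f i j"
  proof -
    show "Xs \<in> carrier_mat m m"
      using Suc.IH[of X] X by (simp add: Xs_def m_def)
    fix i j assume ij: "i < m" "j < m"
    have "Xs $$ (i, j) = star_on {..<m} (\<lambda>i j. X $$ (i, j)) i j"
      using Suc.IH[of X] X ij by (simp add: Xs_def m_def)
    also have "\<dots> = star_on {..<m} f i j"
      by (rule star_on_cong) (use ij in \<open>auto simp: X_def\<close>)
    finally show "Xs $$ (i, j) = star_on {..<m} f i j" .
  qed
  have paths_Suc: "paths {..<Suc m} f = paths {..<m} (bypass m f)"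
    "paths {..<Suc m} f = bypass m (paths {..<m} f)"
    unfolding lessThan_Suc by (rule paths_insert' paths_insert; simp)+
  define p where "p = paths {..<m} f m m"
  have UXs: "(\<Sum>l<m. f m l * Xs $$ (l, j)) = paths {..<m} f m j" if "j < m" for j
    using that by (simp add: Xs_ij paths_eq_mult_star_on)
  have "(V + U * Xs * Y) $$ (0, 0) = f m m + (\<Sum>k<m. (\<Sum>l<m. f m l * Xs $$ (l, k)) * f k m)"
    using Xs by (simp add: V_def Y_def U_def scalar_prod_def atLeast0LessThan)
  also have "\<dots> = p"
    unfolding p_def by (subst paths_unfold_right) (simp_all add: UXs)
  finally have "(V + U * Xs * Y) $$ (0, 0) = p" .
  then have de: "de = mat 1 1 (\<lambda>_. star p)"
    by (simp add: de_def)
  have star_eq: "mat_star_dim (Suc m) M = four_block_mat al (al * Y * Vs) (de * U * Xs) de"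
    unfolding m_def
    by (simp add: Let_def split[unfolded m_def] al_def Z_def Vs_def Xs_def de_def m_def)
  have "mat_star_dim (Suc m) M $$ (i, j) = star_on {..<Suc m} f i j"
    if ij: "i < Suc m" "j < Suc m" for i j
  proof -
    consider "i < m" "j < m" | "i < m" "j = m" | "i = m" "j < m" | "i = m" "j = m"
      using ij by linarith
    then show ?thesis
    proof cases
      case 1
      then show ?thesis
        using al by (simp add: star_eq de al_ij star_on_def paths_Suc(1))
    next
      case 2
      have "bypass m f k m = f k m * star (f m m)" for k
        by (subst star_unfold_right) (simp add: bypass_def distrib_left mult.assoc)
      then show ?thesis
        using 2 al
        by (simp add: star_eq de Vs Y_def scalar_prod_def al_ij star_on_def[of "{..<Suc m}"] unit_mat_def
            paths_Suc(1) paths_eq_star_on_mult sum_distrib_right mult.assoc atLeast0LessThan)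
    next
      case 3
      have "bypass m (paths {..<m} f) m j = star p * paths {..<m} f m j"
        by (subst star_unfold_left) (simp add: bypass_def p_def distrib_right)
      moreover have "(de * U * Xs) $$ (0, j) = star p * (\<Sum>l<m. f m l * Xs $$ (l, j))"
        using 3 Xs
        by (simp add: de U_def scalar_prod_def sum_distrib_left mult.assoc atLeast0LessThan)
      moreover have "mat_star_dim (Suc m) M $$ (i, j) = (de * U * Xs) $$ (0, j)"
        using 3 al Xs by (simp add: star_eq) (simp add: de)
      ultimately show ?thesis
        using 3 by (simp add: UXs star_on_def unit_mat_def paths_Suc(2))
    next
      case 4
      then show ?thesis
        using al by (simp add: star_eq de star_on_def unit_mat_def paths_Suc(2) bypass_self
            flip: p_def star_unfold_left)
    qed
  qed
  moreover have "mat_star_dim (Suc m) M \<in> carrier_mat (Suc m) (Suc m)"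
    unfolding star_eq using four_block_carrier_mat[OF al, of de 1 1] by (simp add: de)
  ultimately show ?case
    by (simp add: m_def f_def)
qed

lemma mat_star_index:
  assumes "M \<in> carrier_mat n n" "i < n" "j < n"
  shows "mat_star (M :: 'a mat) $$ (i, j) = star_on {..<n} (\<lambda>i j. M $$ (i, j)) i j"
  using assms mat_star_dim_index[of M "n - 1"] by (cases n) (auto simp: mat_star_def)

lemma mat_star_carrier:
  "M \<in> carrier_mat n n \<Longrightarrow> mat_star (M :: 'a mat) \<in> carrier_mat n n"
  using mat_star_dim_index[of M "n - 1"] by (cases n) (auto simp: mat_star_def)

end

section \<open>Row sums of group matrices\<close>

lemma group_row_sum_const:
  fixes G (structure) and M :: "'g \<Rightarrow> 'g \<Rightarrow> 'a::comm_monoid_add"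
  assumes G: "group G" and g: "g \<in> carrier G"
    and inv: "\<And>k g h. k \<in> carrier G \<Longrightarrow> g \<in> carrier G \<Longrightarrow> h \<in> carrier G \<Longrightarrow> M (k \<otimes> g) (k \<otimes> h) = M g h"
  shows "(\<Sum>h\<in>carrier G. M g h) = (\<Sum>h\<in>carrier G. M \<one> h)"
proof -
  interpret group G by (rule G)
  have "(\<Sum>h\<in>carrier G. M g h) = (\<Sum>h\<in>carrier G. M g (g \<otimes> h))"
    by (rule sum.reindex_bij_witness[where i = "\<lambda>h. g \<otimes> h" and j = "\<lambda>h. inv g \<otimes> h"])
      (use g in \<open>auto simp flip: m_assoc\<close>)
  also have "\<dots> = (\<Sum>h\<in>carrier G. M \<one> h)"
    using g inv[OF g one_closed] by (intro sum.cong) auto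
  finally show ?thesis .
qed

text \<open>
  A type all of whose elements form an iteration semiring.
\<close>

locale iteration_type =
  fixes T :: "'a::{semiring_1,star} itself"
  assumes iteration: "iteration_semiring (UNIV :: 'a set)"
begin

sublocale conway_type T
  using iteration by (simp add: conway_type_def iteration_semiring_def)

text \<open>
  The group identity for an arbitrary finite group and an arbitrary row of its matrix.  A matrix has the form
  \<open>x\<^bsub>g\<^sup>-\<^sup>1 h\<^esub>\<close> iff it is invariant under left translations.
\<close>

lemma group_star_row_sum:
  fixes G (structure) and M :: "'g \<Rightarrow> 'g \<Rightarrow> 'a"
  assumes G: "group G" and fin: "finite (carrier G)" and g: "g \<in> carrier G"
    and inv: "\<And>k g h. k \<in> carrier G \<Longrightarrow> g \<in> carrier G \<Longrightarrow> h \<in> carrier G \<Longrightarrow> M (k \<otimes> g) (k \<otimes> h) = M g h"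
  shows "(\<Sum>h\<in>carrier G. star_on (carrier G) M g h) = star (\<Sum>h\<in>carrier G. M \<one> h)"
proof -
  interpret group G by (rule G)
  define n where "n = card (carrier G)"
  obtain \<sigma>0 where \<sigma>0: "bij_betw \<sigma>0 {0..<n} (carrier G)"
    using ex_bij_betw_nat_finite[OF fin] unfolding n_def by auto
  then obtain i0 where i0: "i0 < n" "\<sigma>0 i0 = g"
    using g by (metis atLeastLessThan_iff bij_betw_imp_surj_on imageE)
  \<comment> \<open>The numbering of the group elements is chosen such that \<open>g\<close> gets the number \<open>0\<close>: the group identities
on \<open>{0..<n}\<close> concern the first row only, but hold for every group structure on this set.\<close>
  define \<sigma> where "\<sigma> = \<sigma>0 \<circ> Transposition.transpose 0 i0"
  have "bij_betw (Transposition.transpose 0 i0) {0..<n} {0..<n}"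
    using i0 by (intro permutes_imp_bij permutes_swap_id) auto
  then have bij: "bij_betw \<sigma> {0..<n} (carrier G)"
    unfolding \<sigma>_def using \<sigma>0 by (rule bij_betw_trans)
  have \<sigma>_0: "\<sigma> 0 = g" using i0 by (simp add: \<sigma>_def)
  have in_G [simp]: "\<sigma> i \<in> carrier G" if "i < n" for i
    using bij that by (auto simp: bij_betw_def)
  define \<tau> where "\<tau> = inv_into {0..<n} \<sigma>"
  have \<tau>: "\<tau> h < n" "\<sigma> (\<tau> h) = h" if "h \<in> carrier G" for h
    using bij that inv_into_into[of h \<sigma> "{0..<n}"] f_inv_into_f[of h \<sigma> "{0..<n}"]
    by (auto simp: \<tau>_def bij_betw_def)
  have \<tau>\<sigma>: "\<tau> (\<sigma> i) = i" if "i < n" for i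
    using bij that by (simp add: \<tau>_def bij_betw_def)
  define H :: "nat monoid" where
    "H = \<lparr>carrier = {0..<n}, mult = (\<lambda>i j. \<tau> (\<sigma> i \<otimes> \<sigma> j)), one = \<tau> \<one>\<rparr>"
  have H: "group H"
  proof (rule groupI)
    fix i assume i: "i \<in> carrier H"
    show "\<exists>j\<in>carrier H. j \<otimes>\<^bsub>H\<^esub> i = \<one>\<^bsub>H\<^esub>"
      by (rule bexI[of _ "\<tau> (inv (\<sigma> i))"]) (use i in \<open>auto simp: H_def \<tau>\<close>)
  qed (auto simp: H_def \<tau> \<tau>\<sigma> m_assoc)
  interpret H: group H by (rule H)
  have invH: "inv\<^bsub>H\<^esub> i = \<tau> (inv (\<sigma> i))" if "i < n" for i
    by (rule H.inv_equality) (use that in \<open>auto simp: H_def \<tau>\<close>)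
  define x where "x i = M \<one> (\<sigma> i)" for i
  have GM: "group_mat H n x = mat n n (\<lambda>(i, j). M (\<sigma> i) (\<sigma> j))"
  proof (rule eq_matI)
    fix i j assume "i < dim_row (mat n n (\<lambda>(i, j). M (\<sigma> i) (\<sigma> j)))"
      "j < dim_col (mat n n (\<lambda>(i, j). M (\<sigma> i) (\<sigma> j)))"
    then have ij: "i < n" "j < n" by auto
    have "M \<one> (inv (\<sigma> i) \<otimes> \<sigma> j) = M (\<sigma> i \<otimes> \<one>) (\<sigma> i \<otimes> (inv (\<sigma> i) \<otimes> \<sigma> j))"
      using ij by (intro inv[symmetric]) auto
    also have "\<dots> = M (\<sigma> i) (\<sigma> j)"
      using ij by (simp flip: m_assoc)
    finally show "group_mat H n x $$ (i, j) = mat n n (\<lambda>(i, j). M (\<sigma> i) (\<sigma> j)) $$ (i, j)"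
      using ij by (simp add: group_mat_def x_def invH) (simp add: H_def \<tau>)
  qed (auto simp: group_mat_def)
  have n: "0 < n" using i0 by auto
  have "star (\<Sum>h\<in>carrier G. M \<one> h) = star (\<Sum>i<n. x i)"
    using sum.reindex_bij_betw[OF bij, of "M \<one>"] by (simp add: x_def atLeast0LessThan)
  also have "\<dots> = (\<Sum>j<n. mat_star (group_mat H n x) $$ (0, j))"
    using iteration_semiring.group_identity[OF iteration H, of n x] by (simp add: H_def)
  also have "\<dots> = (\<Sum>j<n. star_on (carrier G) M g (\<sigma> j))"
  proof (rule sum.cong[OF refl])
    fix j assume "j \<in> {..<n}"
    then have j: "j < n" by simp
    have "mat_star (group_mat H n x) $$ (0, j) =
        star_on {..<n} (\<lambda>i j. group_mat H n x $$ (i, j)) 0 j"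
      by (rule mat_star_index) (use n j in \<open>auto simp: GM\<close>)
    also have "\<dots> = star_on {..<n} (\<lambda>i j. M (\<sigma> i) (\<sigma> j)) 0 j"
      by (rule star_on_cong) (use n j in \<open>auto simp: GM\<close>)
    also have "\<dots> = star_on (\<sigma> ` {..<n}) M (\<sigma> 0) (\<sigma> j)"
      by (rule star_on_reindex[symmetric]) (use n j bij in \<open>auto simp: bij_betw_def atLeast0LessThan\<close>)
    finally show "mat_star (group_mat H n x) $$ (0, j) = star_on (carrier G) M g (\<sigma> j)"
      using bij by (simp add: \<sigma>_0 bij_betw_def atLeast0LessThan)
  qed
  also have "\<dots> = (\<Sum>h\<in>carrier G. star_on (carrier G) M g h)"
    using sum.reindex_bij_betw[OF bij, of "star_on (carrier G) M g"] by (simp add: atLeast0LessThan)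
  finally show ?thesis by simp
qed

lemma group_paths_row_sum:
  fixes G (structure) and M :: "'g \<Rightarrow> 'g \<Rightarrow> 'a"
  assumes G: "group G" and fin: "finite (carrier G)" and g: "g \<in> carrier G"
    and inv: "\<And>k g h. k \<in> carrier G \<Longrightarrow> g \<in> carrier G \<Longrightarrow> h \<in> carrier G \<Longrightarrow> M (k \<otimes> g) (k \<otimes> h) = M g h"
    and n: "n = (\<Sum>h\<in>carrier G. M g h)"
  shows "(\<Sum>h\<in>carrier G. paths (carrier G) M g h) = n * star n"
proof -
  have n: "n = (\<Sum>h\<in>carrier G. M \<one> h)"
    using group_row_sum_const[OF G g, of M] inv n by simp
  have "(\<Sum>h\<in>carrier G. paths (carrier G) M g h) =
      (\<Sum>h\<in>carrier G. \<Sum>k\<in>carrier G. M g k * star_on (carrier G) M k h)"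
    by (simp add: paths_eq_mult_star_on[OF fin])
  also have "\<dots> = (\<Sum>k\<in>carrier G. M g k * (\<Sum>h\<in>carrier G. star_on (carrier G) M k h))"
    by (subst sum.swap) (simp add: sum_distrib_left)
  also have "\<dots> = (\<Sum>k\<in>carrier G. M g k * star n)"
    by (rule sum.cong) (use group_star_row_sum[OF G fin, of _ M] inv n in auto)
  also have "\<dots> = n * star n"
    unfolding sum_distrib_right[symmetric] using group_row_sum_const[OF G g, of M] inv n by simp
  finally show ?thesis .
qed

end

section \<open>Eliminating a block of states\<close>

text \<open>
  Let \<open>B c\<close> be blocks of states, and let each block of \<open>M\<close> be related to an entry of
  the small matrix \<open>N\<close> by a relation \<open>R\<close> compatible with sums and products.  If the relation is also
  compatible with the star of one diagonal block, it persists when that block is eliminated from \<open>M\<close>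
  and its index from \<open>N\<close>.
\<close>

lemma (in conway_type) block_bypass:
  fixes R :: "'i set \<Rightarrow> 'i set \<Rightarrow> ('i \<Rightarrow> 'i \<Rightarrow> 'a) \<Rightarrow> 'a \<Rightarrow> bool"
  assumes add: "\<And>X Y M m M' m'. R X Y M m \<Longrightarrow> R X Y M' m' \<Longrightarrow> R X Y (\<lambda>i j. M i j + M' i j) (m + m')"
    and comp: "\<And>X Y Z M m M' m'. finite Y \<Longrightarrow> R X Y M m \<Longrightarrow> R Y Z M' m' \<Longrightarrow>
      R X Z (\<lambda>i j. \<Sum>k\<in>Y. M i k * M' k j) (m * m')"
    and fin: "finite (B e)"
    and M: "\<And>c d. c \<in> C \<Longrightarrow> d \<in> C \<Longrightarrow> R (B c) (B d) M (N c d)"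
    and e: "e \<in> C" "R (B e) (B e) (paths (B e) M) (N e e * star (N e e))"
    and cd: "c \<in> C" "d \<in> C"
  shows "R (B c) (B d) (paths (B e) M) (bypass e N c d)"
proof -
  have "paths (B e) M = (\<lambda>i j. M i j + ((\<Sum>k\<in>B e. M i k * M k j) +
      (\<Sum>l\<in>B e. (\<Sum>k\<in>B e. M i k * paths (B e) M k l) * M l j)))"
  proof (intro ext)
    fix i j
    have "(\<Sum>k\<in>B e. M i k * paths (B e) M k j) = (\<Sum>k\<in>B e. M i k * M k j) +
        (\<Sum>l\<in>B e. \<Sum>k\<in>B e. M i k * paths (B e) M k l * M l j)"
      unfolding sum.swap[of "\<lambda>l k. M i k * paths (B e) M k l * M l j"]
      by (subst paths_unfold_right[OF fin])
        (simp add: distrib_left sum.distrib sum_distrib_left mult.assoc)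
    then show "paths (B e) M i j = M i j + ((\<Sum>k\<in>B e. M i k * M k j) +
      (\<Sum>l\<in>B e. (\<Sum>k\<in>B e. M i k * paths (B e) M k l) * M l j))"
      unfolding sum_distrib_right
      by (subst paths_unfold_left[OF fin]) simp
  qed
  moreover have "bypass e N c d = N c d + (N c e * N e d + N c e * (N e e * star (N e e)) * N e d)"
    unfolding bypass_def
    by (subst star_unfold_left) (simp add: distrib_left distrib_right mult.assoc)
  moreover have "R (B c) (B d) (\<lambda>i j. M i j + ((\<Sum>k\<in>B e. M i k * M k j) +
      (\<Sum>l\<in>B e. (\<Sum>k\<in>B e. M i k * paths (B e) M k l) * M l j)))
    (N c d + (N c e * N e d + N c e * (N e e * star (N e e)) * N e d))"
    by (intro add comp M e cd fin)
  ultimately show ?thesis by simp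
qed

context iteration_type
begin

text \<open>
  The group identity with matrices over \<open>Q\<close> in place of scalars, proved by eliminating the
  blocks \<open>G \<times> {q}\<close> one after the other.
\<close>

lemma group_block_row_sum:
  fixes G (structure) and M :: "'g \<times> 'q \<Rightarrow> 'g \<times> 'q \<Rightarrow> 'a"
  assumes G: "group G" and fin: "finite (carrier G)" and Q: "finite Q" "Q \<subseteq> U"
    and inv: "\<And>k g h i j. k \<in> carrier G \<Longrightarrow> g \<in> carrier G \<Longrightarrow> h \<in> carrier G \<Longrightarrow>
      M (k \<otimes> g, i) (k \<otimes> h, j) = M (g, i) (h, j)"
    and N: "\<And>g i j. g \<in> carrier G \<Longrightarrow> i \<in> U \<Longrightarrow> j \<in> U \<Longrightarrow> (\<Sum>h\<in>carrier G. M (g, i) (h, j)) = N i j"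
    and g: "g \<in> carrier G" and ij: "i \<in> U" "j \<in> U"
  shows "(\<Sum>h\<in>carrier G. paths (carrier G \<times> Q) M (g, i) (h, j)) = paths Q N i j"
  using Q g ij
proof (induction Q arbitrary: g i j rule: finite_induct)
  case empty
  then show ?case by (simp add: N)
next
  case (insert q Q)
  interpret group G by (rule G)
  define B where "B i = carrier G \<times> {i}" for i :: 'q
  define R where "R X Y M m \<longleftrightarrow> (\<forall>i\<in>X. (\<Sum>j\<in>Y. M i j) = m)"
    for X Y :: "('g \<times> 'q) set" and M and m :: 'a
  have R_block: "R (B i) (B j) M m \<longleftrightarrow> (\<forall>g\<in>carrier G. (\<Sum>h\<in>carrier G. M (g, i) (h, j)) = m)"
    for i j M m
  proof -
    have "B j = (\<lambda>h. (h, j)) ` carrier G" for j by (auto simp: B_def)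
    then show ?thesis by (auto simp: R_def sum.reindex inj_on_def)
  qed
  define M1 where "M1 = paths (carrier G \<times> Q) M"
  define N1 where "N1 = paths Q N"
  have inv1: "M1 (k \<otimes> g, i) (k \<otimes> h, j) = M1 (g, i) (h, j)"
    if k: "k \<in> carrier G" "g \<in> carrier G" "h \<in> carrier G" for k g h i j
  proof -
    define \<sigma> where "\<sigma> = (\<lambda>(g, i :: 'q). (k \<otimes> g, i))"
    have img: "\<sigma> ` (carrier G \<times> Q) = carrier G \<times> Q"
    proof
      show "\<sigma> ` (carrier G \<times> Q) \<subseteq> carrier G \<times> Q"
        using k by (auto simp: \<sigma>_def)
      have "(g, i) = \<sigma> (inv k \<otimes> g, i)" if "g \<in> carrier G" for g i
        using that k by (simp add: \<sigma>_def flip: m_assoc)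
      then show "carrier G \<times> Q \<subseteq> \<sigma> ` (carrier G \<times> Q)"
        using k by (auto intro!: image_eqI)
    qed
    have "M1 (\<sigma> (g, i)) (\<sigma> (h, j)) = paths (carrier G \<times> Q) (\<lambda>p q. M (\<sigma> p) (\<sigma> q)) (g, i) (h, j)"
      unfolding M1_def using fin insert.hyps k
      by (subst paths_reindex[symmetric]) (auto simp: inj_on_def \<sigma>_def img[unfolded \<sigma>_def])
    also have "\<dots> = M1 (g, i) (h, j)"
      unfolding M1_def
      by (rule paths_cong[where R = "carrier G \<times> UNIV" and C = "carrier G \<times> UNIV"])
        (use fin insert.hyps k inv in \<open>auto simp: \<sigma>_def\<close>)
    finally show ?thesis by (simp add: \<sigma>_def)
  qed
  have R1: "R (B i) (B j) M1 (N1 i j)" if "i \<in> U" "j \<in> U" for i j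
    unfolding R_block M1_def N1_def using insert that by blast
  have q: "q \<in> U" using insert.prems by simp
  have "R (B i) (B j) (paths (B q) M1) (bypass q N1 i j)"
  proof (rule block_bypass[where R = R and C = U])
    show "R (B q) (B q) (paths (B q) M1) (N1 q q * star (N1 q q))"
      unfolding R_block
    proof
      fix g assume g: "g \<in> carrier G"
      have B: "B q = (\<lambda>g. (g, q)) ` carrier G" by (auto simp: B_def)
      have "(\<Sum>h\<in>carrier G. paths (B q) M1 (g, q) (h, q)) =
          (\<Sum>h\<in>carrier G. paths (carrier G) (\<lambda>g h. M1 (g, q) (h, q)) g h)"
        unfolding B
        by (rule sum.cong[OF refl], rule paths_reindex[OF fin]) (auto simp: inj_on_def)
      also have "\<dots> = N1 q q * star (N1 q q)"
        by (rule group_paths_row_sum[OF G fin g]) (use inv1 R1[OF q q] g in \<open>auto simp: R_block\<close>)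
      finally show "(\<Sum>h\<in>carrier G. paths (B q) M1 (g, q) (h, q)) = N1 q q * star (N1 q q)" .
    qed
  next
    fix X Y Z M m M' m'
    assume *: "finite Y" "R X Y M m" "R Y Z M' m'"
    then show "R X Z (\<lambda>i j. \<Sum>k\<in>Y. M i k * M' k j) (m * m')"
      unfolding R_def
      by (subst sum.swap) (simp flip: sum_distrib_left sum_distrib_right)
  qed (use R1 q insert.prems fin in \<open>auto simp: R_def sum.distrib B_def\<close>)
  moreover have "carrier G \<times> insert q Q = B q \<union> carrier G \<times> Q"
    by (auto simp: B_def)
  then have "paths (carrier G \<times> insert q Q) M = paths (B q) M1"
    using insert.hyps fin by (simp add: M1_def) (rule paths_Un, auto simp: B_def)
  ultimately show ?case
    using insert.hyps insert.prems by (simp add: R_block paths_insert N1_def)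
qed

end

section \<open>Sums of weighted transformations\<close>

text \<open>
  The matrix \<open>\<Sum> a R\<^bsub>f\<^esub>\<close> of a list of weighted transformations \<open>(a, f)\<close>.
\<close>

definition transf :: "('a \<times> ('i \<Rightarrow> 'i)) list \<Rightarrow> 'i \<Rightarrow> 'i \<Rightarrow> 'a::semiring_1" where
  "transf L i j = (\<Sum>(a, f)\<leftarrow>L. if f i = j then a else 0)"

definition weight :: "('a \<times> ('i \<Rightarrow> 'i)) list \<Rightarrow> 'a::semiring_1" where
  "weight L = (\<Sum>(a, f)\<leftarrow>L. a)"

text \<open>
  On \<open>X \<times> Y\<close>, the matrix \<open>M\<close> is a sum of weighted functions from \<open>X\<close> to \<open>Y\<close> of total weight \<open>n\<close>.
  In particular, for finite \<open>Y\<close> all rows of \<open>M\<close> have the sum \<open>n\<close>.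
\<close>

definition transf_sum :: "'i set \<Rightarrow> 'i set \<Rightarrow> ('i \<Rightarrow> 'i \<Rightarrow> 'a::semiring_1) \<Rightarrow> 'a \<Rightarrow> bool" where
  "transf_sum X Y M n \<longleftrightarrow> (\<exists>L. (\<forall>(a, f)\<in>set L. f ` X \<subseteq> Y) \<and>
     (\<forall>i\<in>X. \<forall>j\<in>Y. M i j = transf L i j) \<and> n = weight L)"

lemma transf_simps [simp]:
  "transf [] i j = 0" "transf ((a, f) # L) i j = (if f i = j then a else 0) + transf L i j"
  "transf (L @ L') i j = transf L i j + transf L' i j"
  by (simp_all add: transf_def)

lemma weight_simps [simp]:
  "weight [] = 0" "weight ((a, f) # L) = a + weight L" "weight (L @ L') = weight L + weight L'"
  by (simp_all add: weight_def)

lemma transf_sumI: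
  "(\<And>a f. (a, f) \<in> set L \<Longrightarrow> f ` X \<subseteq> Y) \<Longrightarrow> (\<And>i j. i \<in> X \<Longrightarrow> j \<in> Y \<Longrightarrow> M i j = transf L i j) \<Longrightarrow>
    n = weight L \<Longrightarrow> transf_sum X Y M n"
  unfolding transf_sum_def by blast

lemma transf_sumE:
  assumes "transf_sum X Y M n"
  obtains L where "\<And>a f. (a, f) \<in> set L \<Longrightarrow> f ` X \<subseteq> Y"
    "\<And>i j. i \<in> X \<Longrightarrow> j \<in> Y \<Longrightarrow> M i j = transf L i j" "n = weight L"
  using assms unfolding transf_sum_def by blast

lemma transf_sum_cong:
  "transf_sum X Y M n \<Longrightarrow> (\<And>i j. i \<in> X \<Longrightarrow> j \<in> Y \<Longrightarrow> M' i j = M i j) \<Longrightarrow> transf_sum X Y M' n"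
  unfolding transf_sum_def by auto

lemma transf_sum_zero: "transf_sum X Y (\<lambda>i j. 0) 0"
  by (rule transf_sumI[of "[]"]) auto

lemma transf_sum_single: "f ` X \<subseteq> Y \<Longrightarrow> transf_sum X Y (\<lambda>i j. if f i = j then a else 0) a"
  by (rule transf_sumI[of "[(a, f)]"]) auto

lemma transf_sum_add:
  assumes "transf_sum X Y M m" "transf_sum X Y M' m'"
  shows "transf_sum X Y (\<lambda>i j. M i j + M' i j) (m + m')"
proof -
  obtain L where L: "\<And>a f. (a, f) \<in> set L \<Longrightarrow> f ` X \<subseteq> Y"
    "\<And>i j. i \<in> X \<Longrightarrow> j \<in> Y \<Longrightarrow> M i j = transf L i j" "m = weight L"
    using transf_sumE[OF assms(1)] by metis
  obtain L' where L': "\<And>a f. (a, f) \<in> set L' \<Longrightarrow> f ` X \<subseteq> Y"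
    "\<And>i j. i \<in> X \<Longrightarrow> j \<in> Y \<Longrightarrow> M' i j = transf L' i j" "m' = weight L'"
    using transf_sumE[OF assms(2)] by metis
  show ?thesis
  proof (rule transf_sumI[of "L @ L'"])
    show "f ` X \<subseteq> Y" if "(a, f) \<in> set (L @ L')" for a f
      using that L(1)[of a f] L'(1)[of a f] by auto
  qed (simp_all add: L(2,3) L'(2,3))
qed

lemma transf_sum_sum:
  assumes "finite S" "\<And>s. s \<in> S \<Longrightarrow> transf_sum X Y (M s) (m s)"
  shows "transf_sum X Y (\<lambda>i j. \<Sum>s\<in>S. M s i j) (\<Sum>s\<in>S. m s)"
  using assms
proof (induction S rule: finite_induct)
  case empty
  then show ?case by (simp add: transf_sum_zero)
next
  case (insert s S)
  then show ?case by (simp add: transf_sum_add)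
qed

lemma sum_indicator_mult:
  "finite Y \<Longrightarrow> y \<in> Y \<Longrightarrow> (\<Sum>k\<in>Y. (if y = k then a else 0) * g k) = a * (g y :: 'a::semiring_1)"
  by (subst sum.cong[OF refl, of _ _ "\<lambda>k. if y = k then a * g k else 0"]) auto

lemma transf_comp_right:
  "transf (map (\<lambda>(b, g). (a * b, g \<circ> f)) L) i j = a * transf L (f i) j"
  "weight (map (\<lambda>(b, g). (a * b, g \<circ> f)) L) = a * weight L"
  by (induction L) (auto simp: distrib_left)

lemma transf_sum_comp:
  assumes fin: "finite Y" and "transf_sum X Y M m" "transf_sum Y Z M' m'"
  shows "transf_sum X Z (\<lambda>i j. \<Sum>k\<in>Y. M i k * M' k j) (m * m')"
proof -
  obtain L where L: "\<And>a f. (a, f) \<in> set L \<Longrightarrow> f ` X \<subseteq> Y"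
    "\<And>i j. i \<in> X \<Longrightarrow> j \<in> Y \<Longrightarrow> M i j = transf L i j" "m = weight L"
    using transf_sumE[OF assms(2)] by metis
  have "transf_sum X Z (\<lambda>i j. \<Sum>k\<in>Y. transf L i k * M' k j) (weight L * m')"
    using L(1)
  proof (induction L)
    case Nil
    then show ?case by (simp add: transf_sum_zero)
  next
    case (Cons af L)
    obtain a f where af: "af = (a, f)" by (cases af)
    obtain L' where L': "\<And>b g. (b, g) \<in> set L' \<Longrightarrow> g ` Y \<subseteq> Z"
      "\<And>i j. i \<in> Y \<Longrightarrow> j \<in> Z \<Longrightarrow> M' i j = transf L' i j" "m' = weight L'"
      using transf_sumE[OF assms(3)] by metis
    have f: "f ` X \<subseteq> Y" using Cons.prems af by auto
    have "transf_sum X Z (\<lambda>i j. \<Sum>k\<in>Y. (if f i = k then a else 0) * M' k j) (a * m')"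
    proof (rule transf_sumI[of "map (\<lambda>(b, g). (a * b, g \<circ> f)) L'"])
      fix i j assume "i \<in> X" "j \<in> Z"
      then show "(\<Sum>k\<in>Y. (if f i = k then a else 0) * M' k j) =
          transf (map (\<lambda>(b, g). (a * b, g \<circ> f)) L') i j"
        using f by (subst sum_indicator_mult[OF fin]) (auto simp: transf_comp_right L'(2))
    next
      fix b g assume "(b, g) \<in> set (map (\<lambda>(b, g). (a * b, g \<circ> f)) L')"
      then show "g ` X \<subseteq> Z"
        using f L'(1) by (fastforce simp: image_subset_iff)
    qed (simp add: transf_comp_right L'(3))
    moreover have "transf_sum X Z (\<lambda>i j. \<Sum>k\<in>Y. transf L i k * M' k j) (weight L * m')"
      by (rule Cons.IH) (use Cons.prems in auto)
    ultimately have "transf_sum X Z (\<lambda>i j. (\<Sum>k\<in>Y. (if f i = k then a else 0) * M' k j)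
        + (\<Sum>k\<in>Y. transf L i k * M' k j)) (a * m' + weight L * m')"
      by (rule transf_sum_add)
    then show ?case
      by (simp add: af distrib_right sum.distrib)
  qed
  then show ?thesis
    unfolding L(3) by (rule transf_sum_cong) (simp add: L(2))
qed

lemma transf_sum_row_sum:
  assumes "finite Y" "transf_sum X Y M n" "i \<in> X"
  shows "(\<Sum>j\<in>Y. M i j) = n"
proof -
  obtain L where L: "\<And>a f. (a, f) \<in> set L \<Longrightarrow> f ` X \<subseteq> Y"
    "\<And>i j. i \<in> X \<Longrightarrow> j \<in> Y \<Longrightarrow> M i j = transf L i j" "n = weight L"
    using transf_sumE[OF assms(2)] by metis
  have "(\<Sum>j\<in>Y. transf L i j) = weight L"
    using L(1)
  proof (induction L)
    case (Cons af L)
    obtain a f where af: "af = (a, f)" by (cases af)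
    have "(\<Sum>j\<in>Y. transf L i j) = weight L"
      by (rule Cons.IH) (use Cons.prems in auto)
    moreover have "(\<Sum>j\<in>Y. if f i = j then a else 0) = a"
      using Cons.prems[of a f] assms(1,3) af by (auto simp: image_subset_iff)
    ultimately show ?case
      by (simp add: af sum.distrib)
  qed simp
  then show ?thesis by (simp add: L assms(3))
qed

lemma transf_map_set:
  assumes "finite H"
  obtains L where "set L = (\<lambda>h. (w h, h)) ` H" "weight L = (\<Sum>h\<in>H. w h)"
    "\<And>i j. transf L i j = (\<Sum>h\<in>H. if h i = j then w h else 0)"
proof -
  obtain hs where "set hs = H" "distinct hs"
    using finite_distinct_list[OF assms] by blast
  then show ?thesis
    by (intro that[of "map (\<lambda>h. (w h, h)) hs"])
      (auto simp: transf_def weight_def o_def sum_list_distinct_conv_sum_set)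
qed

context iteration_type
begin

subsection \<open>Permutations\<close>

text \<open>
  If all transformations are permutations of \<open>Q\<close>, the weight of a permutation \<open>h\<close> in the path sum is the
  entry at \<open>(id, h)\<close> of the path sum of the group matrix \<open>MG\<close> of the symmetric group.
\<close>

lemma transf_paths_permutations:
  fixes Q :: "'i set" and L :: "('a \<times> ('i \<Rightarrow> 'i)) list"
  assumes Q: "finite Q" and L: "\<And>a f. (a, f) \<in> set L \<Longrightarrow> f permutes Q"
  shows "transf_sum Q Q (paths Q (transf L)) (weight L * star (weight L))"
proof -
  define G :: "('i \<Rightarrow> 'i) monoid" where
    "G = \<lparr>carrier = {p. p permutes Q}, mult = (\<lambda>p q. q \<circ> p), one = id\<rparr>"
  have G_simps [simp]: "carrier G = {p. p permutes Q}" "p \<otimes>\<^bsub>G\<^esub> q = q \<circ> p" "\<one>\<^bsub>G\<^esub> = id" for p q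
    by (simp_all add: G_def)
  have G: "group G"
  proof (rule groupI)
    fix p assume "p \<in> carrier G"
    then show "\<exists>q\<in>carrier G. q \<otimes>\<^bsub>G\<^esub> p = \<one>\<^bsub>G\<^esub>"
      by (auto intro!: exI[of _ "inv_into UNIV p"] simp: permutes_inv permutes_inv_o)
  qed (auto simp: permutes_compose permutes_id o_assoc)
  have fin: "finite (carrier G)"
    using finite_permutations[OF Q] by simp
  define M :: "('i \<Rightarrow> 'i) \<times> 'i \<Rightarrow> ('i \<Rightarrow> 'i) \<times> 'i \<Rightarrow> 'a" where
    "M = (\<lambda>(g, i) (h, j). \<Sum>(a, f)\<leftarrow>L. if f \<circ> g = h \<and> f i = j then a else 0)"
  have M: "M (g, i) (h, j) = (\<Sum>(a, f)\<leftarrow>L. if f \<circ> g = h \<and> f i = j then a else 0)" for g i h j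
    unfolding M_def by simp
  define MG where "MG g h = (\<Sum>(a, f)\<leftarrow>L. if f \<circ> g = h then a else 0)" for g h :: "'i \<Rightarrow> 'i"
  have cancel: "f \<circ> (g \<circ> k) = h \<circ> k \<longleftrightarrow> f \<circ> g = h" if "k permutes Q" for f g h k :: "'i \<Rightarrow> 'i"
    using permutes_surj[OF that] by (auto simp: fun_eq_iff surj_def) metis
  have inv: "M (k \<otimes>\<^bsub>G\<^esub> g, i) (k \<otimes>\<^bsub>G\<^esub> h, j) = M (g, i) (h, j)" if "k \<in> carrier G" for k g h i j
    using that by (simp add: M cancel)
  have invG: "MG (k \<otimes>\<^bsub>G\<^esub> g) (k \<otimes>\<^bsub>G\<^esub> h) = MG g h" if "k \<in> carrier G" for k g h
    using that by (simp add: MG_def cancel)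
  have rowM: "(\<Sum>h\<in>carrier G. M (g, i) (h, j)) = transf L i j" if "g \<in> carrier G" for g i j
    using L unfolding M transf_def
  proof (induction L)
    case (Cons af L)
    obtain a f where af: "af = (a, f)" by (cases af)
    have "f \<circ> g \<in> carrier G"
      using Cons.prems[of a f] that af by (auto intro: permutes_compose)
    then have "(\<Sum>h\<in>carrier G. if f \<circ> g = h \<and> f i = j then a else 0) = (if f i = j then a else 0)"
      using fin by (cases "f i = j") auto
    moreover have "(\<Sum>h\<in>carrier G. \<Sum>(a, f)\<leftarrow>L. if f \<circ> g = h \<and> f i = j then a else 0)
        = (\<Sum>(a, f)\<leftarrow>L. if f i = j then a else 0)"
      by (rule Cons.IH) (use Cons.prems in auto)
    ultimately show ?case
      by (simp only: af list.map sum_list.Cons prod.case sum.distrib)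
  qed simp
  have rowG: "(\<Sum>h\<in>carrier G. MG g h) = weight L" if "g \<in> carrier G" for g
    using L unfolding MG_def weight_def
  proof (induction L)
    case (Cons af L)
    obtain a f where af: "af = (a, f)" by (cases af)
    have "f \<circ> g \<in> carrier G"
      using Cons.prems[of a f] that af by (auto intro: permutes_compose)
    then have "(\<Sum>h\<in>carrier G. if f \<circ> g = h then a else 0) = a"
      using fin by auto
    moreover have "(\<Sum>h\<in>carrier G. \<Sum>(a, f)\<leftarrow>L. if f \<circ> g = h then a else 0)
        = (\<Sum>(a, f)\<leftarrow>L. a)"
      by (rule Cons.IH) (use Cons.prems in auto)
    ultimately show ?case
      by (simp only: af list.map sum_list.Cons prod.case sum.distrib)
  qed simp
  have id: "id \<in> carrier G" by (simp add: permutes_id)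
  define w where "w h = paths (carrier G) MG id h" for h
  have wsum: "(\<Sum>h\<in>carrier G. w h) = weight L * star (weight L)"
    unfolding w_def by (rule group_paths_row_sum[OF G fin id]) (use invG rowG id in auto)
  have paths_eq: "paths Q (transf L) q q' = (\<Sum>h\<in>carrier G. if h q = q' then w h else 0)"
    if qq: "q \<in> Q" "q' \<in> Q" for q q'
  proof -
    \<comment> \<open>The states \<open>(g, g q)\<close> are those reachable from \<open>(id, q)\<close>; the matrix restricted to them is a copy of
the group matrix.\<close>
    define \<sigma> where "\<sigma> g = (g, g q)" for g :: "'i \<Rightarrow> 'i"
    define R where "R = \<sigma> ` carrier G"
    have R: "R \<subseteq> carrier G \<times> Q"
      using qq by (auto simp: R_def \<sigma>_def permutes_in_image)
    have finGQ: "finite (carrier G \<times> Q)" using fin Q by simp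
    have inj: "inj_on \<sigma> (carrier G)" by (auto simp: inj_on_def \<sigma>_def)
    have closed: "M p p' = 0" if "p \<in> R" "p' \<notin> R" for p p'
    proof -
      obtain g where g: "g \<in> carrier G" "p = (g, g q)" using \<open>p \<in> R\<close> by (auto simp: R_def \<sigma>_def)
      obtain h j where h: "p' = (h, j)" by (cases p')
      have "(if f \<circ> g = h \<and> f (g q) = j then a else 0) = 0" if "(a, f) \<in> set L" for a f
      proof -
        have "f \<circ> g \<in> carrier G"
          using L[OF that] g by (auto intro: permutes_compose)
        then have "(f \<circ> g, f (g q)) \<in> R" by (auto simp: R_def \<sigma>_def image_iff)
        then show ?thesis using \<open>p' \<notin> R\<close> h by auto
      qed
      then have "map (\<lambda>(a, f). if f \<circ> g = h \<and> f (g q) = j then a else 0) L = map (\<lambda>_. 0) L"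
        by (intro map_cong) auto
      then show ?thesis
        unfolding g h M by (simp only: sum_list_0)
    qed
    have idR: "(id, q) \<in> R" using id by (auto simp: R_def \<sigma>_def image_iff)
    have "paths Q (transf L) q q' = (\<Sum>h\<in>carrier G. paths (carrier G \<times> Q) M (id, q) (h, q'))"
      by (rule group_block_row_sum[OF G fin Q order_refl, symmetric]) (use inv rowM id qq in auto)
    also have "\<dots> = (\<Sum>h\<in>carrier G. if h q = q' then w h else 0)"
    proof (rule sum.cong[OF refl])
      fix h assume h: "h \<in> carrier G"
      show "paths (carrier G \<times> Q) M (id, q) (h, q') = (if h q = q' then w h else 0)"
      proof (cases "h q = q'")
        case False
        then have "(h, q') \<notin> R" by (auto simp: R_def \<sigma>_def)
        then show ?thesis
          using False paths_closed_rows(2)[OF finGQ R closed idR] by simp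
      next
        case True
        have "paths (carrier G \<times> Q) M (id, q) (h, q') = paths R M (\<sigma> id) (\<sigma> h)"
          using paths_closed_rows(1)[OF finGQ R closed idR] True by (simp add: \<sigma>_def)
        also have "\<dots> = paths (carrier G) (\<lambda>g h. M (\<sigma> g) (\<sigma> h)) id h"
          unfolding R_def by (rule paths_reindex[OF fin inj])
        also have "(\<lambda>g h. M (\<sigma> g) (\<sigma> h)) = MG"
        proof (intro ext)
          fix g h :: "'i \<Rightarrow> 'i"
          have "(f \<circ> g = h \<and> f (g q) = h q) = (f \<circ> g = h)" for f :: "'i \<Rightarrow> 'i" by auto
          then show "M (\<sigma> g) (\<sigma> h) = MG g h"
            by (simp add: M \<sigma>_def MG_def)
        qed
        finally show ?thesis using True by (simp only: w_def simp_thms if_True)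
      qed
    qed
    finally show ?thesis .
  qed
  obtain L' where L': "set L' = (\<lambda>h. (w h, h)) ` carrier G" "weight L' = (\<Sum>h\<in>carrier G. w h)"
    "\<And>i j. transf L' i j = (\<Sum>h\<in>carrier G. if h i = j then w h else 0)"
    using transf_map_set[OF fin, of w] by blast
  show ?thesis
    by (rule transf_sumI[of L'])
      (use L'(1) in \<open>auto simp: L'(2) wsum L'(3) paths_eq permutes_in_image simp del: G_simps(1)\<close>, auto simp: permutes_in_image)
qed

subsection \<open>Arbitrary transformations\<close>

lemma transf_sum_block_bypass:
  fixes B :: "'c \<Rightarrow> 'i set" and M :: "'i \<Rightarrow> 'i \<Rightarrow> 'a"
  assumes "finite (B e)" "\<And>c d. c \<in> C \<Longrightarrow> d \<in> C \<Longrightarrow> transf_sum (B c) (B d) M (N c d)"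
    and "e \<in> C" "transf_sum (B e) (B e) (paths (B e) M) (N e e * star (N e e))"
    and "c \<in> C" "d \<in> C"
  shows "transf_sum (B c) (B d) (paths (B e) M) (bypass e N c d)"
  by (rule block_bypass[where R = transf_sum and C = C])
    (use assms in \<open>auto intro: transf_sum_add transf_sum_comp\<close>)

text \<open>
  Sums of weighted transformations are closed under star, which acts on the total weights.
\<close>

theorem transf_sum_paths:
  fixes Q :: "nat set" and M :: "nat \<Rightarrow> nat \<Rightarrow> 'a"
  assumes "finite Q" "transf_sum Q Q M n"
  shows "transf_sum Q Q (paths Q M) (n * star n)"
  using assms
proof (induction "card Q" arbitrary: Q M n rule: less_induct)
  case less
  note Q = \<open>finite Q\<close> and IH = less.hyps
  have main: "transf_sum Q Q (paths Q (transf L)) (weight L * star (weight L))"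
    if "\<And>a f. (a, f) \<in> set L \<Longrightarrow> f ` Q \<subseteq> Q" for L :: "('a \<times> (nat \<Rightarrow> nat)) list"
    using that
  proof (induction "length L" arbitrary: L rule: less_induct)
    case (less L)
    show ?case
    proof (cases "\<forall>(a, f)\<in>set L. inj_on f Q")
      case True
      define L' where "L' = map (\<lambda>(a, f). (a, \<lambda>x. if x \<in> Q then f x else x)) L"
      have perm: "f permutes Q" if af: "(a, f) \<in> set L'" for a f
      proof -
        obtain f0 where f0: "(a, f0) \<in> set L" "f = (\<lambda>x. if x \<in> Q then f0 x else x)"
          using af by (auto simp: L'_def)
        then have "inj_on f0 Q" "f0 ` Q \<subseteq> Q" using True less.prems by auto
        then have "bij_betw f0 Q Q"
          using Q by (simp add: bij_betw_def endo_inj_surj)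
        then have "bij_betw f Q Q"
          by (rule bij_betw_cong[THEN iffD1, rotated]) (simp add: f0)
        then show ?thesis
          by (rule bij_imp_permutes) (simp add: f0)
      qed
      have "transf L' i j = transf L i j" if "i \<in> Q" for i j
        unfolding L'_def using that by (induction L) auto
      then have "paths Q (transf L) i j = paths Q (transf L') i j" if "i \<in> Q" "j \<in> Q" for i j
        using that by (intro paths_cong[OF Q]) auto
      moreover have "weight L' = weight L"
        unfolding L'_def by (induction L) auto
      moreover have "transf_sum Q Q (paths Q (transf L')) (weight L' * star (weight L'))"
        by (rule transf_paths_permutations[OF Q perm])
      ultimately show ?thesis
        by (simp add: transf_sum_cong[of Q Q "paths Q (transf L')"])
    next
      case False
      then obtain a c where ac: "(a, c) \<in> set L" "\<not> inj_on c Q" by auto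
      obtain L1 L2 where L12: "L = L1 @ (a, c) # L2" using split_list[OF ac(1)] by blast
      define L' where "L' = L1 @ L2"
      have L: "transf L i j = (if c i = j then a else 0) + transf L' i j"
        "weight L = a + weight L'" for i j
        by (simp_all add: L12 L'_def add_ac)
      have c: "c ` Q \<subseteq> Q" using ac(1) less.prems by auto
      have card: "card (c ` Q) < card Q"
        using ac(2) Q card_image_le[OF Q, of c] eq_card_imp_inj_on[OF Q, of c] by linarith
      obtain Q' where Q': "finite Q'" "Q' \<inter> Q = {}" "card Q' = card (c ` Q)"
      proof -
        have "infinite (- Q)" using Diff_infinite_finite[OF Q infinite_UNIV_nat] by (simp add: Compl_eq_Diff_UNIV)
        then obtain Q' where "finite Q'" "card Q' = card (c ` Q)" "Q' \<subseteq> - Q"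
          using infinite_arbitrarily_large by blast
        then show ?thesis using that by blast
      qed
      obtain g where g: "bij_betw g (c ` Q) Q'"
        using finite_same_card_bij[of "c ` Q" Q'] Q Q' by auto
      define g' where "g' = inv_into (c ` Q) g"
      have g'g: "g' (g (c i)) = c i" "g (c i) \<in> Q'" if "i \<in> Q" for i
        using that g by (auto simp: g'_def bij_betw_def)
      have g'_in: "g' k \<in> Q" if "k \<in> Q'" for k
        using that g c inv_into_into[of k g "c ` Q"] by (auto simp: g'_def bij_betw_def)
      have L'_Q: "\<And>b f. (b, f) \<in> set L' \<Longrightarrow> f ` Q \<subseteq> Q"
        using less.prems by (auto simp: L'_def L12)
      \<comment> \<open>The graph \<open>G\<close> on \<open>Q\<close> and a disjoint copy \<open>Q'\<close> of the image of \<open>c\<close> routes every use of \<open>c\<close> through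
\<open>Q'\<close>.  The copy has fewer states than \<open>Q\<close>, and inside \<open>Q\<close> there is one transformation less, so both
blocks can be eliminated by the induction hypotheses.\<close>
      define B where "B x = (if x then Q' else Q)" for x
      define N where "N = (\<lambda>x y. if x then (if y then 0 else 1) else if y then a else weight L')"
      define G where "G i j =
        (if i \<in> Q then (if j \<in> Q then transf L' i j else if g (c i) = j then a else 0)
         else if j \<in> Q then (if g' i = j then 1 else 0) else 0)" for i j
      have G: "transf_sum (B x) (B y) G (N x y)" for x y
      proof -
        have disj: "k \<notin> Q" if "k \<in> Q'" for k using that Q' by auto
        have "transf_sum Q' Q' G 0"
          by (rule transf_sum_cong[OF transf_sum_zero]) (auto simp: G_def disj)
        moreover have "transf_sum Q' Q G 1"
          by (rule transf_sum_cong[OF transf_sum_single[of g']]) (use g'_in in \<open>auto simp: G_def disj\<close>)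
        moreover have "transf_sum Q Q' G a"
          by (rule transf_sum_cong[OF transf_sum_single[of "g \<circ> c"]]) (use g'g in \<open>auto simp: G_def disj\<close>)
        moreover have "transf_sum Q Q G (weight L')"
          by (rule transf_sumI[of L', OF L'_Q]) (auto simp: G_def)
        ultimately show ?thesis by (cases x; cases y) (simp_all add: B_def N_def)
      qed
      have IH1: "transf_sum Q Q (paths Q (transf L')) (weight L' * star (weight L'))"
        by (rule less.hyps) (use L'_Q in \<open>auto simp: L'_def L12\<close>)
      have "transf_sum Q Q (paths Q G) (weight L' * star (weight L'))"
        by (rule transf_sum_cong[OF IH1], rule paths_cong[OF Q order_refl order_refl]) (auto simp: G_def)
      then have H: "transf_sum (B x) (B y) (paths Q G) (bypass False N x y)" for x y
        using transf_sum_block_bypass[of B False UNIV G N x y] G Q by (simp add: B_def N_def)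
      define H N' where "H = paths Q G" and "N' = bypass False N"
      have "transf_sum Q' Q' (paths Q' H) (N' True True * star (N' True True))"
      proof (rule IH)
        show "transf_sum Q' Q' H (N' True True)"
          using H[of True True] by (simp add: B_def H_def N'_def)
      qed (use card Q' in auto)
      then have "transf_sum Q Q (paths Q' H) (bypass True N' False False)"
        using transf_sum_block_bypass[of B True UNIV H N' False False] H Q'
        by (simp add: B_def H_def N'_def)
      moreover have "bypass True N' False False = weight L * star (weight L)"
      proof -
        have "bypass True N False False = weight L"
          by (simp add: bypass_def N_def L add.commute)
        then show ?thesis
          unfolding N'_def bypass_commute[of True] by (subst bypass_self) simp
      qed
      moreover have "paths Q' H i j = paths Q (transf L) i j" if "i \<in> Q" "j \<in> Q" for i j
      proof -
        \<comment> \<open>Eliminating \<open>Q'\<close> first merely reinstates the transformation \<open>c\<close>.\<close>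
        have "paths Q' H = paths Q (paths Q' G)"
          unfolding H_def using Q Q' by (metis Int_commute Un_commute paths_Un)
        moreover have "paths Q (paths Q' G) i j = paths Q (transf L) i j"
        proof (rule paths_cong[OF Q order_refl order_refl _ that])
          fix i j assume ij: "i \<in> Q" "j \<in> Q"
          have disj: "k \<notin> Q" if "k \<in> Q'" for k using that Q' by auto
          have "paths Q' G k j = (if g' k = j then 1 else 0)" if "k \<in> Q'" for k
            using that ij disj by (subst paths_unfold_left[OF Q'(1)]) (simp add: G_def)
          then have "paths Q' G i j = transf L' i j +
              (\<Sum>k\<in>Q'. (if g (c i) = k then a else 0) * (if g' k = j then 1 else 0))"
            using ij disj by (subst paths_unfold_left[OF Q'(1)]) (simp add: G_def)
          also have "\<dots> = transf L i j"
            using ij g'g by (subst sum_indicator_mult[OF Q'(1)]) (auto simp: L add.commute)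
          finally show "paths Q' G i j = transf L i j" .
        qed
        ultimately show ?thesis by simp
      qed
      ultimately show ?thesis
        by (auto elim: transf_sum_cong)
    qed
  qed
  obtain L where L: "\<And>a f. (a, f) \<in> set L \<Longrightarrow> f ` Q \<subseteq> Q"
    "\<And>i j. i \<in> Q \<Longrightarrow> j \<in> Q \<Longrightarrow> M i j = transf L i j" "n = weight L"
    using transf_sumE[OF less.prems(2)] by metis
  show ?case
    unfolding L(3)
    by (rule transf_sum_cong[OF main[OF L(1)]]) (auto intro!: paths_cong[OF Q] simp: L(2))
qed

text \<open>
  The same for several blocks, the fibres of \<open>\<pi>\<close>, with functions between different blocks.
\<close>

theorem transf_sum_block_paths:
  fixes I :: "nat set" and \<pi> :: "nat \<Rightarrow> 'c" and M :: "nat \<Rightarrow> nat \<Rightarrow> 'a"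
  assumes I: "finite I" and C: "finite C" "\<pi> ` I \<subseteq> C"
    and M: "\<And>c d. c \<in> C \<Longrightarrow> d \<in> C \<Longrightarrow> transf_sum {i\<in>I. \<pi> i = c} {i\<in>I. \<pi> i = d} M (N c d)"
    and cd: "c \<in> C" "d \<in> C"
  shows "transf_sum {i\<in>I. \<pi> i = c} {i\<in>I. \<pi> i = d} (paths I M) (paths C N c d)"
proof -
  define B where "B c = {i\<in>I. \<pi> i = c}" for c
  have finB: "finite (B c)" for c using I by (simp add: B_def)
  have "transf_sum (B c) (B d) (paths (\<Union>(B ` D)) M) (paths D N c d)"
    if "finite D" "D \<subseteq> C" "c \<in> C" "d \<in> C" for D c d
    using that
  proof (induction D arbitrary: c d rule: finite_induct)
    case empty
    then show ?case using M by (simp add: B_def)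
  next
    case (insert e D)
    define M1 N1 where "M1 = paths (\<Union>(B ` D)) M" and "N1 = paths D N"
    have IH: "transf_sum (B c) (B d) M1 (N1 c d)" if "c \<in> C" "d \<in> C" for c d
      unfolding M1_def N1_def using insert that by blast
    have "paths (\<Union>(B ` insert e D)) M = paths (B e) M1"
      unfolding M1_def using insert.hyps finB
      by (simp, intro paths_Un) (auto simp: B_def)
    moreover have "paths (insert e D) N = bypass e N1"
      unfolding N1_def using insert.hyps by (simp add: paths_insert)
    moreover have "transf_sum (B c) (B d) (paths (B e) M1) (bypass e N1 c d)"
      using insert.prems
      by (intro transf_sum_block_bypass[where C = C] finB IH transf_sum_paths) auto
    ultimately show ?case by simp
  qed
  from this[OF C(1) order_refl cd] have "transf_sum (B c) (B d) (paths (\<Union>(B ` C)) M) (paths C N c d)" .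
  moreover have "\<Union>(B ` C) = I" using C by (auto simp: B_def)
  ultimately show ?thesis by (simp add: B_def)
qed

end

section \<open>Functional simulations\<close>

text \<open>
  If \<open>X\<close> is the \<open>0\<close>-\<open>1\<close> matrix of the function \<open>\<pi>\<close>, the hypothesis on the blocks is a refined form of \<open>M X = X N\<close>, and
  the conclusion is \<open>M\<^sup>* X = X N\<^sup>*\<close>.
\<close>

lemma (in iteration_type) functional_star:
  fixes I J :: "nat set" and M N :: "nat \<Rightarrow> nat \<Rightarrow> 'a"
  assumes I: "finite I" "finite J" "\<pi> ` I \<subseteq> J"
    and M: "\<And>c d. c \<in> J \<Longrightarrow> d \<in> J \<Longrightarrow> transf_sum {i\<in>I. \<pi> i = c} {i\<in>I. \<pi> i = d} M (N c d)"
    and i: "i \<in> I" "d \<in> J"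
  shows "(\<Sum>j | j \<in> I \<and> \<pi> j = d. star_on I M i j) = star_on J N (\<pi> i) d"
proof -
  have "(\<Sum>j | j \<in> I \<and> \<pi> j = d. paths I M i j) = paths J N (\<pi> i) d"
    by (rule transf_sum_row_sum[OF _ transf_sum_block_paths[OF I(1,2,3) M]]) (use i I in auto)
  moreover have "(\<Sum>j | j \<in> I \<and> \<pi> j = d. unit_mat i j :: 'a) = unit_mat (\<pi> i) d"
  proof (cases "\<pi> i = d")
    case True
    then have "(\<Sum>j | j \<in> I \<and> \<pi> j = d. unit_mat i j * 1 :: 'a) = 1"
      by (intro sum_unit_mat_left) (use i I in auto)
    with True show ?thesis by (simp add: unit_mat_def)
  next
    case False
    then show ?thesis by (auto simp: unit_mat_def intro!: sum.neutral)
  qed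
  ultimately show ?thesis by (simp add: star_on_def sum.distrib)
qed

subsection \<open>The opposite semiring\<close>

text \<open>
  The same additive structure with the reversed product.
\<close>

datatype 'a opposite = Opp (unopp: 'a)

instantiation opposite :: (semiring_1) semiring_1
begin

definition "0 = Opp 0"
definition "1 = Opp 1"
definition "x + y = Opp (unopp x + unopp y)"
definition "x * y = Opp (unopp y * unopp x)"

instance
  by standard
    (auto simp: zero_opposite_def one_opposite_def plus_opposite_def times_opposite_def
      algebra_simps opposite.expand)

end

instantiation opposite :: (star) star
begin

definition "star x = Opp (star (unopp x))"

instance ..

end

lemma unopp_simps [simp]:
  "unopp 0 = 0" "unopp 1 = 1" "unopp (x + y) = unopp x + unopp y" "unopp (x * y) = unopp y * unopp x"
  by (simp_all add: zero_opposite_def one_opposite_def plus_opposite_def times_opposite_def)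

lemma unopp_star [simp]: "unopp (star x) = star (unopp x)"
  by (simp add: star_opposite_def)

lemma unopp_sum [simp]: "unopp (\<Sum>i\<in>S. f i) = (\<Sum>i\<in>S. unopp (f i))"
  by (induction S rule: infinite_finite_induct) auto

lemma opposite_eq_iff: "x = y \<longleftrightarrow> unopp x = unopp y"
  using opposite.expand by auto

lemma conway_type_opposite:
  assumes "conway_type TYPE('a::{semiring_1,star})"
  shows "conway_type TYPE('a opposite)"
proof -
  interpret conway_type "TYPE('a)" by (rule assms)
  show ?thesis
  proof (unfold_locales, goal_cases)
    case (6 a b)
    show ?case
      by (simp add: opposite_eq_iff star_sum[of "unopp a" "unopp b"] star_shift)
  next
    case (7 a b)
    show ?case
      by (subst opposite_eq_iff) (simp add: star_prod[of "unopp b" "unopp a"] mult.assoc)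
  qed auto
qed

lemma unopp_paths:
  assumes "conway_type TYPE('a::{semiring_1,star})" "finite I"
  shows "unopp (paths I M i j) = paths I (\<lambda>i j. unopp (M j i :: 'a opposite)) j i"
proof -
  interpret conway_type "TYPE('a)" by (rule assms)
  interpret op: conway_type "TYPE('a opposite)" by (rule conway_type_opposite) (rule assms)
  show ?thesis
    using assms(2)
  proof (induction I arbitrary: i j rule: finite_induct)
    case (insert k I)
    then show ?case
      by (simp add: paths_insert op.paths_insert bypass_def mult.assoc)
  qed simp
qed

lemma unopp_star_on:
  assumes "conway_type TYPE('a::{semiring_1,star})" "finite I"
  shows "unopp (star_on I M i j) = star_on I (\<lambda>i j. unopp (M j i :: 'a opposite)) j i"
  using unopp_paths[OF assms] by (simp add: star_on_def unit_mat_def)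

text \<open>
  The star of a translation invariant matrix is translation invariant, hence its columns have the same sum as
  its rows.  This gives the group identities in the opposite semiring.
\<close>

lemma (in iteration_type) group_star_column_sum:
  fixes G (structure) and M :: "'g \<Rightarrow> 'g \<Rightarrow> 'a"
  assumes G: "group G" and fin: "finite (carrier G)" and g: "g \<in> carrier G"
    and inv: "\<And>k g h. k \<in> carrier G \<Longrightarrow> g \<in> carrier G \<Longrightarrow> h \<in> carrier G \<Longrightarrow> M (k \<otimes> g) (k \<otimes> h) = M g h"
  shows "(\<Sum>h\<in>carrier G. star_on (carrier G) M h g) = star (\<Sum>h\<in>carrier G. M \<one> h)"
proof -
  interpret group G by (rule G)
  have "star_on (carrier G) M h g = star_on (carrier G) M \<one> (inv h \<otimes> g)" if h: "h \<in> carrier G" for h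
  proof -
    have inj: "inj_on ((\<otimes>) h) (carrier G)" using h by (auto simp: inj_on_def)
    have img: "(\<otimes>) h ` carrier G = carrier G"
    proof
      have "x = h \<otimes> (inv h \<otimes> x)" if "x \<in> carrier G" for x
        using that h by (simp flip: m_assoc)
      then show "carrier G \<subseteq> (\<otimes>) h ` carrier G" using h by (auto intro!: image_eqI)
    qed (use h in auto)
    have "star_on ((\<otimes>) h ` carrier G) M (h \<otimes> \<one>) (h \<otimes> (inv h \<otimes> g)) =
        star_on (carrier G) (\<lambda>x y. M (h \<otimes> x) (h \<otimes> y)) \<one> (inv h \<otimes> g)"
      by (rule star_on_reindex[OF fin inj]) (use h g in auto)
    also have "\<dots> = star_on (carrier G) M \<one> (inv h \<otimes> g)"
      by (rule star_on_cong[OF fin]) (use h g inv in auto)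
    finally show ?thesis using h g by (simp add: img flip: m_assoc)
  qed
  then have "(\<Sum>h\<in>carrier G. star_on (carrier G) M h g) =
      (\<Sum>h\<in>carrier G. star_on (carrier G) M \<one> (inv h \<otimes> g))" by simp
  also have "\<dots> = (\<Sum>h\<in>carrier G. star_on (carrier G) M \<one> h)"
    by (rule sum.reindex_bij_witness[where i = "\<lambda>h. g \<otimes> inv h" and j = "\<lambda>h. inv h \<otimes> g"])
      (use g in \<open>auto simp: inv_mult_group m_assoc[symmetric]\<close>, simp_all add: m_assoc)
  also have "\<dots> = star (\<Sum>h\<in>carrier G. M \<one> h)"
    by (rule group_star_row_sum[OF G fin]) (use inv in auto)
  finally show ?thesis .
qed

lemma iteration_type_opposite:
  assumes "iteration_type TYPE('a::{semiring_1,star})"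
  shows "iteration_type TYPE('a opposite)"
proof -
  interpret iteration_type "TYPE('a)" by (rule assms)
  interpret op: conway_type "TYPE('a opposite)"
    by (rule conway_type_opposite) unfold_locales
  show ?thesis
  proof (unfold_locales, goal_cases)
    case (8 G n x)
    then interpret group G by simp
    have car: "carrier G = {..<n}" using 8(2) by (simp add: atLeast0LessThan)
    have n: "0 < n" using one_closed car by auto
    define y where "y i = unopp (x i)" for i
    define M where "M i j = y (inv\<^bsub>G\<^esub> j \<otimes>\<^bsub>G\<^esub> i)" for i j
    have "unopp (mat_star (group_mat G n x) $$ (0, j)) = star_on (carrier G) M j 0" if j: "j < n" for j
    proof -
      have "mat_star (group_mat G n x) $$ (0, j) =
          star_on {..<n} (\<lambda>i j. group_mat G n x $$ (i, j)) 0 j"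
        by (rule op.mat_star_index) (use n j in \<open>auto simp: group_mat_def\<close>)
      also have "unopp \<dots> = star_on {..<n} (\<lambda>i j. unopp (group_mat G n x $$ (j, i))) j 0"
        by (rule unopp_star_on) (unfold_locales, simp)
      also have "\<dots> = star_on {..<n} M j 0"
        by (rule star_on_cong) (use n j in \<open>auto simp: group_mat_def M_def y_def\<close>)
      finally show ?thesis by (simp add: car)
    qed
    then have "unopp (\<Sum>j<n. mat_star (group_mat G n x) $$ (0, j)) =
        (\<Sum>j\<in>carrier G. star_on (carrier G) M j 0)"
      by (simp add: car)
    also have "\<dots> = star (\<Sum>h\<in>carrier G. M \<one>\<^bsub>G\<^esub> h)"
    proof (rule group_star_column_sum[OF 8(1)])
      fix k g h assume "k \<in> carrier G" "g \<in> carrier G" "h \<in> carrier G"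
      then have "inv\<^bsub>G\<^esub> (k \<otimes>\<^bsub>G\<^esub> h) \<otimes>\<^bsub>G\<^esub> (k \<otimes>\<^bsub>G\<^esub> g) = inv\<^bsub>G\<^esub> h \<otimes>\<^bsub>G\<^esub> (inv\<^bsub>G\<^esub> k \<otimes>\<^bsub>G\<^esub> k) \<otimes>\<^bsub>G\<^esub> g"
        by (simp only: inv_mult_group m_assoc m_closed inv_closed)
      then show "M (k \<otimes>\<^bsub>G\<^esub> g) (k \<otimes>\<^bsub>G\<^esub> h) = M g h"
        using \<open>k \<in> _\<close> \<open>g \<in> _\<close> \<open>h \<in> _\<close> by (simp add: M_def)
    qed (use car n in auto)
    also have "(\<Sum>h\<in>carrier G. M \<one>\<^bsub>G\<^esub> h) = (\<Sum>h\<in>carrier G. y h)"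
      by (rule sum.reindex_bij_witness[where i = "\<lambda>h. inv\<^bsub>G\<^esub> h" and j = "\<lambda>h. inv\<^bsub>G\<^esub> h"])
        (auto simp: M_def)
    finally show ?case
      by (subst opposite_eq_iff) (simp add: y_def car)
  qed (auto simp: op.star_sum intro: op.star_prod)
qed

text \<open>
  The transposed statement: the blocks of the transpose of \<open>M\<close>, read in the opposite semiring, are
  sums of weighted transformations.
\<close>

lemma (in iteration_type) dual_functional_star:
  fixes I J :: "nat set" and M N :: "nat \<Rightarrow> nat \<Rightarrow> 'a"
  assumes I: "finite I" "finite J" "\<pi> ` I \<subseteq> J"
    and M: "\<And>c d. c \<in> J \<Longrightarrow> d \<in> J \<Longrightarrow>
      transf_sum {i\<in>I. \<pi> i = c} {i\<in>I. \<pi> i = d} (\<lambda>i j. Opp (M j i)) (Opp (N d c))"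
    and i: "i \<in> I" "d \<in> J"
  shows "(\<Sum>j | j \<in> I \<and> \<pi> j = d. star_on I M j i) = star_on J N d (\<pi> i)"
proof -
  interpret op: iteration_type "TYPE('a opposite)"
    by (rule iteration_type_opposite) unfold_locales
  have c: "conway_type TYPE('a)" by unfold_locales
  have "unopp (\<Sum>j | j \<in> I \<and> \<pi> j = d. star_on I (\<lambda>i j. Opp (M j i)) i j) =
      unopp (star_on J (\<lambda>i j. Opp (N j i)) (\<pi> i) d)"
    by (rule arg_cong[OF op.functional_star[OF I _ i]]) (rule M)
  then show ?thesis
    by (simp add: unopp_star_on[OF c I(1)] unopp_star_on[OF c I(2)])
qed

subsection \<open>Conjugation by invertible diagonal matrices\<close>

text \<open>
  If \<open>M X = X N\<close> with \<open>X\<close> diagonal, central and invertible, then the diagonal entries of \<open>M\<close> and \<open>N\<close> at eliminated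
  states agree, and every elimination step preserves the equation.
\<close>

lemma (in conway_type) diagonal_paths:
  fixes M N :: "'i \<Rightarrow> 'i \<Rightarrow> 'a"
  assumes "finite I" "I \<subseteq> S" "\<And>k. k \<in> S \<Longrightarrow> y k * x k = 1"
    and "\<And>i a. x i * a = a * x i" "\<And>i j. i \<in> S \<Longrightarrow> j \<in> S \<Longrightarrow> M i j * x j = x i * N i j"
    and "i \<in> S" "j \<in> S"
  shows "paths I M i j * x j = x i * paths I N i j"
  using assms(1,2,6,7)
proof (induction I arbitrary: i j rule: finite_induct)
  case empty
  then show ?case by (simp add: assms(5))
next
  case (insert k I)
  define P P' where "P = paths I M" and "P' = paths I N"
  have IH: "P i j * x j = x i * P' i j" if "i \<in> S" "j \<in> S" for i j
    unfolding P_def P'_def using insert that by auto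
  have k: "k \<in> S" using insert.prems by simp
  have cancel: "a = b" if "x k * a = x k * b" for a b :: 'a
  proof -
    have "y k * x k * a = y k * x k * b" using that by (simp add: mult.assoc)
    then show ?thesis using assms(3)[OF k] by simp
  qed
  have kk: "P k k = P' k k"
    by (rule cancel) (simp only: assms(4)[of k "P k k"] IH k)
  have "P i k * star (P k k) * P k j * x j = P i k * star (P k k) * (P k j * x j)"
    by (simp add: mult.assoc)
  also have "\<dots> = P i k * (star (P k k) * x k) * P' k j"
    by (simp add: IH k insert.prems mult.assoc)
  also have "\<dots> = (P i k * x k) * star (P k k) * P' k j"
    using assms(4)[of k "star (P k k)"] by (simp add: mult.assoc)
  also have "\<dots> = x i * (P' i k * star (P' k k) * P' k j)"
    by (simp add: IH k insert.prems kk mult.assoc)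
  finally show ?case
    using insert.hyps insert.prems
    by (simp add: paths_insert bypass_def IH distrib_left distrib_right flip: P_def P'_def)
qed

section \<open>Refinement in atomistic semirings\<close>

text \<open>
  Two decompositions of the same element have a common refinement, arranged as a matrix \<open>r\<close> with the
  given row and column sums.
\<close>

lemma atomistic_refinement:
  fixes x :: "'i \<Rightarrow> 'k::semiring_1" and y :: "'j \<Rightarrow> 'k"
  assumes "atomistic TYPE('k)" and A: "finite A" "A \<noteq> {}" and B: "finite B" "B \<noteq> {}"
    and eq: "(\<Sum>a\<in>A. x a) = (\<Sum>b\<in>B. y b)"
  obtains r where "\<And>a. a \<in> A \<Longrightarrow> (\<Sum>b\<in>B. r a b) = x a" "\<And>b. b \<in> B \<Longrightarrow> (\<Sum>a\<in>A. r a b) = y b"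
proof -
  define m n where "m = card A" and "n = card B"
  have mn: "m \<ge> 1" "n \<ge> 1"
    using A B by (auto simp: m_def n_def Suc_le_eq card_gt_0_iff)
  obtain g where g: "bij_betw g A {1..m}"
    using finite_same_card_bij[OF A(1) finite_atLeastAtMost, of 1 m] by (auto simp: m_def)
  obtain h where h: "bij_betw h B {1..n}"
    using finite_same_card_bij[OF B(1) finite_atLeastAtMost, of 1 n] by (auto simp: n_def)
  define g' h' where "g' = inv_into A g" and "h' = inv_into B h"
  have g': "bij_betw g' {1..m} A" and h': "bij_betw h' {1..n} B"
    using g h by (auto simp: g'_def h'_def bij_betw_inv_into)
  have g'g: "g' (g a) = a" "g a \<in> {1..m}" if "a \<in> A" for a
    using g that by (auto simp: g'_def bij_betw_def)
  have h'h: "h' (h a) = a" "h a \<in> {1..n}" if "a \<in> B" for a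
    using h that by (auto simp: h'_def bij_betw_def)
  have "(\<Sum>i\<in>{1..m}. x (g' i)) = (\<Sum>j\<in>{1..n}. y (h' j))"
    using eq sum.reindex_bij_betw[OF g', of x] sum.reindex_bij_betw[OF h', of y] by simp
  then obtain k z I J where I: "(\<Union>i\<in>{1..m}. I i) = {1..k::nat}" "disjoint_family_on I {1..m}"
    and J: "(\<Union>j\<in>{1..n}. J j) = {1..k}" "disjoint_family_on J {1..n}"
    and x: "\<forall>i\<in>{1..m}. x (g' i) = (\<Sum>l\<in>I i. z l)"
    and y: "\<forall>j\<in>{1..n}. y (h' j) = (\<Sum>l\<in>J j. z l)"
    using assms(1)[unfolded atomistic_def, rule_format, OF mn, of "\<lambda>i. x (g' i)" "\<lambda>j. y (h' j)"]
    by metis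
  have fin: "finite (I i)" if "i \<in> {1..m}" for i
    by (rule finite_subset[of _ "{1..k}"]) (use I that in auto)
  have fin': "finite (J j)" if "j \<in> {1..n}" for j
    by (rule finite_subset[of _ "{1..k}"]) (use J that in auto)
  define r where "r a b = (\<Sum>l\<in>I (g a) \<inter> J (h b). z l)" for a b
  show ?thesis
  proof (rule that[of r])
    fix a assume a: "a \<in> A"
    have "(\<Sum>b\<in>B. r a b) = (\<Sum>j\<in>{1..n}. \<Sum>l\<in>I (g a) \<inter> J j. z l)"
      unfolding r_def by (rule sum.reindex_bij_betw[OF h])
    also have "\<dots> = (\<Sum>l\<in>(\<Union>j\<in>{1..n}. I (g a) \<inter> J j). z l)"
      by (rule sum.UNION_disjoint[symmetric])
        (use fin g'g[OF a] J(2) in \<open>auto simp: disjoint_family_on_def\<close>)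
    also have "(\<Union>j\<in>{1..n}. I (g a) \<inter> J j) = I (g a)"
      using I(1) J(1) g'g[OF a] by blast
    finally show "(\<Sum>b\<in>B. r a b) = x a"
      using bspec[OF x g'g(2)[OF a]] g'g(1)[OF a] by simp
  next
    fix b assume b: "b \<in> B"
    have "(\<Sum>a\<in>A. r a b) = (\<Sum>i\<in>{1..m}. \<Sum>l\<in>I i \<inter> J (h b). z l)"
      unfolding r_def by (rule sum.reindex_bij_betw[OF g])
    also have "\<dots> = (\<Sum>l\<in>(\<Union>i\<in>{1..m}. I i \<inter> J (h b)). z l)"
      by (rule sum.UNION_disjoint[symmetric])
        (use fin' h'h[OF b] I(2) in \<open>auto simp: disjoint_family_on_def\<close>)
    also have "(\<Union>i\<in>{1..m}. I i \<inter> J (h b)) = J (h b)"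
      using I(1) J(1) h'h[OF b] by blast
    finally show "(\<Sum>a\<in>A. r a b) = y b"
      using bspec[OF y h'h(2)[OF b]] h'h(1)[OF b] by simp
  qed
qed

lemma transf_eq_sum_nth:
  "transf L i j = (\<Sum>l<length L. if snd (L ! l) i = j then fst (L ! l) else 0)"
  "weight L = (\<Sum>l<length L. fst (L ! l))"
  unfolding transf_def weight_def
  by (simp_all add: sum_list_sum_nth atLeast0LessThan case_prod_beta)

text \<open>
  Over an atomistic semiring, a matrix with constant row sums is a sum of weighted functions: a new
  row is refined against the weights found for the previous rows.
\<close>

lemma transf_sum_atomistic:
  fixes m :: "'i \<Rightarrow> 'i \<Rightarrow> 'k::semiring_1"
  assumes at: "atomistic TYPE('k)" and "finite X" and Y: "finite Y"
    and "\<And>i. i \<in> X \<Longrightarrow> (\<Sum>j\<in>Y. m i j) = n"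
  shows "transf_sum X Y m n"
  using assms(2,4)
proof (induction X rule: finite_induct)
  case empty
  show ?case by (rule transf_sumI[of "[(n, id)]"]) auto
next
  case (insert i0 X)
  then have "transf_sum X Y m n" by auto
  then obtain L0 where L0: "\<And>a f. (a, f) \<in> set L0 \<Longrightarrow> f ` X \<subseteq> Y"
    "\<And>i j. i \<in> X \<Longrightarrow> j \<in> Y \<Longrightarrow> m i j = transf L0 i j" "n = weight L0"
    using transf_sumE by metis
  have row: "(\<Sum>j\<in>Y. m i0 j) = n" using insert.prems by auto
  show ?case
  proof (cases "Y = {}")
    case True
    then show ?thesis
      using row by (intro transf_sumI[of "[]"]) auto
  next
    case False
    then obtain y0 where y0: "y0 \<in> Y" by blast
    \<comment> \<open>A transformation of weight \<open>0\<close> makes the list nonempty, as the refinement requires.\<close>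
    define L where "L = (0, \<lambda>_. y0) # L0"
    have L: "f ` X \<subseteq> Y" if "(a, f) \<in> set L" for a f
      using L0(1)[of a f] y0 that by (auto simp: L_def)
    have L': "m i j = transf L i j" if "i \<in> X" "j \<in> Y" for i j
      using L0(2)[OF that] by (simp add: L_def)
    have nL: "n = weight L" by (simp add: L_def L0(3))
    define A where "A = {..<length L}"
    have A: "finite A" "A \<noteq> {}" by (auto simp: A_def L_def)
    have "(\<Sum>l\<in>A. fst (L ! l)) = (\<Sum>j\<in>Y. m i0 j)"
      unfolding row nL transf_eq_sum_nth A_def ..
    from atomistic_refinement[OF at A Y False this] obtain r where
      r: "\<And>l. l \<in> A \<Longrightarrow> (\<Sum>j\<in>Y. r l j) = fst (L ! l)" "\<And>j. j \<in> Y \<Longrightarrow> (\<Sum>l\<in>A. r l j) = m i0 j"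
      by metis
    define f where "f p = (snd (L ! fst p))(i0 := snd p)" for p :: "nat \<times> 'i"
    have "transf_sum (insert i0 X) Y (\<lambda>i j. \<Sum>p\<in>A\<times>Y. if f p i = j then r (fst p) (snd p) else 0)
        (\<Sum>p\<in>A\<times>Y. r (fst p) (snd p))"
    proof (rule transf_sum_sum)
      fix p assume p: "p \<in> A \<times> Y"
      then have "(fst (L ! fst p), snd (L ! fst p)) \<in> set L" by (auto simp: A_def)
      from L[OF this] show "transf_sum (insert i0 X) Y
          (\<lambda>i j. if f p i = j then r (fst p) (snd p) else 0) (r (fst p) (snd p))"
        using p by (intro transf_sum_single) (auto simp: f_def)
    qed (use A Y in auto)
    also have "(\<Sum>p\<in>A\<times>Y. r (fst p) (snd p)) = n"
      using r(1) by (simp add: nL transf_eq_sum_nth sum.cartesian_product' flip: A_def)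
    finally have ts: "transf_sum (insert i0 X) Y
        (\<lambda>i j. \<Sum>p\<in>A\<times>Y. if f p i = j then r (fst p) (snd p) else 0) n" .
    have "m i j = (\<Sum>p\<in>A\<times>Y. if f p i = j then r (fst p) (snd p) else 0)"
      if ij: "i \<in> insert i0 X" "j \<in> Y" for i j
    proof (cases "i = i0")
      case True
      then show ?thesis
        using r(2)[OF ij(2)] Y ij(2) by (simp add: f_def sum.cartesian_product')
    next
      case False
      have "(\<Sum>p\<in>A\<times>Y. if f p i = j then r (fst p) (snd p) else 0) =
          (\<Sum>l\<in>A. if snd (L ! l) i = j then \<Sum>j\<in>Y. r l j else 0)"
        unfolding sum.cartesian_product' by (rule sum.cong) (use False in \<open>auto simp: f_def\<close>)
      also have "\<dots> = transf L i j"
        unfolding transf_eq_sum_nth A_def[symmetric] by (rule sum.cong) (auto simp: r(1))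
      finally show ?thesis using L' False ij by auto
    qed
    then show ?thesis
      by (rule transf_sum_cong[OF ts])
  qed
qed

section \<open>Formal power series\<close>

lemma coeff_simps [simp]:
  "coeff 0 w = 0"
  "coeff 1 w = (if w = [] then 1 else 0)"
  "coeff (s + t) w = coeff s w + coeff t w"
  "coeff (const k) w = (if w = [] then k else 0)"
  "coeff (letter a) w = (if w = [a] then 1 else 0)"
  "coeff (series_scale k s) w = k * coeff s w"
  "coeff (proper_part s) w = (if w = [] then 0 else coeff s w)"
  by (transfer, simp)+

lemma coeff_mult: "coeff (s * t) w = (\<Sum>i\<le>length w. coeff s (take i w) * coeff t (drop i w))"
  by transfer simp

lemma coeff_sum [simp]: "coeff (\<Sum>i\<in>S. f i) w = (\<Sum>i\<in>S. coeff (f i) w)"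
  by (induction S rule: infinite_finite_induct) auto

lemma coeff_mult_Nil [simp]: "coeff (s * t) [] = coeff s [] * coeff t []"
  by (simp add: coeff_mult)

lemma coeff_const_mult [simp]: "coeff (const k * s) w = k * coeff s w"
proof -
  have "coeff (const k * s) w = (\<Sum>i\<le>length w. if i = 0 then k * coeff s w else 0)"
    unfolding coeff_mult by (rule sum.cong) auto
  then show ?thesis by simp
qed

lemma coeff_mult_const [simp]: "coeff (s * const k) w = coeff s w * k"
proof -
  have "coeff (s * const k) w = (\<Sum>i\<le>length w. if i = length w then coeff s w * k else 0)"
    unfolding coeff_mult by (rule sum.cong) auto
  then show ?thesis by simp
qed

lemma series_scale_eq: "series_scale k s = const k * s"
  by (rule series_eqI) simp

lemma const_simps:
  "const 0 = 0" "const 1 = 1" "const (a + b) = const a + const b" "const (a * b) = const a * const b"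
  by (rule series_eqI; simp)+

lemma const_sum: "const (\<Sum>i\<in>S. f i) = (\<Sum>i\<in>S. const (f i))"
  by (induction S rule: infinite_finite_induct) (auto simp: const_simps)

lemma const_commute: "const k * s = s * (const k :: ('s, 'k::comm_semiring_1) series)"
  by (rule series_eqI) (simp add: mult.commute)

lemma proper_decomp: "s = const (coeff s []) + proper_part s"
  by (rule series_eqI) simp

lemma proper_part_unique:
  "s = const k + p \<Longrightarrow> proper p \<Longrightarrow> coeff s [] = k \<and> proper_part s = p"
  by (auto simp: proper_def intro!: series_eqI)

lemma proper_simps [simp]:
  "proper 0" "proper (proper_part s)" "proper (letter a)"
  "proper s \<Longrightarrow> proper t \<Longrightarrow> proper (s + t)" "proper s \<Longrightarrow> proper (s * t)" "proper t \<Longrightarrow> proper (s * t)" "proper s \<Longrightarrow> proper (series_scale k s)"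
  by (auto simp: proper_def)

lemma proper_sum: "(\<And>i. i \<in> S \<Longrightarrow> proper (f i)) \<Longrightarrow> proper (\<Sum>i\<in>S. f i)"
  by (simp add: proper_def)

subsection \<open>Proper linear systems\<close>

lemma coeff_mult_proper_cong:
  assumes "proper r" "\<And>v. length v < length w \<Longrightarrow> coeff x v = coeff y v"
  shows "coeff (r * x) w = coeff (r * y) w"
  unfolding coeff_mult
proof (rule sum.cong[OF refl])
  fix i assume "i \<in> {..length w}"
  then show "coeff r (take i w) * coeff x (drop i w) = coeff r (take i w) * coeff y (drop i w)"
    using assms by (cases "i = 0 \<or> w = []") (auto simp: proper_def)
qed

text \<open>
  A linear system with proper coefficients has at most one solution: the coefficient of the solution at a word
  is determined by the coefficients at shorter words.
\<close>

lemma proper_system_unique: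
  assumes "\<And>i j. i \<in> I \<Longrightarrow> j \<in> I \<Longrightarrow> proper (R i j)"
    and "\<And>i. i \<in> I \<Longrightarrow> X i = (\<Sum>j\<in>I. R i j * X j) + t i"
    and "\<And>i. i \<in> I \<Longrightarrow> Y i = (\<Sum>j\<in>I. R i j * Y j) + t i"
    and "i \<in> I"
  shows "X i = Y i"
proof (rule series_eqI)
  fix w
  show "coeff (X i) w = coeff (Y i) w"
    using \<open>i \<in> I\<close>
  proof (induction "length w" arbitrary: w i rule: less_induct)
    case less
    have "coeff (R i j * X j) w = coeff (R i j * Y j) w" if "j \<in> I" for j
      using less that assms(1) by (intro coeff_mult_proper_cong) auto
    then have "coeff ((\<Sum>j\<in>I. R i j * X j) + t i) w = coeff ((\<Sum>j\<in>I. R i j * Y j) + t i) w"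
      by simp
    then show ?case
      using assms(2)[OF less.prems] assms(3)[OF less.prems] by simp
  qed
qed

text \<open>
  The coefficients of the star of a proper series, by recursion on the length of the word; the sum ranges over its
  nonempty prefixes.
\<close>

function star_coeff :: "('s, 'k::semiring_1) series \<Rightarrow> 's list \<Rightarrow> 'k" where
  "star_coeff s w = (if w = [] then 1 else
     (\<Sum>i\<in>{1..length w}. coeff s (take i w) * star_coeff s (drop i w)))"
  by auto
termination by (relation "measure (\<lambda>(s, w). length w)") auto

declare star_coeff.simps [simp del]

lemma proper_star_unfold:
  assumes "proper s"
  shows "proper_star s = s * proper_star s + 1"
proof -
  define x where "x = Series (star_coeff s)"
  have cx: "coeff x w = star_coeff s w" for w
    by (simp add: x_def Series_inverse)
  have x: "x = s * x + 1"
  proof (rule series_eqI)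
    fix w
    show "coeff x w = coeff (s * x + 1) w"
    proof (cases "w = []")
      case True
      then show ?thesis
        using assms by (simp add: cx proper_def star_coeff.simps)
    next
      case False
      have "{..length w} = insert 0 {1..length w}" by auto
      then show ?thesis
        using assms False by (simp add: coeff_mult cx proper_def) (simp add: star_coeff.simps)
    qed
  qed
  have "y = x" if "y = s * y + 1" for y
    by (rule proper_system_unique[of "{()}" "\<lambda>_ _. s" "\<lambda>_. y" "\<lambda>_. 1" "\<lambda>_. x" "()"])
      (use assms that x in auto)
  with x show ?thesis
    unfolding proper_star_def by (rule theI)
qed

lemma proper_fix_unique:
  assumes "proper s" "x = s * x + t"
  shows "x = proper_star s * t"
proof (rule proper_system_unique[of "{()}" "\<lambda>_ _. s" "\<lambda>_. x" "\<lambda>_. t" "\<lambda>_. proper_star s * t" "()"])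
  have "proper_star s * t = (s * proper_star s + 1) * t"
    using proper_star_unfold[OF assms(1)] by simp
  then show "proper_star s * t = (\<Sum>j\<in>{()}. s * (proper_star s * t)) + t"
    by (simp add: distrib_right mult.assoc)
qed (use assms in auto)

subsection \<open>The star of a series\<close>

lemma star_series_eq:
  "star s = proper_star (const (star (coeff s [])) * proper_part s) * const (star (coeff s []))"
  by (simp add: star_series_def series_scale_eq Let_def)

lemma star_series_unfold:
  fixes s :: "('s, 'k::{comm_semiring_1,star}) series"
  assumes "s = const k + p" "proper p"
  shows "star s = const (star k) * (p * star s + 1)"
proof -
  define K where "K = (const (star k) :: ('s, 'k) series)"
  have *: "coeff s [] = k" "proper_part s = p"
    using proper_part_unique[OF assms] by auto
  have S: "star s = proper_star (K * p) * K"
    unfolding star_series_eq * K_def ..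
  have "proper_star (K * p) * K = (K * p * proper_star (K * p) + 1) * K"
    using assms(2) by (subst (1) proper_star_unfold) auto
  then show ?thesis
    unfolding S K_def[symmetric] by (simp add: distrib_left distrib_right mult.assoc)
qed

text \<open>
  The star of \<open>k + p\<close> with \<open>p\<close> proper is the only solution of \<open>x = k\<^sup>* (p x + 1)\<close>; most identities for the star
  of series are verified through this equation.
\<close>

lemma star_series_unique:
  fixes s :: "('s, 'k::{comm_semiring_1,star}) series"
  assumes "s = const k + p" "proper p" "x = const (star k) * (p * x + 1)"
  shows "x = star s"
proof -
  have *: "coeff s [] = k" "proper_part s = p"
    using proper_part_unique[OF assms(1,2)] by auto
  have "x = const (star k) * p * x + const (star k)"
    using assms(3) by (simp add: distrib_left mult.assoc)
  then have "x = proper_star (const (star k) * p) * const (star k)"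
    by (rule proper_fix_unique[rotated]) (use assms(2) in simp)
  then show ?thesis by (simp only: star_series_eq *)
qed

lemma conway_type_series:
  assumes "conway_type TYPE('k::{comm_semiring_1,star})"
  shows "conway_type TYPE(('s, 'k) series)"
proof -
  interpret conway_type "TYPE('k)" by (rule assms)
  have fix_left: "star s = 1 + s * star s" for s :: "('s, 'k) series"
  proof -
    define k p where "k = coeff s []" and "p = proper_part s"
    have s: "s = const k + p" "proper p"
      using proper_decomp[of s] by (simp_all add: k_def p_def)
    define K where "K = (const (star k) :: ('s, 'k) series)"
    have K: "K = 1 + const k * K"
      unfolding K_def by (subst star_unfold_left) (simp add: const_simps)
    have S: "star s = K * (p * star s + 1)"
      unfolding K_def by (rule star_series_unfold[OF s])
    then have "star s = (1 + const k * K) * (p * star s + 1)"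
      using K by simp
    also have "\<dots> = p * star s + 1 + const k * (K * (p * star s + 1))"
      by (simp add: distrib_right mult.assoc)
    also have "\<dots> = 1 + (const k + p) * star s"
      unfolding S[symmetric] by (simp add: distrib_right add_ac)
    also have "\<dots> = 1 + s * star s"
      by (simp flip: s(1))
    finally show ?thesis .
  qed
  have add: "star (x + y) = star (star x * y) * star x" for x y :: "('s, 'k) series"
  proof -
    define x0 a y0 b where "x0 = coeff x []" "a = proper_part x" "y0 = coeff y []" "b = proper_part y"
    have x: "x = const x0 + a" "proper a" and y: "y = const y0 + b" "proper b"
      using proper_decomp[of x] proper_decomp[of y] by (simp_all add: x0_a_y0_b_def)
    define v u where "v = star x0" and "u = star (v * y0)"
    define V U where "V = (const v :: ('s, 'k) series)" and "U = (const u :: ('s, 'k) series)"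
    define X where "X = star x"
    have X: "X = V + V * a * X"
      using star_series_unfold[OF x] by (simp add: X_def V_def v_def distrib_left mult.assoc add_ac)
    define p where "p = V * a * X * const y0 + X * b"
    have "X * y = X * const y0 + X * b"
      by (subst (1) y(1)) (simp add: distrib_left)
    also have "\<dots> = (V + V * a * X) * const y0 + X * b"
      by (simp flip: X)
    finally have Xy: "X * y = const (v * y0) + p" "proper p"
      using x(2) y(2) by (simp_all add: p_def distrib_right V_def const_simps add_ac)
    define w where "w = star (X * y)"
    have w: "w = U * (p * w + 1)"
      unfolding w_def U_def u_def by (rule star_series_unfold[OF Xy])
    define z where "z = w * X"
    have z: "z = X + X * y * z"
    proof -
      have "z = (1 + X * y * w) * X"
        unfolding z_def w_def by (subst fix_left) simp
      then show ?thesis by (simp add: distrib_right z_def mult.assoc)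
    qed
    have "const (star (x0 + y0)) * ((a + b) * z + 1) = U * (V * a * z + V * b * z + V)"
      by (simp add: star_sum const_simps U_def u_def V_def v_def distrib_left distrib_right mult.assoc)
    also have "V * a * z = V * a * (X + X * y * z)"
      using z by simp
    also have "\<dots> = V * a * X + V * a * X * (const y0 + b) * z"
      by (simp add: distrib_left mult.assoc flip: y(1))
    also have "U * (V * a * X + V * a * X * (const y0 + b) * z + V * b * z + V) =
        U * ((V + V * a * X) + (V + V * a * X) * b * z + V * a * X * const y0 * z)"
      by (simp add: distrib_left distrib_right mult.assoc add_ac)
    also have "\<dots> = U * (p * w + 1) * X"
      unfolding X[symmetric] by (simp add: p_def z_def distrib_left distrib_right mult.assoc add_ac)
    also have "\<dots> = z"
      unfolding w[symmetric] z_def ..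
    finally have "z = const (star (x0 + y0)) * ((a + b) * z + 1)" ..
    moreover have "x + y = const (x0 + y0) + (a + b)"
      by (subst x(1), subst y(1)) (simp add: const_simps add_ac)
    ultimately have "z = star (x + y)"
      using x(2) y(2) by (intro star_series_unique) auto
    then show ?thesis by (simp add: z_def w_def X_def)
  qed
  have mult: "star (x * y) = 1 + x * star (y * x) * y" for x y :: "('s, 'k) series"
  proof -
    define x0 a y0 b :: "('s, 'k) series" where "x0 = const (coeff x [])" "a = proper_part x"
      "y0 = const (coeff y [])" "b = proper_part y"
    have x: "x = x0 + a" "proper a" and y: "y = y0 + b" "proper b"
      using proper_decomp[of x] proper_decomp[of y] by (simp_all add: x0_a_y0_b_def)
    define k where "k = coeff x [] * coeff y []"
    define U where "U = (const (star k) :: ('s, 'k) series)"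
    have U: "U = 1 + x0 * y0 * U"
      unfolding U_def by (subst star_unfold_left) (simp add: x0_a_y0_b_def const_simps k_def)
    have U_comm: "U * z = z * U" and x0_comm: "x0 * z = z * x0" for z
      by (simp_all add: U_def x0_a_y0_b_def const_commute)
    define p q m where "p = x0 * b + a * y" and "q = y0 * a + b * x" and "m = star (y * x)"
    have k: "const k = x0 * y0" "const k = y0 * x0"
      by (simp_all add: k_def x0_a_y0_b_def const_simps mult.commute flip: const_simps(4))
    have "x * y = x0 * y + a * y" "y * x = y0 * x + b * x"
      by (subst (1) x(1), rule distrib_right) (subst (1) y(1), rule distrib_right)
    moreover have "x0 * y = x0 * y0 + x0 * b" "y0 * x = y0 * x0 + y0 * a"
      by (subst (1) y(1), rule distrib_left) (subst (1) x(1), rule distrib_left)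
    ultimately have xy: "x * y = const k + p" and yx: "y * x = const k + q"
      by (simp_all add: p_def q_def add.assoc k(1)) (simp flip: k)
    have pq: "proper p" "proper q"
      using x(2) y(2) by (simp_all add: p_def q_def)
    have m: "m = U * (q * m + 1)"
      unfolding m_def U_def by (rule star_series_unfold[OF yx pq(2)])
    have am: "a * y + a * y * x * m * y = a * m * y"
    proof -
      have "a * m * y = a * (1 + y * x * m) * y"
        unfolding m_def by (subst fix_left) simp
      then show ?thesis by (simp add: distrib_left distrib_right mult.assoc)
    qed
    define r where "r = 1 + x * m * y"
    have "x0 * m * y = x0 * (U * (q * m + 1)) * y"
      using m by simp
    also have "\<dots> = x0 * U * (y0 * a + b * x) * m * y + x0 * U * y"
      by (simp add: q_def distrib_left distrib_right mult.assoc)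
    also have "x0 * U * y = x0 * U * (y0 + b)"
      by (simp flip: y(1))
    also have "x0 * U * (y0 * a + b * x) * m * y + \<dots> =
        x0 * U * y0 * a * m * y + x0 * U * b * x * m * y + x0 * U * y0 + x0 * U * b"
      by (simp add: distrib_left distrib_right mult.assoc add_ac)
    also have "x0 * U * y0 = x0 * y0 * U"
      using U_comm[of y0] by (simp add: mult.assoc)
    also have "x0 * U = U * x0"
      using U_comm[of x0] by simp
    finally have "r = (1 + x0 * y0 * U) + (1 + x0 * y0 * U) * a * m * y
        + U * x0 * b * x * m * y + U * x0 * b"
      unfolding r_def by (subst x(1)) (simp add: distrib_right add_ac)
    also have "\<dots> = U * (x0 * b + (x0 * b * x * m * y + a * m * y) + 1)"
      unfolding U[symmetric] by (simp add: distrib_left mult.assoc add_ac)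
    also have "\<dots> = U * (p * r + 1)"
      unfolding am[symmetric] by (simp add: p_def r_def distrib_left distrib_right mult.assoc add_ac)
    finally have "r = star (x * y)"
      unfolding U_def by (intro star_series_unique[OF xy pq(1)])
    then show ?thesis by (simp add: r_def m_def)
  qed
  show ?thesis
    by unfold_locales (simp_all only: UNIV_I, rule add, rule mult)
qed

lemma star_const:
  assumes "conway_type TYPE('k::{comm_semiring_1,star})"
  shows "star (const k :: ('s, 'k) series) = const (star k)"
  using star_series_unique[of "const k" k 0 "const (star k) :: ('s, 'k) series"] by simp

lemma star_proper:
  assumes "conway_type TYPE('k::{comm_semiring_1,star})" "proper (s :: ('s, 'k) series)"
  shows "star s = proper_star s"
proof -
  interpret conway_type "TYPE('k)" by (rule assms)
  have "proper_part s = s" "coeff s [] = 0"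
    using assms(2) by (auto simp: proper_def intro: series_eqI)
  then show ?thesis by (simp add: star_series_eq const_simps)
qed

subsection \<open>Group identities for series\<close>

lemma proper_part_sum: "proper_part (\<Sum>i\<in>S. f i) = (\<Sum>i\<in>S. proper_part (f i))"
  by (rule series_eqI) simp

text \<open>
  Write the group matrix as \<open>A + R\<close> with \<open>A\<close> scalar and \<open>R\<close> proper.  By the group identity for the
  coefficients, the row sums of \<open>A\<^sup>*\<close> are constant; so are those of
  \<open>C = A\<^sup>* R\<close>.  The row sums of \<open>C\<^sup>*\<close> solve a proper linear system that is also solved by a constant vector, and the
  claim follows from \<open>(A + R)\<^sup>* = C\<^sup>* A\<^sup>*\<close>.
\<close>

lemma iteration_type_series:
  assumes "iteration_type TYPE('k::{comm_semiring_1,star})"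
  shows "iteration_type TYPE(('s, 'k) series)"
proof -
  interpret iteration_type "TYPE('k)" by (rule assms)
  have cK: "conway_type TYPE('k)" by unfold_locales
  interpret S: conway_type "TYPE(('s, 'k) series)" by (rule conway_type_series[OF cK])
  show ?thesis
  proof (unfold_locales, goal_cases)
    case (8 G n x)
    then interpret group G by simp
    define I where "I = carrier G"
    have car: "I = {..<n}" using 8(2) by (simp add: I_def atLeast0LessThan)
    have "\<one>\<^bsub>G\<^esub> \<in> I" by (simp add: I_def)
    then have n: "0 < n" by (cases n) (simp_all add: car)
    have I: "finite I" "0 \<in> I" using n by (simp_all add: car)
    define M where "M i j = x (inv\<^bsub>G\<^esub> i \<otimes>\<^bsub>G\<^esub> j)" for i j
    have inv: "M (k \<otimes>\<^bsub>G\<^esub> g) (k \<otimes>\<^bsub>G\<^esub> h) = M g h" if "k \<in> I" "g \<in> I" "h \<in> I" for k g h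
    proof -
      have "inv\<^bsub>G\<^esub> (k \<otimes>\<^bsub>G\<^esub> g) \<otimes>\<^bsub>G\<^esub> (k \<otimes>\<^bsub>G\<^esub> h) = inv\<^bsub>G\<^esub> g \<otimes>\<^bsub>G\<^esub> (inv\<^bsub>G\<^esub> k \<otimes>\<^bsub>G\<^esub> k) \<otimes>\<^bsub>G\<^esub> h"
        using that by (simp only: I_def inv_mult_group m_assoc m_closed inv_closed)
      then show ?thesis using that by (simp add: M_def I_def)
    qed
    define k \<rho> where "k = (\<Sum>h\<in>I. coeff (x h) [])" and "\<rho> = (\<Sum>h\<in>I. proper_part (x h))"
    define A0 A R where "A0 i j = coeff (M i j) []" and "A i j = (const (A0 i j) :: ('s, 'k) series)"
      and "R i j = proper_part (M i j)" for i j
    define K where "K = (const (star k) :: ('s, 'k) series)"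
    have A0_row: "(\<Sum>h\<in>I. star_on I A0 g h) = star k" if "g \<in> I" for g
    proof -
      have "(\<Sum>h\<in>carrier G. star_on (carrier G) A0 g h) = star (\<Sum>h\<in>carrier G. A0 \<one>\<^bsub>G\<^esub> h)"
        by (rule group_star_row_sum) (use 8(1) I that inv in \<open>auto simp: A0_def I_def\<close>)
      moreover have "(\<Sum>h\<in>carrier G. A0 \<one>\<^bsub>G\<^esub> h) = k"
        unfolding k_def I_def by (rule sum.cong) (auto simp: A0_def M_def)
      ultimately show ?thesis by (simp add: I_def)
    qed
    have R_row: "(\<Sum>h\<in>I. R g h) = \<rho>" if "g \<in> I" for g
    proof -
      have "(\<Sum>h\<in>carrier G. R g h) = (\<Sum>h\<in>carrier G. R \<one>\<^bsub>G\<^esub> h)"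
        by (rule group_row_sum_const[OF 8(1)]) (use that inv in \<open>auto simp: R_def I_def\<close>)
      also have "\<dots> = \<rho>"
        unfolding \<rho>_def I_def by (rule sum.cong) (auto simp: R_def M_def)
      finally show ?thesis by (simp add: I_def)
    qed
    have starA: "star_on I A i j = const (star_on I A0 i j)" for i j
      unfolding A_def
      by (rule star_on_hom[symmetric]) (use cK I S.conway_type_axioms in \<open>auto simp: const_simps star_const\<close>)
    define C where "C i j = (\<Sum>k\<in>I. star_on I A i k * R k j)" for i j
    define W where "W i = (\<Sum>j\<in>I. star_on I C i j)" for i
    have C_row: "(\<Sum>j\<in>I. C i j) = K * \<rho>" if "i \<in> I" for i
    proof -
      have "(\<Sum>j\<in>I. C i j) = (\<Sum>k\<in>I. star_on I A i k * (\<Sum>j\<in>I. R k j))"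
        unfolding C_def by (subst sum.swap) (simp add: sum_distrib_left)
      also have "\<dots> = (\<Sum>k\<in>I. star_on I A i k) * \<rho>"
        by (simp add: R_row sum_distrib_right)
      finally show ?thesis
        using A0_row[OF that] by (simp add: starA K_def flip: const_sum)
    qed
    have "proper \<rho>"
      unfolding \<rho>_def by (rule proper_sum) simp
    have "W 0 = proper_star (K * \<rho>)"
    proof (rule proper_system_unique[where I = I and R = C and X = W and t = "\<lambda>_. 1"
          and Y = "\<lambda>_. proper_star (K * \<rho>)"])
      show "proper (C i j)" for i j
        unfolding C_def R_def by (rule proper_sum) simp
      show "W i = (\<Sum>j\<in>I. C i j * W j) + 1" if "i \<in> I" for i
      proof -
        have "(\<Sum>j\<in>I. paths I C i j) = (\<Sum>j\<in>I. C i j * W j)"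
          unfolding W_def sum_distrib_left by (subst sum.swap) (simp add: S.paths_eq_mult_star_on[OF I(1)])
        moreover have "(\<Sum>j\<in>I. unit_mat i j) = (1 :: ('s, 'k) series)"
          using sum_unit_mat_left[OF I(1) that, of "\<lambda>_. 1 :: ('s, 'k) series"] by simp
        ultimately show ?thesis
          unfolding W_def[of i] star_on_def by (simp add: sum.distrib add.commute)
      qed
      show "proper_star (K * \<rho>) = (\<Sum>j\<in>I. C i j * proper_star (K * \<rho>)) + 1" if "i \<in> I" for i
        using proper_star_unfold[of "K * \<rho>"] \<open>proper \<rho>\<close> C_row[OF that]
        by (simp flip: sum_distrib_right)
    qed (use I in auto)
    moreover have "(\<Sum>j<n. mat_star (group_mat G n x) $$ (0, j)) = W 0 * K"
    proof -
      have "mat_star (group_mat G n x) $$ (0, j) = (\<Sum>k\<in>I. star_on I C 0 k * star_on I A k j)"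
        if j: "j < n" for j
      proof -
        have "mat_star (group_mat G n x) $$ (0, j) =
            star_on {..<n} (\<lambda>i j. group_mat G n x $$ (i, j)) 0 j"
          by (rule S.mat_star_index) (use n j in \<open>auto simp: group_mat_def\<close>)
        also have "\<dots> = star_on I (\<lambda>i j. A i j + R i j) 0 j"
          unfolding car
          by (rule S.star_on_cong) (use n j in
              \<open>auto simp: group_mat_def A_def A0_def R_def M_def simp flip: proper_decomp\<close>)
        also have "\<dots> = (\<Sum>k\<in>I. star_on I C 0 k * star_on I A k j)"
          unfolding C_def[abs_def] by (rule S.star_on_add) (use I j car in auto)
        finally show ?thesis .
      qed
      then have "(\<Sum>j<n. mat_star (group_mat G n x) $$ (0, j)) =
          (\<Sum>j\<in>I. \<Sum>k\<in>I. star_on I C 0 k * star_on I A k j)"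
        by (simp add: car)
      also have "\<dots> = (\<Sum>k\<in>I. star_on I C 0 k * (\<Sum>j\<in>I. star_on I A k j))"
        by (subst sum.swap) (simp add: sum_distrib_left)
      also have "\<dots> = W 0 * K"
        by (simp add: W_def starA A0_row K_def sum_distrib_right flip: const_sum)
      finally show ?thesis .
    qed
    moreover have "star (\<Sum>i<n. x i) = proper_star (K * \<rho>) * K"
      by (simp add: star_series_eq K_def \<rho>_def k_def car proper_part_sum)
    ultimately show ?case by simp
  next
    case (6 a b)
    show ?case by (rule S.star_sum)
  next
    case (7 a b)
    show ?case by (rule S.star_prod)
  qed auto
qed

subsection \<open>Rational series\<close>

lemma rat_proper_proper: "s \<in> rat_proper \<Sigma> \<Longrightarrow> proper s"
  by (induction rule: rat_proper.induct) (auto simp: proper_plus_def) 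

lemma rat_proper_subset_rat: "s \<in> rat_proper \<Sigma> \<Longrightarrow> s \<in> rat \<Sigma>"
  unfolding rat_def mem_Collect_eq by (intro exI[of _ 0] exI[of _ s]) (simp add: const_simps)

lemma const_in_rat: "const k \<in> rat \<Sigma>"
  unfolding rat_def using rat_proper.zero[of \<Sigma>] by force

lemma rat_add: "s \<in> rat \<Sigma> \<Longrightarrow> t \<in> rat \<Sigma> \<Longrightarrow> s + t \<in> rat \<Sigma>"
proof -
  assume "s \<in> rat \<Sigma>" "t \<in> rat \<Sigma>"
  then obtain k b l c where "s = const k + b" "t = const l + c" "b \<in> rat_proper \<Sigma>" "c \<in> rat_proper \<Sigma>"
    by (auto simp: rat_def)
  then have "s + t = const (k + l) + (b + c)" "b + c \<in> rat_proper \<Sigma>"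
    by (auto simp: const_simps add_ac intro: rat_proper.add)
  then show ?thesis unfolding rat_def by blast
qed

lemma rat_mult: "s \<in> rat \<Sigma> \<Longrightarrow> t \<in> rat \<Sigma> \<Longrightarrow> s * t \<in> rat \<Sigma>"
proof -
  assume "s \<in> rat \<Sigma>" "t \<in> rat \<Sigma>"
  then obtain k b l c where *: "s = const k + b" "t = const l + c" "b \<in> rat_proper \<Sigma>" "c \<in> rat_proper \<Sigma>"
    by (auto simp: rat_def)
  then have "s * t = const (k * l) + (series_scale k c + series_scale l b + b * c)"
    by (simp add: const_simps series_scale_eq const_commute[of l] distrib_left distrib_right add_ac)
  moreover have "series_scale k c + series_scale l b + b * c \<in> rat_proper \<Sigma>"
    using * by (intro rat_proper.add rat_proper.scale rat_proper.mult)
  ultimately show ?thesis unfolding rat_def by blast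
qed

lemma rat_star: "s \<in> rat \<Sigma> \<Longrightarrow> star s \<in> rat \<Sigma>"
proof -
  assume "s \<in> rat \<Sigma>"
  then obtain k b where *: "s = const k + b" "b \<in> rat_proper \<Sigma>"
    by (auto simp: rat_def)
  then have "coeff s [] = k" "proper_part s = b"
    using proper_part_unique rat_proper_proper by metis+
  then have "star s = proper_star (series_scale (star k) b) * const (star k)"
    by (simp add: star_series_eq series_scale_eq)
  also have "proper_star (series_scale (star k) b) = proper_plus (series_scale (star k) b) + 1"
    unfolding proper_plus_def
    by (rule proper_star_unfold) (use rat_proper_proper[OF *(2)] in simp)
  finally have "star s = (proper_plus (series_scale (star k) b) + const 1) * const (star k)"
    by (simp add: const_simps)
  moreover have "proper_plus (series_scale (star k) b) \<in> rat_proper \<Sigma>"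
    using * by (intro rat_proper.plus rat_proper.scale)
      (use rat_proper_proper[OF *(2)] in simp_all)
  ultimately show ?thesis
    by (simp only:) (intro rat_mult rat_add const_in_rat rat_proper_subset_rat)
qed

theorem rat_iteration_semialgebra:
  assumes "iteration_type TYPE('k::{comm_semiring_1,star})"
  shows "iteration_semialgebra (rat \<Sigma> :: ('s, 'k) series set) series_scale"
proof -
  interpret iteration_type "TYPE('k)" by (rule assms)
  have cK: "conway_type TYPE('k)" by unfold_locales
  interpret S: iteration_type "TYPE(('s, 'k) series)" by (rule iteration_type_series) (rule assms)
  show ?thesis
  proof (unfold_locales, goal_cases)
    case 1
    show ?case using const_in_rat[of 0] by (simp add: const_simps)
  next
    case 2
    show ?case using const_in_rat[of 1] by (simp add: const_simps)
  next
    case (13 a b k)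
    have "const k * (a * b) = const k * a * b" by (simp add: mult.assoc)
    also have "\<dots> = a * (const k * b)" by (simp add: const_commute[of k a] mult.assoc)
    finally show ?case by (simp add: series_scale_eq)
  next
    case (15 a b)
    show ?case by (rule S.star_sum)
  next
    case (16 a b)
    show ?case by (rule S.star_prod)
  next
    case (17 G n x)
    show ?case
      by (rule iteration_semiring.group_identity[OF S.iteration 17(1,2)]) simp
  next
    case (18 k)
    show ?case by (simp add: series_scale_eq star_const[OF cK])
  qed (auto simp: series_scale_eq const_simps rat_add rat_mult rat_star const_in_rat distrib_left
      distrib_right mult.assoc)
qed

section \<open>Rational expressions and automata\<close>

text \<open>
  A Conway semiring with a central copy of the scalars; the embedding sends \<open>k\<close> to the multiple \<open>k e\<close> of the
  unit.  The two instances are the series and the target of the morphism.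
\<close>

locale star_algebra =
  fixes emb :: "'k::{comm_semiring_1,star} \<Rightarrow> 'a::{semiring_1,star}"
  assumes conway_scalars: "conway_type TYPE('k)"
    and conway_algebra: "conway_type TYPE('a)"
    and emb_zero [simp]: "emb 0 = 0" and emb_one [simp]: "emb 1 = 1"
    and emb_add: "emb (k + l) = emb k + emb l"
    and emb_mult: "emb (k * l) = emb k * emb l"
    and emb_star: "emb (star k) = star (emb k)"
    and emb_commute: "emb k * a = a * emb k"
begin

sublocale conway_type "TYPE('a)"
  by (rule conway_algebra)

lemma emb_sum: "emb (\<Sum>i\<in>S. f i) = (\<Sum>i\<in>S. emb (f i))"
  by (induction S rule: infinite_finite_induct) (auto simp: emb_add)

lemma emb_star_on: "finite I \<Longrightarrow> emb (star_on I M i j) = star_on I (\<lambda>i j. emb (M i j)) i j"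
  by (rule star_on_hom)
    (auto simp: conway_scalars conway_algebra emb_add emb_mult emb_star)

end

text \<open>
  Rational expressions over scalars and letters.  The star is unrestricted.
\<close>

datatype (letters: 's, 'k) rexp =
  Scalar 'k
| Letter 's
| Add "('s, 'k) rexp" "('s, 'k) rexp"
| Mult "('s, 'k) rexp" "('s, 'k) rexp"
| Star "('s, 'k) rexp"
for map: map_rexp

primrec eval_rexp :: "('k \<Rightarrow> 'a::{semiring_1,star}) \<Rightarrow> ('s \<Rightarrow> 'a) \<Rightarrow> ('s, 'k) rexp \<Rightarrow> 'a" where
  "eval_rexp emb h (Scalar k) = emb k"
| "eval_rexp emb h (Letter a) = h a"
| "eval_rexp emb h (Add e f) = eval_rexp emb h e + eval_rexp emb h f"
| "eval_rexp emb h (Mult e f) = eval_rexp emb h e * eval_rexp emb h f"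
| "eval_rexp emb h (Star e) = star (eval_rexp emb h e)"

type_synonym ('s, 'k) edge = "nat \<times> ('k + 's) \<times> nat"

text \<open>
  A graph for an expression, with initial state \<open>p\<close> and final state \<open>q\<close>.  The new states are numbered from \<open>n\<close> on, and the
  first component of the result is the next unused number.  Transitions are labelled by scalars
  (\<open>Inl\<close>) or letters (\<open>Inr\<close>).
\<close>

primrec edges :: "nat \<Rightarrow> ('s, 'k::one) rexp \<Rightarrow> nat \<Rightarrow> nat \<Rightarrow> nat \<times> ('s, 'k) edge list" where
  "edges n (Scalar k) p q = (n, [(p, Inl k, q)])"
| "edges n (Letter a) p q = (n, [(p, Inr a, q)])"
| "edges n (Add e f) p q =
    (let (n1, L1) = edges n e p q; (n2, L2) = edges n1 f p q in (n2, L1 @ L2))"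
| "edges n (Mult e f) p q =
    (let (n1, L1) = edges (Suc n) e p n; (n2, L2) = edges n1 f n q in (n2, L1 @ L2))"
| "edges n (Star e) p q =
    (let (n1, L1) = edges (Suc n) e n n in (n1, [(p, Inl 1, n), (n, Inl 1, q)] @ L1))"

definition label_val :: "('k \<Rightarrow> 'a) \<Rightarrow> ('s \<Rightarrow> 'a) \<Rightarrow> 'k + 's \<Rightarrow> 'a" where
  "label_val emb h = case_sum emb h"

text \<open>
  The entry at \<open>(i, j)\<close> is the sum of the evaluated labels of all transitions from \<open>i\<close> to \<open>j\<close>.
\<close>

definition graph_mat ::
  "('k \<Rightarrow> 'a::semiring_1) \<Rightarrow> ('s \<Rightarrow> 'a) \<Rightarrow> ('s, 'k) edge list \<Rightarrow> nat \<Rightarrow> nat \<Rightarrow> 'a" where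
  "graph_mat emb h L i j = (\<Sum>(p, x, q)\<leftarrow>L. if i = p \<and> j = q then label_val emb h x else 0)"

lemma graph_mat_simps [simp]:
  "graph_mat emb h [] i j = 0"
  "graph_mat emb h ((p, x, q) # L) i j =
    (if i = p \<and> j = q then label_val emb h x else 0) + graph_mat emb h L i j"
  "graph_mat emb h (L @ L') i j = graph_mat emb h L i j + graph_mat emb h L' i j"
  by (simp_all add: graph_mat_def)

lemma edges_states_all:
  assumes "edges n e p q = (n', L)"
  shows "n \<le> n' \<and> (\<forall>(i, x, j)\<in>set L. (i = p \<or> n \<le> i \<and> i < n') \<and>
    (j = q \<or> n \<le> j \<and> j < n') \<and> (\<forall>a. x = Inr a \<longrightarrow> a \<in> letters e))"
  using assms
proof (induction e arbitrary: n p q n' L)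
  case (Add e f)
  obtain n1 L1 n2 L2 where E: "edges n e p q = (n1, L1)" "edges n1 f p q = (n2, L2)"
    by (metis surj_pair)
  then have "n' = n2" "L = L1 @ L2" using Add.prems by auto
  then show ?case
    using Add.IH(1)[OF E(1)] Add.IH(2)[OF E(2)] by fastforce
next
  case (Mult e f)
  obtain n1 L1 n2 L2 where E: "edges (Suc n) e p n = (n1, L1)" "edges n1 f n q = (n2, L2)"
    by (metis surj_pair)
  then have "n' = n2" "L = L1 @ L2" using Mult.prems by auto
  then show ?case
    using Mult.IH(1)[OF E(1)] Mult.IH(2)[OF E(2)] by fastforce
next
  case (Star e)
  obtain n1 L1 where E: "edges (Suc n) e n n = (n1, L1)"
    by (metis surj_pair)
  then have "n' = n1" "L = [(p, Inl 1, n), (n, Inl 1, q)] @ L1" using Star.prems by auto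
  then show ?case
    using Star.IH[OF E] by fastforce
qed auto

lemma edges_states:
  assumes "edges n e p q = (n', L)"
  shows "n \<le> n'" and "(i, x, j) \<in> set L \<Longrightarrow> i = p \<or> n \<le> i \<and> i < n'"
    and "(i, x, j) \<in> set L \<Longrightarrow> j = q \<or> n \<le> j \<and> j < n'"
    and "(i, Inr a, j) \<in> set L \<Longrightarrow> a \<in> letters e"
  using edges_states_all[OF assms] by fastforce+

lemma graph_mat_zero:
  assumes "\<And>x. (i, x, j) \<notin> set L"
  shows "graph_mat emb h L i j = 0"
  using assms
proof (induction L)
  case (Cons p L)
  obtain p1 x p2 where p: "p = (p1, x, p2)" by (cases p)
  from Cons show ?case by (force simp: p)
qed simp

context star_algebra
begin

text \<open>
  Inserting the graph \<open>L\<close> into any graph that does not touch its inner states \<open>S\<close>, and then eliminating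
  \<open>S\<close>, amounts to inserting a single transition of weight \<open>v\<close> from \<open>p\<close> to \<open>q\<close>.  The quantification
  over the surrounding graph \<open>M\<close> is what makes an induction over expressions possible.
\<close>

definition realizes ::
  "('s \<Rightarrow> 'a) \<Rightarrow> nat set \<Rightarrow> ('s, 'k) edge list \<Rightarrow> nat \<Rightarrow> nat \<Rightarrow> 'a \<Rightarrow> bool" where
  "realizes h S L p q v \<longleftrightarrow> (\<forall>M. (\<forall>i j. i \<in> S \<or> j \<in> S \<longrightarrow> M i j = 0) \<longrightarrow>
    (\<forall>i j. i \<notin> S \<longrightarrow> j \<notin> S \<longrightarrow>
      paths S (\<lambda>i j. M i j + graph_mat emb h L i j) i j = M i j + (if i = p \<and> j = q then v else 0)))"

lemma realizesD:
  assumes "realizes h S L p q v" "\<And>i j. i \<in> S \<or> j \<in> S \<Longrightarrow> M i j = 0" "i \<notin> S" "j \<notin> S"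
  shows "paths S (\<lambda>i j. M i j + graph_mat emb h L i j) i j = M i j + (if i = p \<and> j = q then v else 0)"
  using assms unfolding realizes_def by blast

lemma realizes_Un:
  fixes M :: "nat \<Rightarrow> nat \<Rightarrow> 'a"
  assumes S: "finite S1" "finite S2" "S1 \<inter> S2 = {}"
    and R1: "realizes h S1 L1 p1 q1 v1" and R2: "realizes h S2 L2 p2 q2 v2"
    and pq: "p1 \<notin> S2" "q1 \<notin> S2"
    and L2: "\<And>i x j. (i, x, j) \<in> set L2 \<Longrightarrow> i \<notin> S1 \<and> j \<notin> S1"
    and M: "\<And>i j. i \<in> S1 \<union> S2 \<or> j \<in> S1 \<union> S2 \<Longrightarrow> M i j = 0"
    and ij: "i \<notin> S1 \<union> S2" "j \<notin> S1 \<union> S2"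
  shows "paths (S1 \<union> S2) (\<lambda>i j. M i j + graph_mat emb h (L1 @ L2) i j) i j =
    M i j + (if i = p1 \<and> j = q1 then v1 else 0) + (if i = p2 \<and> j = q2 then v2 else 0)"
proof -
  define X where "X i j = M i j + (if i = p1 \<and> j = q1 then v1 else 0)" for i j
  have "paths (S1 \<union> S2) (\<lambda>i j. M i j + graph_mat emb h (L1 @ L2) i j) i j =
      paths S2 (paths S1 (\<lambda>i j. (M i j + graph_mat emb h L2 i j) + graph_mat emb h L1 i j)) i j"
    using paths_Un[OF S(2,1)] S(3) by (simp add: Un_commute Int_commute add_ac)
  also have "\<dots> = paths S2 (\<lambda>i j. X i j + graph_mat emb h L2 i j) i j"
  proof (rule paths_cong[OF S(2), where R = "- S1" and C = "- S1"])
    fix i j assume *: "i \<in> - S1" "j \<in> - S1"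
    have "paths S1 (\<lambda>i j. (M i j + graph_mat emb h L2 i j) + graph_mat emb h L1 i j) i j =
        (M i j + graph_mat emb h L2 i j) + (if i = p1 \<and> j = q1 then v1 else 0)"
    proof (rule realizesD[OF R1])
      fix i j assume "i \<in> S1 \<or> j \<in> S1"
      moreover from this have "graph_mat emb h L2 i j = 0"
        using L2 by (intro graph_mat_zero) blast
      ultimately show "M i j + graph_mat emb h L2 i j = 0"
        using M[of i j] by auto
    qed (use * in auto)
    then show "paths S1 (\<lambda>i j. (M i j + graph_mat emb h L2 i j) + graph_mat emb h L1 i j) i j =
        X i j + graph_mat emb h L2 i j"
      by (simp add: X_def add_ac)
  qed (use S(3) ij in auto)
  also have "\<dots> = X i j + (if i = p2 \<and> j = q2 then v2 else 0)"
    by (rule realizesD[OF R2]) (use M pq ij in \<open>auto simp: X_def\<close>)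
  finally show ?thesis by (simp add: X_def)
qed

lemma realizes_edges:
  assumes "edges n e p q = (n', L)" "p < n" "q < n"
  shows "realizes h {n..<n'} L p q (eval_rexp emb h e)"
  using assms
proof (induction e arbitrary: n p q n' L)
  case (Add e f)
  obtain n1 L1 n2 L2 where E: "edges n e p q = (n1, L1)" "edges n1 f p q = (n2, L2)"
    by (metis surj_pair)
  then have n': "n' = n2" "L = L1 @ L2" using Add.prems by auto
  have le: "n \<le> n1" "n1 \<le> n'" using edges_states(1)[OF E(1)] edges_states(1)[OF E(2)] n' by auto
  have S: "{n..<n'} = {n..<n1} \<union> {n1..<n'}" using le by auto
  have R1: "realizes h {n..<n1} L1 p q (eval_rexp emb h e)"
    using Add E by blast
  have R2: "realizes h {n1..<n'} L2 p q (eval_rexp emb h f)"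
    using Add E le n' by (metis order_less_le_trans)
  show ?case
    unfolding realizes_def
  proof (intro allI impI)
    fix M i j
    assume *: "\<forall>i j. i \<in> {n..<n'} \<or> j \<in> {n..<n'} \<longrightarrow> M i j = (0 :: 'a)" "i \<notin> {n..<n'}" "j \<notin> {n..<n'}"
    have "paths ({n..<n1} \<union> {n1..<n'}) (\<lambda>i j. M i j + graph_mat emb h (L1 @ L2) i j) i j =
      M i j + (if i = p \<and> j = q then eval_rexp emb h e else 0) + (if i = p \<and> j = q then eval_rexp emb h f else 0)"
    proof (rule realizes_Un[OF _ _ _ R1 R2])
      fix i x j assume "(i, x, j) \<in> set L2"
      from edges_states(2,3)[OF E(2) this] show "i \<notin> {n..<n1} \<and> j \<notin> {n..<n1}"
        using Add.prems by auto
    qed (use * Add.prems le in auto)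
    then show "paths {n..<n'} (\<lambda>i j. M i j + graph_mat emb h L i j) i j =
        M i j + (if i = p \<and> j = q then eval_rexp emb h (Add e f) else 0)"
      by (simp only: S n'(2)) (auto simp: add.assoc)
  qed
next
  case (Mult e f)
  obtain n1 L1 n2 L2 where E: "edges (Suc n) e p n = (n1, L1)" "edges n1 f n q = (n2, L2)"
    by (metis surj_pair)
  then have n': "n' = n2" "L = L1 @ L2" using Mult.prems by auto
  have le: "Suc n \<le> n1" "n1 \<le> n'" using edges_states(1)[OF E(1)] edges_states(1)[OF E(2)] n' by auto
  define S where "S = {Suc n..<n1} \<union> {n1..<n'}"
  have S: "{n..<n'} = {n} \<union> S" "n \<notin> S" "finite S" using le by (auto simp: S_def)
  have R1: "realizes h {Suc n..<n1} L1 p n (eval_rexp emb h e)"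
    using Mult E by (simp add: less_Suc_eq)
  have R2: "realizes h {n1..<n'} L2 n q (eval_rexp emb h f)"
    using Mult E le n' by auto
  show ?case
    unfolding realizes_def
  proof (intro allI impI)
    fix M i j
    assume *: "\<forall>i j. i \<in> {n..<n'} \<or> j \<in> {n..<n'} \<longrightarrow> M i j = (0 :: 'a)" "i \<notin> {n..<n'}" "j \<notin> {n..<n'}"
    define Y where "Y = paths S (\<lambda>i j. M i j + graph_mat emb h (L1 @ L2) i j)"
    have X: "Y i j =
      M i j + (if i = p \<and> j = n then eval_rexp emb h e else 0) + (if i = n \<and> j = q then eval_rexp emb h f else 0)"
      if "i \<notin> S" "j \<notin> S" for i j
      unfolding Y_def S_def
    proof (rule realizes_Un[OF _ _ _ R1 R2])
      fix i x j assume "(i, x, j) \<in> set L2"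
      from edges_states(2,3)[OF E(2) this] show "i \<notin> {Suc n..<n1} \<and> j \<notin> {Suc n..<n1}"
        using Mult.prems by auto
    qed (use *(1) Mult.prems(2,3) le that in \<open>auto simp: S_def\<close>)
    have M0: "M i n = 0" "M n j = 0" for i j using *(1) S(1) by auto
    have "paths ({n} \<union> S) (\<lambda>i j. M i j + graph_mat emb h (L1 @ L2) i j) i j =
        bypass n Y i j"
      using S(2,3) by (simp add: paths_insert Y_def)
    also have "\<dots> = M i j + (if i = p \<and> j = q then eval_rexp emb h e * eval_rexp emb h f else 0)"
      using *(2,3) S(1,2) Mult.prems(2,3) by (auto simp: bypass_def X M0)
    finally show "paths {n..<n'} (\<lambda>i j. M i j + graph_mat emb h L i j) i j =
        M i j + (if i = p \<and> j = q then eval_rexp emb h (Mult e f) else 0)"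
      by (simp only: S(1) n'(2)) simp
  qed
next
  case (Star e)
  obtain n1 L1 where E: "edges (Suc n) e n n = (n1, L1)"
    by (metis surj_pair)
  then have n': "n' = n1" "L = [(p, Inl 1, n), (n, Inl 1, q)] @ L1" using Star.prems by auto
  have le: "Suc n \<le> n'" using edges_states(1)[OF E] n' by auto
  define S where "S = {Suc n..<n'}"
  have S: "{n..<n'} = {n} \<union> S" "n \<notin> S" "finite S" using le by (auto simp: S_def)
  have R1: "realizes h S L1 n n (eval_rexp emb h e)"
    using Star E n' by (simp add: S_def)
  show ?case
    unfolding realizes_def
  proof (intro allI impI)
    fix M i j
    assume *: "\<forall>i j. i \<in> {n..<n'} \<or> j \<in> {n..<n'} \<longrightarrow> M i j = (0 :: 'a)" "i \<notin> {n..<n'}" "j \<notin> {n..<n'}"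
    define E where "E i j = M i j + ((if i = p \<and> j = n then 1 else 0) + (if i = n \<and> j = q then 1 else 0))"
      for i j
    have G: "(\<lambda>i j. M i j + graph_mat emb h L i j) = (\<lambda>i j. E i j + graph_mat emb h L1 i j)"
      by (intro ext) (simp add: n'(2) E_def label_val_def add_ac)
    define Y where "Y = paths S (\<lambda>i j. E i j + graph_mat emb h L1 i j)"
    have X: "Y i j = E i j + (if i = n \<and> j = n then eval_rexp emb h e else 0)" if "i \<notin> S" "j \<notin> S" for i j
      unfolding Y_def
      by (rule realizesD[OF R1]) (use *(1) that Star.prems(2,3) S(2) in \<open>auto simp: E_def S_def\<close>)
    have M0: "M i n = 0" "M n j = 0" for i j using *(1) S(1) by auto
    have "paths {n..<n'} (\<lambda>i j. M i j + graph_mat emb h L i j) i j =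
        bypass n Y i j"
      unfolding S(1) G using S(2,3) by (simp add: paths_insert Y_def)
    also have "\<dots> = M i j + (if i = p \<and> j = q then star (eval_rexp emb h e) else 0)"
      using *(2,3) S(1,2) Star.prems(2,3) by (auto simp: bypass_def X E_def M0)
    finally show "paths {n..<n'} (\<lambda>i j. M i j + graph_mat emb h L i j) i j =
        M i j + (if i = p \<and> j = q then eval_rexp emb h (Star e) else 0)"
      by simp
  qed
qed (auto simp: realizes_def label_val_def)

end

subsection \<open>Removal of scalar transitions\<close>

text \<open>
  The automaton of an expression.  Its graph has the states \<open>0\<close> (initial), \<open>1\<close> (final) and inner states
  numbered from \<open>2\<close>; its matrix is \<open>A + B\<close> with \<open>A\<close> scalar (\<open>scalar_mat\<close>) and \<open>B\<close> linear in the letters (coefficients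
  \<open>letter_mat\<close>).  As \<open>(A + B)\<^sup>* = (A\<^sup>* B)\<^sup>* A\<^sup>*\<close>, the matrix \<open>A\<^sup>* B\<close> (coefficients \<open>aut_mat\<close>) with the column
  \<open>1\<close> of \<open>A\<^sup>*\<close> as final vector (\<open>aut_out\<close>) has the same value.  All data are computed in the coefficient
  semiring, independently of the algebra in which the expression is evaluated.
\<close>

definition aut_dim :: "('s, 'k::one) rexp \<Rightarrow> nat" where
  "aut_dim e = fst (edges 2 e 0 1)"

definition scalar_mat :: "('s, 'k::semiring_1) rexp \<Rightarrow> nat \<Rightarrow> nat \<Rightarrow> 'k" where
  "scalar_mat e = graph_mat (\<lambda>k. k) (\<lambda>_. 0) (snd (edges 2 e 0 1))"

definition letter_mat :: "'s \<Rightarrow> ('s, 'k::semiring_1) rexp \<Rightarrow> nat \<Rightarrow> nat \<Rightarrow> 'k" where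
  "letter_mat a e = graph_mat (\<lambda>_. 0) (\<lambda>b. if b = a then 1 else 0) (snd (edges 2 e 0 1))"

definition aut_mat :: "'s \<Rightarrow> ('s, 'k::{semiring_1,star}) rexp \<Rightarrow> nat \<Rightarrow> nat \<Rightarrow> 'k" where
  "aut_mat a e i j =
    (\<Sum>k<aut_dim e. star_on {..<aut_dim e} (scalar_mat e) i k * letter_mat a e k j)"

definition aut_out :: "('s, 'k::{semiring_1,star}) rexp \<Rightarrow> nat \<Rightarrow> 'k" where
  "aut_out e k = star_on {..<aut_dim e} (scalar_mat e) k 1"

lemma aut_dim_ge_2: "2 \<le> aut_dim e"
  unfolding aut_dim_def by (metis edges_states(1) prod.collapse)

context star_algebra
begin

lemma eval_rexp_star_on:
  "eval_rexp emb h e = star_on {..<aut_dim e} (graph_mat emb h (snd (edges 2 e 0 1))) 0 1"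
proof -
  define n L where "n = aut_dim e" and "L = snd (edges 2 e 0 1)"
  have E: "edges 2 e 0 1 = (n, L)" by (simp add: n_def L_def aut_dim_def)
  have n: "{..<n} = insert 0 (insert 1 {2..<n})"
    using aut_dim_ge_2[of e] by (auto simp: n_def)
  have R: "realizes h {2..<n} L 0 1 (eval_rexp emb h e)"
    by (rule realizes_edges[OF E]) auto
  have X: "paths {2..<n} (graph_mat emb h L) i j = (if i = 0 \<and> j = 1 then eval_rexp emb h e else 0)"
    if "i < 2" "j < 2" for i j
    using realizesD[OF R, of "\<lambda>_ _. 0" i j] that by simp
  have "paths {..<n} (graph_mat emb h L) 0 1 =
      bypass 0 (bypass 1 (paths {2..<n} (graph_mat emb h L))) 0 1"
    unfolding n by (simp add: paths_insert)
  also have "\<dots> = eval_rexp emb h e"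
    by (simp add: bypass_def X)
  finally show ?thesis
    by (simp add: star_on_def unit_mat_def n_def L_def)
qed

lemma graph_mat_split:
  assumes "finite \<Sigma>" "\<And>i a j. (i, Inr a, j) \<in> set L \<Longrightarrow> a \<in> \<Sigma>"
  shows "graph_mat emb h L i j = emb (graph_mat (\<lambda>k. k) (\<lambda>_. 0) L i j) +
    (\<Sum>a\<in>\<Sigma>. emb (graph_mat (\<lambda>_. 0) (\<lambda>b. if b = a then 1 else 0) L i j) * h a)"
  using assms(2)
proof (induction L)
  case (Cons x L)
  obtain p l q where x: "x = (p, l, q)" by (cases x)
  have "graph_mat emb h L i j = emb (graph_mat (\<lambda>k. k) (\<lambda>_. 0) L i j) +
    (\<Sum>a\<in>\<Sigma>. emb (graph_mat (\<lambda>_. 0) (\<lambda>b. if b = a then 1 else 0) L i j) * h a)"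
    by (rule Cons.IH) (use Cons.prems in auto)
  moreover have "label_val emb h l = emb (label_val (\<lambda>k. k) (\<lambda>_. 0) l) +
    (\<Sum>a\<in>\<Sigma>. emb (label_val (\<lambda>_. 0) (\<lambda>b. if b = a then 1 else 0) l) * h a)"
  proof (cases l)
    case (Inr b)
    then have "b \<in> \<Sigma>" using Cons.prems x by auto
    then have "(\<Sum>a\<in>\<Sigma>. emb (if b = a then 1 else 0) * h a) = h b"
      by (subst sum.cong[OF refl, of _ _ "\<lambda>a. if b = a then h a else 0"]) (auto simp: assms(1))
    with Inr show ?thesis by (simp add: label_val_def)
  qed (simp add: label_val_def)
  ultimately show ?case
    by (auto simp: x emb_add distrib_right sum.distrib add_ac)
qed simp

theorem eval_rexp_automaton:
  assumes \<Sigma>: "finite \<Sigma>" "letters e \<subseteq> \<Sigma>"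
  shows "eval_rexp emb h e = (\<Sum>k<aut_dim e.
    star_on {..<aut_dim e} (\<lambda>i j. \<Sum>a\<in>\<Sigma>. emb (aut_mat a e i j) * h a) 0 k * emb (aut_out e k))"
proof -
  define n where "n = aut_dim e"
  have n: "0 < n" "1 < n" using aut_dim_ge_2[of e] by (auto simp: n_def)
  define A B where "A i j = emb (scalar_mat e i j)"
    and "B i j = (\<Sum>a\<in>\<Sigma>. emb (letter_mat a e i j) * h a)" for i j
  have G: "graph_mat emb h (snd (edges 2 e 0 1)) = (\<lambda>i j. A i j + B i j)"
    unfolding A_def B_def scalar_mat_def letter_mat_def
    by (intro ext graph_mat_split) (use \<Sigma> edges_states(4)[of 2 e 0 1] in \<open>auto simp: prod_eq_iff\<close>)
  have starA: "star_on {..<n} A i j = emb (star_on {..<n} (scalar_mat e) i j)" for i j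
    unfolding A_def by (rule emb_star_on[symmetric]) simp
  have C: "(\<Sum>k<n. star_on {..<n} A i k * B k j) = (\<Sum>a\<in>\<Sigma>. emb (aut_mat a e i j) * h a)" for i j
    unfolding B_def sum_distrib_left
    by (subst sum.swap)
      (simp add: starA aut_mat_def[of _ e, folded n_def] emb_sum emb_mult sum_distrib_right mult.assoc)
  have "eval_rexp emb h e = star_on {..<n} (\<lambda>i j. A i j + B i j) 0 1"
    unfolding eval_rexp_star_on G n_def ..
  also have "\<dots> = (\<Sum>k<n. star_on {..<n} (\<lambda>i j. \<Sum>k<n. star_on {..<n} A i k * B k j) 0 k * star_on {..<n} A k 1)"
    by (rule star_on_add) (use n in auto)
  also have "\<dots> = (\<Sum>k<n. star_on {..<n} (\<lambda>i j. \<Sum>a\<in>\<Sigma>. emb (aut_mat a e i j) * h a) 0 k * emb (aut_out e k))"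
    unfolding C by (simp add: starA aut_out_def[of e, folded n_def])
  finally show ?thesis by (simp add: n_def)
qed

end

section \<open>Invariance of automaton values under simulations\<close>

text \<open>
  A star algebra that is an iteration semiring.
\<close>

locale iteration_algebra = star_algebra emb
  for emb :: "'k::{comm_semiring_1,star} \<Rightarrow> 'a::{semiring_1,star}" +
  assumes iteration_algebra: "iteration_type TYPE('a)"

sublocale iteration_algebra \<subseteq> iteration_type "TYPE('a)"
  by (rule iteration_algebra)

text \<open>
  The coefficients of the letter \<open>a\<close> in the transition matrix of an automaton.
\<close>

definition letter_coeff :: "('s, 'k::semiring_1) series mat \<Rightarrow> 's \<Rightarrow> nat \<Rightarrow> nat \<Rightarrow> 'k" where
  "letter_coeff M a i j = coeff (M $$ (i, j)) [a]"

text \<open>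
  The transition matrix evaluated in an algebra, the letters being interpreted by \<open>h\<close>.
\<close>

definition transition_mat ::
  "('k::semiring_1 \<Rightarrow> 'a::semiring_1) \<Rightarrow> ('s \<Rightarrow> 'a) \<Rightarrow> 's set \<Rightarrow> ('s, 'k) series mat \<Rightarrow> nat \<Rightarrow> nat \<Rightarrow> 'a" where
  "transition_mat emb h \<Sigma> M i j = (\<Sum>a\<in>\<Sigma>. emb (letter_coeff M a i j) * h a)"

text \<open>
  The value \<open>\<alpha> M\<^sup>* \<beta>\<close> of an automaton in an algebra; for the algebra of series it is the behavior
  (\<open>behavior_eq_aut_value\<close>).
\<close>

definition aut_value ::
  "('k::semiring_1 \<Rightarrow> 'a::{semiring_1,star}) \<Rightarrow> ('s \<Rightarrow> 'a) \<Rightarrow> 's set \<Rightarrow> ('s, 'k) automaton \<Rightarrow> 'a" where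
  "aut_value emb h \<Sigma> = (\<lambda>(\<alpha>, M, \<beta>).
    \<Sum>i<dim_row M. \<Sum>j<dim_row M. emb (\<alpha> $$ (0, i)) *
      star_on {..<dim_row M} (transition_mat emb h \<Sigma> M) i j * emb (\<beta> $$ (j, 0)))"

lemma transf_sum_map:
  assumes "transf_sum X Y M n" "\<phi> 0 = 0" "\<And>x y. \<phi> (x + y) = \<phi> x + \<phi> y"
  shows "transf_sum X Y (\<lambda>i j. \<phi> (M i j)) (\<phi> n)"
proof -
  obtain L where L: "\<And>a f. (a, f) \<in> set L \<Longrightarrow> f ` X \<subseteq> Y"
    "\<And>i j. i \<in> X \<Longrightarrow> j \<in> Y \<Longrightarrow> M i j = transf L i j" "n = weight L"
    using transf_sumE[OF assms(1)] by metis
  have "\<phi> (transf L i j) = transf (map (\<lambda>(a, f). (\<phi> a, f)) L) i j"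
    "\<phi> (weight L) = weight (map (\<lambda>(a, f). (\<phi> a, f)) L)" for i j
    by (induction L) (auto simp: assms(2,3))
  moreover have "f ` X \<subseteq> Y" if bf: "(b, f) \<in> set (map (\<lambda>(a, f). (\<phi> a, f)) L)" for b f
  proof -
    obtain a where "(a, f) \<in> set L" using bf by auto
    then show ?thesis by (rule L(1))
  qed
  ultimately show ?thesis
    using L(2,3) by (intro transf_sumI[of "map (\<lambda>(a, f). (\<phi> a, f)) L"]) metis+
qed

text \<open>
  The simulation equation \<open>M X = X N\<close> compared at a single letter.
\<close>

lemma simulation_letter_coeff:
  fixes M N :: "('s, 'k::comm_semiring_1) series mat"
  assumes M: "M \<in> carrier_mat m m" and N: "N \<in> carrier_mat n n" and X: "X \<in> carrier_mat m n"
    and eq: "M * map_mat const X = map_mat const X * N" and ij: "i < m" "j < n"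
  shows "(\<Sum>k<m. letter_coeff M a i k * X $$ (k, j)) = (\<Sum>k<n. X $$ (i, k) * letter_coeff N a k j)"
proof -
  have "(M * map_mat const X) $$ (i, j) = (\<Sum>k<m. M $$ (i, k) * const (X $$ (k, j)))"
    using M X ij by (simp add: scalar_prod_def atLeast0LessThan)
  moreover have "(map_mat const X * N) $$ (i, j) = (\<Sum>k<n. const (X $$ (i, k)) * N $$ (k, j))"
    using N X ij by (simp add: scalar_prod_def atLeast0LessThan)
  ultimately have "coeff (\<Sum>k<m. M $$ (i, k) * const (X $$ (k, j))) [a] =
      coeff (\<Sum>k<n. const (X $$ (i, k)) * N $$ (k, j)) [a]"
    using eq by simp
  then show ?thesis by (simp add: letter_coeff_def)
qed

lemma functional_mat_function:
  assumes "functional_mat X" "X \<in> carrier_mat m n"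
  shows "\<exists>\<pi>. (\<forall>i<m. \<pi> i < n) \<and> (\<forall>i<m. \<forall>j<n. X $$ (i, j) = (if \<pi> i = j then 1 else 0))"
proof -
  have dim: "dim_row X = m" "dim_col X = n" using assms(2) by auto
  have "\<forall>i<m. \<exists>j<n. X $$ (i, j) = 1 \<and> (\<forall>j'<n. j' \<noteq> j \<longrightarrow> X $$ (i, j') = 0)"
    using assms(1) unfolding functional_mat_def dim .
  then obtain \<pi> where \<pi>: "\<forall>i<m. \<pi> i < n \<and> X $$ (i, \<pi> i) = 1 \<and> (\<forall>j'<n. j' \<noteq> \<pi> i \<longrightarrow> X $$ (i, j') = 0)"
    by metis
  show ?thesis
    by (rule exI[of _ \<pi>]) (use \<pi> in auto)
qed

lemma sum_if_fibre:
  fixes f :: "nat \<Rightarrow> 'a::semiring_1"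
  shows "(\<Sum>k<n. f k * (if \<pi> k = c then 1 else 0)) = (\<Sum>k | k \<in> {..<n} \<and> \<pi> k = c. f k)"
    "(\<Sum>k<n. (if \<pi> k = c then 1 else 0) * f k) = (\<Sum>k | k \<in> {..<n} \<and> \<pi> k = c. f k)"
proof -
  have "(\<Sum>k | k \<in> {..<n} \<and> \<pi> k = c. f k) = (\<Sum>k<n. if \<pi> k = c then f k else 0)"
    by (subst sum.inter_filter[symmetric]) auto
  also have "\<dots> = (\<Sum>k<n. f k * (if \<pi> k = c then 1 else 0))"
    by (rule sum.cong) auto
  finally show "(\<Sum>k<n. f k * (if \<pi> k = c then 1 else 0)) = (\<Sum>k | k \<in> {..<n} \<and> \<pi> k = c. f k)" ..
  then show "(\<Sum>k<n. (if \<pi> k = c then 1 else 0) * f k) = (\<Sum>k | k \<in> {..<n} \<and> \<pi> k = c. f k)"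
    by (subst sum.cong[OF refl, of _ _ "\<lambda>k. f k * (if \<pi> k = c then 1 else 0)"]) auto
qed

lemma sum_if_point:
  fixes f :: "nat \<Rightarrow> 'a::semiring_1"
  assumes "c < n"
  shows "(\<Sum>k<n. f k * (if c = k then 1 else 0)) = f c" "(\<Sum>k<n. (if c = k then 1 else 0) * f k) = f c"
  using sum_unit_mat_left[of "{..<n}" c f] sum_unit_mat_right[of "{..<n}" c f] assms
  by (simp_all add: unit_mat_def eq_commute)

context iteration_algebra
begin

lemma transition_mat_transf_sum:
  assumes at: "atomistic TYPE('k)" and "finite X" "finite Y"
    and "\<And>a i. i \<in> X \<Longrightarrow> (\<Sum>j\<in>Y. m a i j) = n a"
  shows "transf_sum X Y (\<lambda>i j. \<Sum>a\<in>\<Sigma>. emb (m a i j) * h a) (\<Sum>a\<in>\<Sigma>. emb (n a) * h a)"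
proof (cases "finite \<Sigma>")
  case True
  show ?thesis
  proof (rule transf_sum_sum[OF True])
    fix a
    have "transf_sum X Y (m a) (n a)"
      by (rule transf_sum_atomistic) (use assms in auto)
    then show "transf_sum X Y (\<lambda>i j. emb (m a i j) * h a) (emb (n a) * h a)"
      by (rule transf_sum_map[where \<phi> = "\<lambda>k. emb k * h a"]) (auto simp: emb_add distrib_right)
  qed
qed (simp add: transf_sum_zero)

lemma aut_value_functional:
  fixes P Q :: "('s, 'k) automaton"
  assumes at: "atomistic TYPE('k)"
    and P: "P = (\<alpha>, M, \<beta>)" "is_automaton \<Sigma> m P" and Q: "Q = (\<gamma>, N, \<delta>)" "is_automaton \<Sigma> n Q"
    and sim: "simulation X P Q" and func: "functional_mat X"
  shows "aut_value emb h \<Sigma> P = aut_value emb h \<Sigma> Q"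
proof -
  have carr: "\<alpha> \<in> carrier_mat 1 m" "M \<in> carrier_mat m m" "\<beta> \<in> carrier_mat m 1"
    "\<gamma> \<in> carrier_mat 1 n" "N \<in> carrier_mat n n" "\<delta> \<in> carrier_mat n 1"
    using P Q by (auto simp: is_automaton_def)
  have "dim_row M = m" "dim_row N = n" using carr by auto
  then have X: "X \<in> carrier_mat m n" "\<alpha> * X = \<gamma>" "M * map_mat const X = map_mat const X * N" "\<beta> = X * \<delta>"
    using sim unfolding simulation_def P(1) Q(1) prod.case by blast+
  obtain \<pi> where \<pi>: "\<And>i. i < m \<Longrightarrow> \<pi> i < n"
    "\<And>i j. i < m \<Longrightarrow> j < n \<Longrightarrow> X $$ (i, j) = (if \<pi> i = j then 1 else 0)"
    using functional_mat_function[OF func X(1)] by blast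
  have \<gamma>: "\<gamma> $$ (0, j) = (\<Sum>i | i \<in> {..<m} \<and> \<pi> i = j. \<alpha> $$ (0, i))" if "j < n" for j
  proof -
    have "\<gamma> $$ (0, j) = (\<Sum>i<m. \<alpha> $$ (0, i) * (if \<pi> i = j then 1 else 0))"
      using carr X(1) that \<pi> by (simp add: X(2)[symmetric] scalar_prod_def atLeast0LessThan)
    then show ?thesis by (simp only: sum_if_fibre)
  qed
  have \<beta>: "\<beta> $$ (i, 0) = \<delta> $$ (\<pi> i, 0)" if "i < m" for i
  proof -
    have "\<beta> $$ (i, 0) = (\<Sum>k<n. (if \<pi> i = k then 1 else 0) * \<delta> $$ (k, 0))"
      using carr X(1) that \<pi> by (simp add: X(4) scalar_prod_def atLeast0LessThan)
    then show ?thesis using \<pi>(1)[OF that] by (simp only: sum_if_point)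
  qed
  have MN: "(\<Sum>k | k \<in> {..<m} \<and> \<pi> k = j. letter_coeff M a i k) = letter_coeff N a (\<pi> i) j"
    if ij: "i < m" "j < n" for a i j
  proof -
    have "(\<Sum>k<m. letter_coeff M a i k * (if \<pi> k = j then 1 else 0)) =
        (\<Sum>k<n. (if \<pi> i = k then 1 else 0) * letter_coeff N a k j)"
      using simulation_letter_coeff[OF carr(2,5) X(1,3) ij, of a] ij \<pi> by simp
    then show ?thesis
      using \<pi>(1)[OF ij(1)] by (simp only: sum_if_fibre sum_if_point)
  qed
  define S where "S = star_on {..<m} (transition_mat emb h \<Sigma> M)"
  define S' where "S' = star_on {..<n} (transition_mat emb h \<Sigma> N)"
  have S: "(\<Sum>j | j \<in> {..<m} \<and> \<pi> j = d. S i j) = S' (\<pi> i) d" if "i < m" "d < n" for i d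
    unfolding S_def S'_def
  proof (rule functional_star)
    fix c d assume "c \<in> {..<n}" "d \<in> {..<n}"
    then show "transf_sum {i \<in> {..<m}. \<pi> i = c} {i \<in> {..<m}. \<pi> i = d}
        (transition_mat emb h \<Sigma> M) (transition_mat emb h \<Sigma> N c d)"
      unfolding transition_mat_def[abs_def]
      by (intro transition_mat_transf_sum[OF at]) (use MN in auto)
  qed (use that \<pi> in auto)
  have \<pi>_img: "\<pi> ` {..<m} \<subseteq> {..<n}" using \<pi>(1) by auto
  have "(\<Sum>j<m. S i j * emb (\<beta> $$ (j, 0))) = (\<Sum>d<n. S' (\<pi> i) d * emb (\<delta> $$ (d, 0)))"
    if "i < m" for i
  proof -
    have "(\<Sum>j<m. S i j * emb (\<beta> $$ (j, 0))) =
        (\<Sum>d<n. \<Sum>j | j \<in> {..<m} \<and> \<pi> j = d. S i j * emb (\<beta> $$ (j, 0)))"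
      by (rule sum.group[symmetric]) (use \<pi>_img in auto)
    also have "\<dots> = (\<Sum>d<n. (\<Sum>j | j \<in> {..<m} \<and> \<pi> j = d. S i j) * emb (\<delta> $$ (d, 0)))"
      unfolding sum_distrib_right by (intro sum.cong refl) (auto simp: \<beta>)
    finally show ?thesis using S that by simp
  qed
  then have "aut_value emb h \<Sigma> P =
      (\<Sum>i<m. emb (\<alpha> $$ (0, i)) * (\<Sum>d<n. S' (\<pi> i) d * emb (\<delta> $$ (d, 0))))"
    using carr by (simp add: aut_value_def P mult.assoc S_def flip: sum_distrib_left)
  also have "\<dots> = (\<Sum>c<n. \<Sum>i | i \<in> {..<m} \<and> \<pi> i = c.
      emb (\<alpha> $$ (0, i)) * (\<Sum>d<n. S' (\<pi> i) d * emb (\<delta> $$ (d, 0))))"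
    by (rule sum.group[symmetric]) (use \<pi>_img in auto)
  also have "\<dots> = (\<Sum>c<n. emb (\<gamma> $$ (0, c)) * (\<Sum>d<n. S' c d * emb (\<delta> $$ (d, 0))))"
    by (intro sum.cong refl) (simp add: \<gamma> emb_sum sum_distrib_right)
  also have "\<dots> = aut_value emb h \<Sigma> Q"
    using carr by (simp add: aut_value_def Q mult.assoc S'_def flip: sum_distrib_left)
  finally show ?thesis .
qed

lemma aut_value_dual_functional:
  fixes P Q :: "('s, 'k) automaton"
  assumes at: "atomistic TYPE('k)"
    and P: "P = (\<alpha>, M, \<beta>)" "is_automaton \<Sigma> m P" and Q: "Q = (\<gamma>, N, \<delta>)" "is_automaton \<Sigma> n Q"
    and sim: "simulation X P Q" and func: "dual_functional_mat X"
  shows "aut_value emb h \<Sigma> P = aut_value emb h \<Sigma> Q"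
proof -
  have carr: "\<alpha> \<in> carrier_mat 1 m" "M \<in> carrier_mat m m" "\<beta> \<in> carrier_mat m 1"
    "\<gamma> \<in> carrier_mat 1 n" "N \<in> carrier_mat n n" "\<delta> \<in> carrier_mat n 1"
    using P Q by (auto simp: is_automaton_def)
  have "dim_row M = m" "dim_row N = n" using carr by auto
  then have X: "X \<in> carrier_mat m n" "\<alpha> * X = \<gamma>" "M * map_mat const X = map_mat const X * N" "\<beta> = X * \<delta>"
    using sim unfolding simulation_def P(1) Q(1) prod.case by blast+
  obtain \<pi> where \<pi>: "\<And>j. j < n \<Longrightarrow> \<pi> j < m"
    "\<And>i j. i < m \<Longrightarrow> j < n \<Longrightarrow> X $$ (i, j) = (if \<pi> j = i then 1 else 0)"
  proof -
    have "X\<^sup>T \<in> carrier_mat n m" using X(1) by simp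
    from functional_mat_function[OF func[unfolded dual_functional_mat_def] this]
    obtain \<pi> where \<pi>: "\<forall>j<n. \<pi> j < m" "\<forall>j<n. \<forall>i<m. X\<^sup>T $$ (j, i) = (if \<pi> j = i then 1 else 0)"
      by blast
    show ?thesis
      by (rule that[of \<pi>]) (use \<pi> X(1) in auto)
  qed
  have \<gamma>: "\<gamma> $$ (0, j) = \<alpha> $$ (0, \<pi> j)" if "j < n" for j
  proof -
    have "\<gamma> $$ (0, j) = (\<Sum>i<m. \<alpha> $$ (0, i) * (if \<pi> j = i then 1 else 0))"
      using carr X(1) that \<pi> by (simp add: X(2)[symmetric] scalar_prod_def atLeast0LessThan)
    then show ?thesis using \<pi>(1)[OF that] by (simp only: sum_if_point)
  qed
  have \<beta>: "\<beta> $$ (i, 0) = (\<Sum>k | k \<in> {..<n} \<and> \<pi> k = i. \<delta> $$ (k, 0))" if "i < m" for i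
  proof -
    have "\<beta> $$ (i, 0) = (\<Sum>k<n. (if \<pi> k = i then 1 else 0) * \<delta> $$ (k, 0))"
      using carr X(1) that \<pi> by (simp add: X(4) scalar_prod_def atLeast0LessThan)
    then show ?thesis by (simp only: sum_if_fibre)
  qed
  have MN: "(\<Sum>k | k \<in> {..<n} \<and> \<pi> k = i. letter_coeff N a k j) = letter_coeff M a i (\<pi> j)"
    if ij: "i < m" "j < n" for a i j
  proof -
    have "(\<Sum>k<m. letter_coeff M a i k * (if \<pi> j = k then 1 else 0)) =
        (\<Sum>k<n. (if \<pi> k = i then 1 else 0) * letter_coeff N a k j)"
      using simulation_letter_coeff[OF carr(2,5) X(1,3) ij, of a] ij \<pi> by simp
    then show ?thesis
      using \<pi>(1)[OF ij(2)] by (simp only: sum_if_fibre sum_if_point)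
  qed
  define S where "S = star_on {..<m} (transition_mat emb h \<Sigma> M)"
  define S' where "S' = star_on {..<n} (transition_mat emb h \<Sigma> N)"
  have S: "(\<Sum>j | j \<in> {..<n} \<and> \<pi> j = d. S' j i) = S d (\<pi> i)" if "i < n" "d < m" for i d
    unfolding S_def S'_def
  proof (rule dual_functional_star)
    fix c d assume cd: "c \<in> {..<m}" "d \<in> {..<m}"
    have "transf_sum {i \<in> {..<n}. \<pi> i = c} {i \<in> {..<n}. \<pi> i = d}
        (\<lambda>i j. transition_mat emb h \<Sigma> N j i) (transition_mat emb h \<Sigma> M d c)"
      unfolding transition_mat_def
      by (intro transition_mat_transf_sum[OF at]) (use MN cd in auto)
    then show "transf_sum {i \<in> {..<n}. \<pi> i = c} {i \<in> {..<n}. \<pi> i = d}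
        (\<lambda>i j. Opp (transition_mat emb h \<Sigma> N j i)) (Opp (transition_mat emb h \<Sigma> M d c))"
      by (rule transf_sum_map) (auto simp: zero_opposite_def plus_opposite_def)
  qed (use that \<pi> in auto)
  have \<pi>_img: "\<pi> ` {..<n} \<subseteq> {..<m}" using \<pi>(1) by auto
  have row: "(\<Sum>j<n. emb (\<gamma> $$ (0, j)) * S' j i) = (\<Sum>d<m. emb (\<alpha> $$ (0, d)) * S d (\<pi> i))"
    if "i < n" for i
  proof -
    have "(\<Sum>j<n. emb (\<gamma> $$ (0, j)) * S' j i) =
        (\<Sum>d<m. \<Sum>j | j \<in> {..<n} \<and> \<pi> j = d. emb (\<gamma> $$ (0, j)) * S' j i)"
      by (rule sum.group[symmetric]) (use \<pi>_img in auto)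
    also have "\<dots> = (\<Sum>d<m. emb (\<alpha> $$ (0, d)) * (\<Sum>j | j \<in> {..<n} \<and> \<pi> j = d. S' j i))"
      unfolding sum_distrib_left by (intro sum.cong refl) (auto simp: \<gamma>)
    finally show ?thesis using S that by simp
  qed
  have "aut_value emb h \<Sigma> Q = (\<Sum>i<n. (\<Sum>j<n. emb (\<gamma> $$ (0, j)) * S' j i) * emb (\<delta> $$ (i, 0)))"
    using carr unfolding aut_value_def Q S'_def prod.case
    by (subst sum.swap) (simp add: sum_distrib_right)
  also have "\<dots> = (\<Sum>i<n. (\<Sum>d<m. emb (\<alpha> $$ (0, d)) * S d (\<pi> i)) * emb (\<delta> $$ (i, 0)))"
    by (simp add: row)
  also have "\<dots> = (\<Sum>c<m. \<Sum>i | i \<in> {..<n} \<and> \<pi> i = c.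
      (\<Sum>d<m. emb (\<alpha> $$ (0, d)) * S d (\<pi> i)) * emb (\<delta> $$ (i, 0)))"
    by (rule sum.group[symmetric]) (use \<pi>_img in auto)
  also have "\<dots> = (\<Sum>c<m. (\<Sum>d<m. emb (\<alpha> $$ (0, d)) * S d c) * emb (\<beta> $$ (c, 0)))"
    by (intro sum.cong refl) (simp add: \<beta> emb_sum sum_distrib_left)
  also have "\<dots> = aut_value emb h \<Sigma> P"
    using carr unfolding aut_value_def P S_def prod.case
    by (subst sum.swap[of _ "{..<dim_row M}"]) (simp add: sum_distrib_right)
  finally show ?thesis ..
qed

lemma aut_value_diagonal:
  fixes P Q :: "('s, 'k) automaton"
  assumes P: "P = (\<alpha>, M, \<beta>)" "is_automaton \<Sigma> m P" and Q: "Q = (\<gamma>, N, \<delta>)" "is_automaton \<Sigma> n Q"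
    and sim: "simulation X P Q" and diag: "invertible_diagonal_mat X"
  shows "aut_value emb h \<Sigma> P = aut_value emb h \<Sigma> Q"
proof -
  have carr: "\<alpha> \<in> carrier_mat 1 m" "M \<in> carrier_mat m m" "\<beta> \<in> carrier_mat m 1"
    "\<gamma> \<in> carrier_mat 1 n" "N \<in> carrier_mat n n" "\<delta> \<in> carrier_mat n 1"
    using P Q by (auto simp: is_automaton_def)
  have "dim_row M = m" "dim_row N = n" using carr by auto
  then have X: "X \<in> carrier_mat m n" "\<alpha> * X = \<gamma>" "M * map_mat const X = map_mat const X * N" "\<beta> = X * \<delta>"
    using sim unfolding simulation_def P(1) Q(1) prod.case by blast+
  have mn: "n = m"
    using diag X(1) by (auto simp: invertible_diagonal_mat_def)
  define x where "x i = X $$ (i, i)" for i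
  have Xij: "X $$ (i, j) = x i * (if i = j then 1 else 0)" "X $$ (i, j) = (if j = i then 1 else 0) * x j"
    if "i < m" "j < m" for i j
    using diag X(1) that by (auto simp: invertible_diagonal_mat_def diagonal_mat_def x_def mn)
  obtain y where y: "\<And>i. i < m \<Longrightarrow> y i * x i = 1"
  proof -
    have "\<exists>z. z * x i = 1" if "i < m" for i
    proof -
      have "x i dvd 1" using diag X(1) that by (auto simp: invertible_diagonal_mat_def x_def)
      then obtain z where "1 = x i * z" by (rule dvdE)
      then show ?thesis by (auto simp: mult.commute)
    qed
    then show ?thesis using that by metis
  qed
  have \<gamma>: "\<gamma> $$ (0, j) = \<alpha> $$ (0, j) * x j" if "j < m" for j
  proof -
    have "\<gamma> $$ (0, j) = (\<Sum>i<m. \<alpha> $$ (0, i) * ((if j = i then 1 else 0) * x j))"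
      using carr X(1) that Xij by (simp add: X(2)[symmetric] scalar_prod_def atLeast0LessThan mn)
    also have "\<dots> = (\<Sum>i<m. \<alpha> $$ (0, i) * (if j = i then 1 else 0)) * x j"
      by (simp only: sum_distrib_right mult.assoc)
    finally show ?thesis using that by (simp only: sum_if_point)
  qed
  have \<beta>: "\<beta> $$ (i, 0) = x i * \<delta> $$ (i, 0)" if "i < m" for i
  proof -
    have "\<beta> $$ (i, 0) = (\<Sum>k<m. x i * (if i = k then 1 else 0) * \<delta> $$ (k, 0))"
      using carr X(1) that Xij(1) by (simp add: X(4) scalar_prod_def atLeast0LessThan mn)
    also have "\<dots> = x i * (\<Sum>k<m. (if i = k then 1 else 0) * \<delta> $$ (k, 0))"
      by (simp only: sum_distrib_left mult.assoc)
    finally show ?thesis using that by (simp only: sum_if_point)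
  qed
  have MN: "letter_coeff M a i j * x j = x i * letter_coeff N a i j"
    if ij: "i < m" "j < m" for a i j
  proof -
    have "(\<Sum>k<m. letter_coeff M a i k * ((if j = k then 1 else 0) * x j)) =
        (\<Sum>k<m. x i * (if i = k then 1 else 0) * letter_coeff N a k j)"
      using simulation_letter_coeff[OF carr(2,5) X(1,3) ij(1), of j a] ij Xij(2)[of _ j] Xij(1)[of i]
      by (simp add: mn)
    also have "(\<Sum>k<m. letter_coeff M a i k * ((if j = k then 1 else 0) * x j)) =
        (\<Sum>k<m. letter_coeff M a i k * (if j = k then 1 else 0)) * x j"
      by (simp only: sum_distrib_right mult.assoc)
    also have "(\<Sum>k<m. x i * (if i = k then 1 else 0) * letter_coeff N a k j) =
        x i * (\<Sum>k<m. (if i = k then 1 else 0) * letter_coeff N a k j)"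
      by (simp only: sum_distrib_left mult.assoc)
    finally show ?thesis using ij by (simp only: sum_if_point)
  qed
  define TM TN where "TM = transition_mat emb h \<Sigma> M" and "TN = transition_mat emb h \<Sigma> N"
  have T: "TM i j * emb (x j) = emb (x i) * TN i j" if "i < m" "j < m" for i j
  proof -
    have "emb (letter_coeff M a i j) * h a * emb (x j) = emb (x i) * (emb (letter_coeff N a i j) * h a)" for a
    proof -
      have "emb (letter_coeff M a i j) * h a * emb (x j) = emb (letter_coeff M a i j) * emb (x j) * h a"
        by (simp add: mult.assoc emb_commute[of "x j" "h a"])
      also have "\<dots> = emb (x i) * emb (letter_coeff N a i j) * h a"
        unfolding emb_mult[symmetric] MN[OF that] ..
      finally show ?thesis by (simp add: mult.assoc)
    qed
    then show ?thesis
      by (simp add: TM_def TN_def transition_mat_def sum_distrib_left sum_distrib_right)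
  qed
  have paths: "paths {..<m} TM i j * emb (x j) = emb (x i) * paths {..<m} TN i j" if "i < m" "j < m" for i j
    by (rule diagonal_paths[where S = "{..<m}" and y = "\<lambda>i. emb (y i)"])
      (use that y T in \<open>auto simp flip: emb_mult intro: emb_commute\<close>)
  have S: "star_on {..<m} TM i j * emb (x j) = emb (x i) * star_on {..<m} TN i j" if "i < m" "j < m" for i j
    using paths[OF that] by (simp add: star_on_def distrib_left distrib_right unit_mat_def)
  have "emb (\<alpha> $$ (0, i)) * star_on {..<m} TM i j * emb (\<beta> $$ (j, 0)) =
      emb (\<gamma> $$ (0, i)) * star_on {..<m} TN i j * emb (\<delta> $$ (j, 0))" if "i < m" "j < m" for i j
  proof -
    have "emb (\<alpha> $$ (0, i)) * star_on {..<m} TM i j * emb (\<beta> $$ (j, 0)) =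
        emb (\<alpha> $$ (0, i)) * (star_on {..<m} TM i j * emb (x j)) * emb (\<delta> $$ (j, 0))"
      using that by (simp add: \<beta> emb_mult mult.assoc)
    then show ?thesis
      using that by (simp add: S \<gamma> emb_mult mult.assoc)
  qed
  then show ?thesis
    using carr by (simp add: aut_value_def P Q mn TM_def TN_def)
qed

theorem aut_value_simulation_step:
  assumes "atomistic TYPE('k)" "simulation_step \<Sigma> P (Q :: ('s, 'k) automaton)"
  shows "aut_value emb h \<Sigma> P = aut_value emb h \<Sigma> Q"
proof -
  obtain \<alpha> M \<beta> \<gamma> N \<delta> where PQ: "P = (\<alpha>, M, \<beta>)" "Q = (\<gamma>, N, \<delta>)"
    by (metis surj_pair)
  obtain m n X where "is_automaton \<Sigma> m P" "is_automaton \<Sigma> n Q" "simulation X P Q"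
    "functional_mat X \<or> dual_functional_mat X \<or> invertible_diagonal_mat X"
    using assms(2) unfolding simulation_step_def by blast
  then show ?thesis
    using aut_value_functional[OF assms(1) PQ(1) _ PQ(2)]
      aut_value_dual_functional[OF assms(1) PQ(1) _ PQ(2)] aut_value_diagonal[OF PQ(1) _ PQ(2)]
    by metis
qed

corollary aut_value_equivclp:
  assumes "atomistic TYPE('k)" "equivclp (simulation_step \<Sigma>) P (Q :: ('s, 'k) automaton)"
  shows "aut_value emb h \<Sigma> P = aut_value emb h \<Sigma> Q"
  using assms(2) unfolding equivclp_def
proof (induction rule: rtranclp_induct)
  case (step Q R)
  then have "aut_value emb h \<Sigma> Q = aut_value emb h \<Sigma> R"
    using aut_value_simulation_step[OF assms(1)] unfolding symclp_def by metis
  with step.IH show ?case by simp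
qed simp

end

section \<open>Behaviors\<close>

lemma star_algebra_series:
  assumes "conway_type TYPE('k::{comm_semiring_1,star})"
  shows "star_algebra (const :: 'k \<Rightarrow> ('s, 'k) series)"
  by (intro star_algebra.intro assms conway_type_series const_simps star_const[symmetric] const_commute)

lemma behavior_eq_aut_value:
  fixes P :: "('s, 'k::{comm_semiring_1,star}) automaton"
  assumes K: "conway_type TYPE('k)" and \<Sigma>: "finite \<Sigma>" and P: "is_automaton \<Sigma> n P"
  shows "behavior P = aut_value const letter \<Sigma> P"
proof -
  interpret S: conway_type "TYPE(('s, 'k) series)" by (rule conway_type_series[OF K])
  obtain \<alpha> M \<beta> where P_eq: "P = (\<alpha>, M, \<beta>)" by (metis surj_pair)
  have carr: "\<alpha> \<in> carrier_mat 1 n" "M \<in> carrier_mat n n" "\<beta> \<in> carrier_mat n 1"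
    and lin: "\<And>i j. i < n \<Longrightarrow> j < n \<Longrightarrow> M $$ (i, j) \<in> linear_combs \<Sigma>"
    using P by (auto simp: is_automaton_def P_eq)
  have dim: "dim_row M = n" using carr by auto
  have entry: "M $$ (i, j) = transition_mat const letter \<Sigma> M i j" if ij: "i < n" "j < n" for i j
  proof -
    obtain c where c: "M $$ (i, j) = (\<Sum>a\<in>\<Sigma>. series_scale (c a) (letter a))"
      using lin[OF ij] by (auto simp: linear_combs_def)
    have "letter_coeff M b i j = c b" if "b \<in> \<Sigma>" for b
    proof -
      have "letter_coeff M b i j = (\<Sum>a\<in>\<Sigma>. if a = b then c a else 0)"
        unfolding letter_coeff_def c coeff_sum by (rule sum.cong) auto
      then show ?thesis using that \<Sigma> by simp
    qed
    then show ?thesis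
      unfolding transition_mat_def by (subst c) (simp add: series_scale_eq)
  qed
  have MS: "mat_star M \<in> carrier_mat n n" by (rule S.mat_star_carrier[OF carr(2)])
  have star: "mat_star M $$ (i, j) = star_on {..<n} (transition_mat const letter \<Sigma> M) i j"
    if "i < n" "j < n" for i j
    unfolding S.mat_star_index[OF carr(2) that]
    by (rule S.star_on_cong) (use that entry in auto)
  have "behavior P = (\<Sum>i<n. const (\<alpha> $$ (0, i)) * (\<Sum>j<n. mat_star M $$ (i, j) * const (\<beta> $$ (j, 0))))"
    using carr MS by (simp add: behavior_def P_eq scalar_prod_def atLeast0LessThan)
  also have "\<dots> = aut_value const letter \<Sigma> P"
    unfolding aut_value_def P_eq prod.case dim by (simp add: star sum_distrib_left mult.assoc)
  finally show ?thesis .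
qed

text \<open>
  The automaton of an expression in the matrix format, with letters from \<open>\<Sigma>\<close>; its initial vector is
  the unit vector of the state \<open>0\<close>.
\<close>

definition rexp_automaton :: "'s set \<Rightarrow> ('s, 'k::{comm_semiring_1,star}) rexp \<Rightarrow> ('s, 'k) automaton" where
  "rexp_automaton \<Sigma> e =
    (mat 1 (aut_dim e) (\<lambda>(_, j). if 0 = j then 1 else 0),
     mat (aut_dim e) (aut_dim e) (\<lambda>(i, j). \<Sum>a\<in>\<Sigma>. series_scale (aut_mat a e i j) (letter a)),
     mat (aut_dim e) 1 (\<lambda>(i, _). aut_out e i))"

lemma is_automaton_rexp: "is_automaton \<Sigma> (aut_dim e) (rexp_automaton \<Sigma> e)"
  using aut_dim_ge_2[of e] by (auto simp: is_automaton_def rexp_automaton_def linear_combs_def)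

lemma (in star_algebra) aut_value_rexp:
  fixes e :: "('s, 'k) rexp"
  assumes "finite \<Sigma>" "letters e \<subseteq> \<Sigma>"
  shows "aut_value emb h \<Sigma> (rexp_automaton \<Sigma> e) = eval_rexp emb h e"
proof -
  define n where "n = aut_dim e"
  define M where
    "M = mat n n (\<lambda>(i, j). \<Sum>a\<in>\<Sigma>. series_scale (aut_mat a e i j) (letter a :: ('s, 'k) series))"
  define T where "T i j = (\<Sum>a\<in>\<Sigma>. emb (aut_mat a e i j) * h a)" for i j
  have n: "0 < n" using aut_dim_ge_2[of e] by (simp add: n_def)
  have "letter_coeff M b i j = aut_mat b e i j" if "i < n" "j < n" "b \<in> \<Sigma>" for b i j
  proof -
    have "letter_coeff M b i j = (\<Sum>a\<in>\<Sigma>. if a = b then aut_mat a e i j else 0)"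
      using that unfolding letter_coeff_def M_def by (auto intro!: sum.cong)
    then show ?thesis using that assms(1) by simp
  qed
  then have T: "transition_mat emb h \<Sigma> M i j = T i j" if "i < n" "j < n" for i j
    using that by (simp add: transition_mat_def T_def)
  have dim: "dim_row M = n" by (simp add: M_def)
  have "aut_value emb h \<Sigma> (rexp_automaton \<Sigma> e) =
      (\<Sum>i<n. \<Sum>j<n. (if 0 = i then 1 else 0) * (star_on {..<n} (transition_mat emb h \<Sigma> M) i j * emb (aut_out e j)))"
    unfolding aut_value_def rexp_automaton_def prod.case n_def[symmetric] M_def[symmetric] dim
    by (intro sum.cong refl) auto
  also have "\<dots> = (\<Sum>j<n. star_on {..<n} (transition_mat emb h \<Sigma> M) 0 j * emb (aut_out e j))"
    unfolding sum_distrib_left[symmetric] by (rule sum_if_point(2)[OF n])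
  also have "\<dots> = (\<Sum>j<n. star_on {..<n} T 0 j * emb (aut_out e j))"
    by (intro sum.cong refl arg_cong2[where f = "(*)"] star_on_cong) (use n T in auto)
  also have "\<dots> = eval_rexp emb h e"
    unfolding T_def[abs_def] n_def by (rule eval_rexp_automaton[OF assms, symmetric])
  finally show ?thesis .
qed

subsection \<open>Renaming of letters\<close>

lemma eval_map_rexp:
  "letters e \<subseteq> \<Sigma> \<Longrightarrow> (\<And>a. a \<in> \<Sigma> \<Longrightarrow> h' (g a) = h a) \<Longrightarrow>
    eval_rexp emb h' (map_rexp g id e) = eval_rexp emb h e"
  by (induction e) auto

text \<open>
  The renaming of letters by a function \<open>g\<close> injective on \<open>\<Sigma>\<close>: the coefficient of a word over \<open>g ` \<Sigma>\<close> is that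
  of its preimage, and all other coefficients are \<open>0\<close>.
\<close>

definition relabel :: "('s \<Rightarrow> 't) \<Rightarrow> 's set \<Rightarrow> ('s, 'k::zero) series \<Rightarrow> ('t, 'k) series" where
  "relabel g \<Sigma> s = Series (\<lambda>w. if set w \<subseteq> g ` \<Sigma> then coeff s (map (inv_into \<Sigma> g) w) else 0)"

lemma coeff_relabel:
  "coeff (relabel g \<Sigma> s) w = (if set w \<subseteq> g ` \<Sigma> then coeff s (map (inv_into \<Sigma> g) w) else 0)"
  by (simp add: relabel_def Series_inverse)

lemma relabel_add: "relabel g \<Sigma> (s + t) = relabel g \<Sigma> s + relabel g \<Sigma> t"
  by (rule series_eqI) (simp add: coeff_relabel)

lemma relabel_const: "relabel g \<Sigma> (const k) = const k"
  by (rule series_eqI) (simp add: coeff_relabel)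

lemma relabel_letter:
  assumes "inj_on g \<Sigma>" "a \<in> \<Sigma>"
  shows "relabel g \<Sigma> (letter a) = letter (g a)"
proof (rule series_eqI)
  fix w
  have "set w \<subseteq> g ` \<Sigma> \<and> map (inv_into \<Sigma> g) w = [a] \<longleftrightarrow> w = [g a]"
    using assms by (auto simp: map_eq_Cons_conv)
  then show "coeff (relabel g \<Sigma> (letter a)) w = coeff (letter (g a)) w"
    by (auto simp: coeff_relabel)
qed

lemma relabel_mult: "relabel g \<Sigma> (s * t) = relabel g \<Sigma> s * relabel g \<Sigma> t"
proof (rule series_eqI)
  fix w
  have sub: "set w \<subseteq> g ` \<Sigma> \<longleftrightarrow> set (take i w) \<subseteq> g ` \<Sigma> \<and> set (drop i w) \<subseteq> g ` \<Sigma>" for i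
    by (metis Un_subset_iff append_take_drop_id set_append)
  show "coeff (relabel g \<Sigma> (s * t)) w = coeff (relabel g \<Sigma> s * relabel g \<Sigma> t) w"
  proof (cases "set w \<subseteq> g ` \<Sigma>")
    case True
    then show ?thesis
      using sub by (simp add: coeff_relabel coeff_mult take_map drop_map)
  next
    case False
    have "coeff (relabel g \<Sigma> s) (take i w) * coeff (relabel g \<Sigma> t) (drop i w) = 0" for i
      using sub[of i] False by (auto simp: coeff_relabel)
    with False show ?thesis
      by (simp add: coeff_mult) (simp add: coeff_relabel)
  qed
qed

lemma relabel_star:
  fixes s :: "('s, 'k::{comm_semiring_1,star}) series"
  shows "relabel g \<Sigma> (star s) = star (relabel g \<Sigma> s)"
proof -
  define k p where "k = coeff s []" and "p = proper_part s"
  have s: "s = const k + p" "proper p"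
    using proper_decomp[of s] by (simp_all add: k_def p_def)
  have "relabel g \<Sigma> s = const k + relabel g \<Sigma> p"
    by (subst s(1)) (simp add: relabel_add relabel_const)
  moreover have "proper (relabel g \<Sigma> p)"
    using s(2) by (simp add: proper_def coeff_relabel)
  moreover have "relabel g \<Sigma> (star s) = const (star k) * (relabel g \<Sigma> p * relabel g \<Sigma> (star s) + 1)"
    by (subst star_series_unfold[OF s])
      (simp add: relabel_mult relabel_add relabel_const flip: const_simps(2))
  ultimately show ?thesis by (rule star_series_unique)
qed

lemma relabel_eval:
  fixes e :: "('s, 'k::{comm_semiring_1,star}) rexp"
  assumes "inj_on g \<Sigma>" "letters e \<subseteq> \<Sigma>"
  shows "relabel g \<Sigma> (eval_rexp const letter e) = eval_rexp const letter (map_rexp g id e)"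
  using assms(2)
  by (induction e)
    (auto simp: relabel_const relabel_letter[OF assms(1)] relabel_add relabel_mult relabel_star)

section \<open>Freeness of the rational series\<close>

text \<open>
  An identity between expressions that holds for series holds in every iteration algebra.  Strong
  properness refers to letters that are natural numbers, hence the renaming.
\<close>

lemma rexp_identity_transfer:
  fixes emb :: "'k::{comm_semiring_1,star} \<Rightarrow> 'a::{semiring_1,star}" and e e' :: "('s, 'k) rexp"
  assumes "iteration_algebra emb" "strongly_proper TYPE('k)" "atomistic TYPE('k)"
    and \<Sigma>: "finite \<Sigma>" "letters e \<subseteq> \<Sigma>" "letters e' \<subseteq> \<Sigma>"
    and eq: "eval_rexp const letter e = (eval_rexp const letter e' :: ('s, 'k) series)"
  shows "eval_rexp emb h e = eval_rexp emb h e'"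
proof -
  interpret A: iteration_algebra emb by (rule assms(1))
  interpret S: star_algebra "const :: 'k \<Rightarrow> (nat, 'k) series"
    by (rule star_algebra_series[OF A.conway_scalars])
  obtain g :: "'s \<Rightarrow> nat" where g: "inj_on g \<Sigma>"
    using finite_imp_inj_to_nat_seg[OF \<Sigma>(1)] by blast
  define \<Sigma>' where "\<Sigma>' = g ` \<Sigma>"
  have fin: "finite \<Sigma>'" using \<Sigma>(1) by (simp add: \<Sigma>'_def)
  define h' where "h' b = h (inv_into \<Sigma> g b)" for b
  define P where "P f = rexp_automaton \<Sigma>' (map_rexp g id f)" for f :: "('s, 'k) rexp"
  have sub: "letters (map_rexp g id f) \<subseteq> \<Sigma>'" if "letters f \<subseteq> \<Sigma>" for f :: "('s, 'k) rexp"
    using that by (auto simp: \<Sigma>'_def rexp.set_map)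
  have aut: "is_automaton \<Sigma>' (aut_dim (map_rexp g id f)) (P f)" for f
    unfolding P_def by (rule is_automaton_rexp)
  have "behavior (P f) = relabel g \<Sigma> (eval_rexp const letter f)" if "letters f \<subseteq> \<Sigma>" for f
  proof -
    have "behavior (P f) = aut_value const letter \<Sigma>' (P f)"
      by (rule behavior_eq_aut_value[OF A.conway_scalars fin aut])
    also have "\<dots> = eval_rexp const letter (map_rexp g id f)"
      unfolding P_def by (rule S.aut_value_rexp[OF fin sub[OF that]])
    also have "\<dots> = relabel g \<Sigma> (eval_rexp const letter f)"
      by (rule relabel_eval[OF g that, symmetric])
    finally show ?thesis .
  qed
  then have "behavior (P e) = behavior (P e')"
    using \<Sigma> eq by simp
  then have "equivclp (simulation_step \<Sigma>') (P e) (P e')"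
    using assms(2) fin aut unfolding strongly_proper_def by blast
  then have "aut_value emb h' \<Sigma>' (P e) = aut_value emb h' \<Sigma>' (P e')"
    by (rule A.aut_value_equivclp[OF assms(3)])
  moreover have "aut_value emb h' \<Sigma>' (P f) = eval_rexp emb h f" if "letters f \<subseteq> \<Sigma>" for f
  proof -
    have "aut_value emb h' \<Sigma>' (P f) = eval_rexp emb h' (map_rexp g id f)"
      unfolding P_def by (rule A.aut_value_rexp[OF fin sub[OF that]])
    also have "\<dots> = eval_rexp emb h f"
      by (rule eval_map_rexp[OF that]) (simp add: h'_def g)
    finally show ?thesis .
  qed
  ultimately show ?thesis using \<Sigma> by simp
qed

lemma eval_rexp_in_rat:
  "letters e \<subseteq> \<Sigma> \<Longrightarrow> eval_rexp const letter e \<in> rat \<Sigma>"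
  by (induction e)
    (auto intro: const_in_rat rat_add rat_mult rat_star rat_proper_subset_rat rat_proper.letter)

lemma rat_proper_rexp:
  assumes "conway_type TYPE('k::{comm_semiring_1,star})" "(s :: ('s, 'k) series) \<in> rat_proper \<Sigma>"
  shows "\<exists>e. letters e \<subseteq> \<Sigma> \<and> eval_rexp const letter e = s"
  using assms(2)
proof induction
  case zero
  show ?case by (rule exI[of _ "Scalar 0"]) (simp add: const_simps)
next
  case (letter a)
  then show ?case by (intro exI[of _ "Letter a"]) simp
next
  case (add s t)
  then obtain e f where "letters e \<subseteq> \<Sigma> \<and> eval_rexp const letter e = s"
    "letters f \<subseteq> \<Sigma> \<and> eval_rexp const letter f = t" by blast
  then show ?case by (intro exI[of _ "Add e f"]) simp
next
  case (mult s t)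
  then obtain e f where "letters e \<subseteq> \<Sigma> \<and> eval_rexp const letter e = s"
    "letters f \<subseteq> \<Sigma> \<and> eval_rexp const letter f = t" by blast
  then show ?case by (intro exI[of _ "Mult e f"]) simp
next
  case (scale s k)
  then obtain e where "letters e \<subseteq> \<Sigma> \<and> eval_rexp const letter e = s" by blast
  then show ?case by (intro exI[of _ "Mult (Scalar k) e"]) (simp add: series_scale_eq)
next
  case (plus s)
  then obtain e where "letters e \<subseteq> \<Sigma> \<and> eval_rexp const letter e = s" by blast
  with \<open>proper s\<close> show ?case
    by (intro exI[of _ "Mult e (Star e)"]) (simp add: proper_plus_def star_proper[OF assms(1)])
qed

lemma rat_rexp:
  assumes "conway_type TYPE('k::{comm_semiring_1,star})" "(s :: ('s, 'k) series) \<in> rat \<Sigma>"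
  obtains e where "letters e \<subseteq> \<Sigma>" "eval_rexp const letter e = s"
proof -
  obtain k b where s: "s = const k + b" "b \<in> rat_proper \<Sigma>"
    using assms(2) by (auto simp: rat_def)
  obtain e where "letters e \<subseteq> \<Sigma>" "eval_rexp const letter e = b"
    using rat_proper_rexp[OF assms(1) s(2)] by blast
  then show ?thesis
    by (intro that[of "Add (Scalar k) e"]) (simp_all add: s)
qed

lemma iteration_semialgebra_algebra:
  fixes scale :: "'k::{comm_semiring_1,star} \<Rightarrow> 'a::{semiring_1,star} \<Rightarrow> 'a"
  assumes K: "iteration_type TYPE('k)" and A: "iteration_semialgebra (UNIV :: 'a set) scale"
  shows "iteration_algebra (\<lambda>k. scale k 1)" and "scale k a = scale k 1 * a"
proof -
  interpret A: iteration_semialgebra "UNIV :: 'a set" scale by (rule A)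
  interpret K: iteration_type "TYPE('k)" by (rule K)
  have left: "scale k a = scale k 1 * a" for k a
    using A.scale_mult_left[of 1 a k] by simp
  have right: "scale k a = a * scale k 1" for k a
    using A.scale_mult_right[of a 1 k] by simp
  have it: "iteration_type TYPE('a)"
    by unfold_locales
  show "scale k a = scale k 1 * a" by (rule left)
  show "iteration_algebra (\<lambda>k. scale k 1)"
  proof (intro iteration_algebra.intro star_algebra.intro iteration_algebra_axioms.intro)
    show "conway_type TYPE('k)" by unfold_locales
    show "conway_type TYPE('a)" using it by (simp add: conway_type_def iteration_type_def iteration_semiring_def)
    show "scale (k * l) 1 = scale k 1 * scale l 1" for k l
      using A.scale_scale[of 1 k l] left[of k "scale l 1"] by simp
    show "scale k 1 * a = a * scale k 1" for k a
      using left[of k a] right[of k a] by simp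
  qed (simp_all add: A.scale_zero_left A.scale_one A.scale_add_left A.star_scale_one it)
qed

lemma hom_eval_rexp:
  fixes scale :: "'k::{comm_semiring_1,star} \<Rightarrow> 'a::{semiring_1,star} \<Rightarrow> 'a"
  assumes "iteration_semialgebra_hom (rat \<Sigma>) series_scale (UNIV :: 'a set) scale f"
    and "\<And>a. a \<in> \<Sigma> \<Longrightarrow> f (letter a) = h a" and "letters e \<subseteq> \<Sigma>"
  shows "f (eval_rexp const letter e) = eval_rexp (\<lambda>k. scale k 1) h e"
  using assms(3)
proof (induction e)
  interpret iteration_semialgebra_hom "rat \<Sigma>" series_scale "UNIV :: 'a set" scale f by (rule assms(1))
  {
    case (Scalar k)
    show ?case
      using hom_scale[of 1 k] hom_one dom.one_closed by (simp add: series_scale_eq)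
  next
    case (Letter a)
    then show ?case using assms(2) by simp
  next
    case (Add e e')
    then show ?case using hom_add[OF eval_rexp_in_rat[of e \<Sigma>] eval_rexp_in_rat[of e' \<Sigma>]] by simp
  next
    case (Mult e e')
    then show ?case using hom_mult[OF eval_rexp_in_rat[of e \<Sigma>] eval_rexp_in_rat[of e' \<Sigma>]] by simp
  next
    case (Star e)
    then show ?case using hom_star[OF eval_rexp_in_rat[of e \<Sigma>]] by simp
  }
qed

theorem theorem9p5:
  fixes \<Sigma> :: "'s set"
    and scale :: "'k::{comm_semiring_1,star} \<Rightarrow> 'a::{semiring_1,star} \<Rightarrow> 'a"
    and h :: "'s \<Rightarrow> 'a"
  assumes "iteration_semiring (UNIV :: 'k set)"
    and "strongly_proper TYPE('k)"
    and "atomistic TYPE('k)"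
    and "finite \<Sigma>"
  shows "iteration_semialgebra (rat \<Sigma> :: ('s, 'k) series set) series_scale \<and>
    (iteration_semialgebra (UNIV :: 'a set) scale \<longrightarrow>
      (\<exists>!f :: ('s, 'k) series \<Rightarrow> 'a.
         f \<in> extensional (rat \<Sigma>) \<and>
         iteration_semialgebra_hom (rat \<Sigma>) series_scale (UNIV :: 'a set) scale f \<and>
         (\<forall>a\<in>\<Sigma>. f (letter a) = h a)))"
proof (intro conjI impI)
  have K: "iteration_type TYPE('k)"
    using assms(1) by (rule iteration_type.intro)
  interpret K: iteration_type "TYPE('k)" by (rule K)
  have cK: "conway_type TYPE('k)" by unfold_locales
  show rat: "iteration_semialgebra (rat \<Sigma> :: ('s, 'k) series set) series_scale"
    by (rule rat_iteration_semialgebra[OF K])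
  assume A: "iteration_semialgebra (UNIV :: 'a set) scale"
  define emb where "emb k = scale k (1 :: 'a)" for k
  have alg: "iteration_algebra emb"
    unfolding emb_def by (rule iteration_semialgebra_algebra(1)[OF K A])
  have scale_emb: "scale k a = emb k * a" for k a
    unfolding emb_def by (rule iteration_semialgebra_algebra(2)[OF K A])
  define F :: "('s, 'k) series \<Rightarrow> 'a" where
    "F = (\<lambda>s\<in>rat \<Sigma>. eval_rexp emb h (SOME e. letters e \<subseteq> \<Sigma> \<and> eval_rexp const letter e = s))"
  have F: "F (eval_rexp const letter e) = eval_rexp emb h e" if e: "letters e \<subseteq> \<Sigma>" for e
  proof -
    define e' where "e' = (SOME e'. letters e' \<subseteq> \<Sigma> \<and>
      eval_rexp const letter e' = (eval_rexp const letter e :: ('s, 'k) series))"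
    have "letters e' \<subseteq> \<Sigma> \<and> eval_rexp const letter e' = (eval_rexp const letter e :: ('s, 'k) series)"
      unfolding e'_def by (rule someI[of _ e]) (use e in simp)
    then have "eval_rexp emb h e' = eval_rexp emb h e"
      using e by (intro rexp_identity_transfer[OF alg assms(2,3,4)]) auto
    then show ?thesis
      using eval_rexp_in_rat[OF e] by (simp add: F_def e'_def)
  qed
  have hom: "iteration_semialgebra_hom (rat \<Sigma>) series_scale (UNIV :: 'a set) scale F"
  proof (intro iteration_semialgebra_hom.intro iteration_semialgebra_hom_axioms.intro rat A)
    interpret star_algebra emb using alg by (simp add: iteration_algebra_def)
    show "F 0 = 0" using F[of "Scalar 0"] by (simp add: const_simps)
    show "F 1 = 1" using F[of "Scalar 1"] by (simp add: const_simps)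
    fix s :: "('s, 'k) series" assume "s \<in> rat \<Sigma>"
    then obtain e where e: "letters e \<subseteq> \<Sigma>" "eval_rexp const letter e = s"
      using rat_rexp[OF cK] by blast
    show "F (series_scale k s) = scale k (F s)" for k
      using F[of "Mult (Scalar k) e"] F[of e] e by (simp add: series_scale_eq scale_emb)
    show "F (star s) = star (F s)"
      using F[of "Star e"] F[of e] e by simp
    fix t :: "('s, 'k) series" assume "t \<in> rat \<Sigma>"
    then obtain e' where e': "letters e' \<subseteq> \<Sigma>" "eval_rexp const letter e' = t"
      using rat_rexp[OF cK] by blast
    show "F (s + t) = F s + F t"
      using F[of "Add e e'"] F[of e] F[of e'] e e' by simp
    show "F (s * t) = F s * F t"
      using F[of "Mult e e'"] F[of e] F[of e'] e e' by simp
  qed simp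
  show "\<exists>!f :: ('s, 'k) series \<Rightarrow> 'a. f \<in> extensional (rat \<Sigma>) \<and>
      iteration_semialgebra_hom (rat \<Sigma>) series_scale (UNIV :: 'a set) scale f \<and>
      (\<forall>a\<in>\<Sigma>. f (letter a) = h a)"
  proof (rule ex1I[of _ F])
    show "F \<in> extensional (rat \<Sigma>) \<and>
      iteration_semialgebra_hom (rat \<Sigma>) series_scale (UNIV :: 'a set) scale F \<and>
      (\<forall>a\<in>\<Sigma>. F (letter a) = h a)"
      using hom F[of "Letter a" for a] by (auto simp: F_def)
  next
    fix f :: "('s, 'k) series \<Rightarrow> 'a"
    assume f: "f \<in> extensional (rat \<Sigma>) \<and>
      iteration_semialgebra_hom (rat \<Sigma>) series_scale (UNIV :: 'a set) scale f \<and>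
      (\<forall>a\<in>\<Sigma>. f (letter a) = h a)"
    show "f = F"
    proof (rule extensionalityI[of _ "rat \<Sigma>"])
      show "f \<in> extensional (rat \<Sigma>)" "F \<in> extensional (rat \<Sigma>)"
        using f by (simp_all add: F_def)
      fix s :: "('s, 'k) series" assume "s \<in> rat \<Sigma>"
      then obtain e where e: "letters e \<subseteq> \<Sigma>" "eval_rexp const letter e = s"
        using rat_rexp[OF cK] by blast
      have "f (eval_rexp const letter e) = eval_rexp (\<lambda>k. scale k 1) h e"
        by (rule hom_eval_rexp) (use f e in auto)
      then show "f s = F s"
        using F[OF e(1)] e(2) by (simp add: emb_def[abs_def])
    qed
  qed
qed

end
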